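(* Let $0<s<\frac12$ and $\Lambda\in\mathbb{N}$. Let $X^0\in\mathcal{R}^\Lambda$ and let $X^\infty$ be the unique (up to permutations of the indices) configuration in $\mathcal{C}^\Lambda$ having the same barycenter as $X^0$, i.e. $\mathrm{bar}(X^\infty)=\mathrm{bar}(X^0)$. Then, denoting by $X=X(t)$ the unique solution to the Cauchy problem $$\dot X(t)=-\nabla\mathcal{E}^s(X(t)),\qquad X(0)=X^0,$$ we have (for $t\ge0$) $$\mathrm{dist}(X(t),X^\infty)\le\mathrm{dist}(X^0,X^\infty)\,e^{-\gamma(s)\Lambda^{-2s}t},$$ where $\gamma(s)$ is the positive constant, depending only on $s$, in the Hessian lower bound $\langle\nabla^2\mathcal{E}^s(Y)h,h\rangle\ge\gamma(s)\Lambda^{-2s}|h|^2$, valid for every $Y\in\mathcal{R}^\Lambda$ with all entries in $(0,\Lambda)$ and every $h\in\mathbb{R}^\Lambda$ with $\sum_{\lambda=1}^\Lambda h_\lambda=0$.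
   Context: Let $\mathcal{X}^\Lambda:=[0,\Lambda)^\Lambda$; entries of $X=(x_1,\dots,x_\Lambda)\in\mathcal{X}^\Lambda$ need not be distinct. Let $\mathcal{S}(X):=\{x_1,\dots,x_\Lambda\}$, let $\mathcal{R}^\Lambda$ be the set of $X\in\mathcal{X}^\Lambda$ with pairwise distinct entries, and let $\mathcal{C}^\Lambda:=\{X\in\mathcal{R}^\Lambda:\ \mathcal{S}(X)=\{\tau,1+\tau,\dots,\Lambda-1+\tau\}\text{ for some }\tau\in[0,1)\}$. Let $|t|_{\rm per}:=\min_{z\in\mathbb{Z}}|t+\Lambda z|$. For $X\in\mathcal{X}^\Lambda$, $X^{\rm ord}=(x_1^{\rm ord},\dots,x_\Lambda^{\rm ord})$ is the non-decreasing reordering of the entries of $X$. For $X,Y\in\mathcal{X}^\Lambda$, $$\mathrm{dist}(X,Y):=\Big(\sum_{\lambda=1}^\Lambda|x^{\rm ord}_\lambda-y^{\rm ord}_\lambda|_{\rm per}^2\Big)^{1/2}.$$ The barycenter is $\mathrm{bar}(X):=(X\cdot e)/\mathbb{Z}$, i.e. $X\cdot e$ taken modulo $\mathbb{Z}$, where $e:=\Lambda^{-1/2}\sum_{\lambda=1}^\Lambda e_\lambda$ and $\{e_\lambda\}$ is the canonical basis of $\mathbb{R}^\Lambda$. Let $\mu^X:=\sum_{\lambda=1}^{\Lambda}\sum_{k\in\mathbb{Z}}\delta_{x_\lambda+\Lambda k}$, and let $u^X\in BV_{\rm loc}(\mathbb{R})$ be the function, unique up to additive constants and $\Lambda$-periodic,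 whose distributional derivative is $(u^X)'=\mathrm{d}x-\mu^X$. For $0<s<\frac12$, $$\mathcal{E}^s(X):=\frac12\int_0^\Lambda \mathrm{d}x\int_{\mathbb{R}}\frac{|u^X(x)-u^X(y)|^2}{|x-y|^{1+2s}}\,\mathrm{d}y .$$ Gradient and Hessian are taken with respect to $(x_1,\dots,x_\Lambda)$, positions being read modulo $\Lambda$, and the differential equation is understood for the $\Lambda$-periodic extension of the configuration: each particle of the periodic configuration moves continuously on $\mathbb{R}$. The solution with initial datum in $\mathcal{R}^\Lambda$ exists, is unique and stays in $\mathcal{R}^\Lambda$ for all $t\in[0,+\infty)$.
   Formalization: The barycenter X·e is taken modulo √Λ (mean of positions modulo 1) instead of modulo 1, and dist is the minimum of the stated formula over cyclic relabellings of the ordered entries of the second configuration; with the literal definitions the decay fails for Λ=2. *)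

theory Defs
  imports "HOL-Analysis.Analysis" "HOL-Combinatorics.Permutations" "HOL-Library.Real_Mod"
begin

text \<open>
  The number of particles and the period are both \<open>\<Lambda>\<close>. A configuration is a function
  \<open>nat \<Rightarrow> real\<close> of which only the entries with index below \<open>\<Lambda>\<close> matter; the indices
  \<open>1, \<dots>, \<Lambda>\<close> are written \<open>0, \<dots>, \<Lambda> - 1\<close>. (The dimension is not a type because the constant in
  the Hessian bound has to be independent of \<open>\<Lambda>\<close>.)
\<close>

definition configs :: "nat \<Rightarrow> (nat \<Rightarrow> real) set" where
  "configs \<Lambda> = {..<\<Lambda>} \<rightarrow> {0..<real \<Lambda>}"

definition reg_configs :: "nat \<Rightarrow> (nat \<Rightarrow> real) set" where
  "reg_configs \<Lambda> = {X \<in> configs \<Lambda>. inj_on X {..<\<Lambda>}}"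

definition crystals :: "nat \<Rightarrow> (nat \<Rightarrow> real) set" where
  "crystals \<Lambda> = {X \<in> reg_configs \<Lambda>.
     \<exists>\<tau>\<in>{0..<1}. X ` {..<\<Lambda>} = (\<lambda>j. real j + \<tau>) ` {..<\<Lambda>}}"

definition per_abs :: "nat \<Rightarrow> real \<Rightarrow> real" where
  "per_abs \<Lambda> t = (INF z::int. \<bar>t + real \<Lambda> * of_int z\<bar>)"

definition ord_config :: "nat \<Rightarrow> (nat \<Rightarrow> real) \<Rightarrow> nat \<Rightarrow> real" where
  "ord_config \<Lambda> X i = sort (map X [0..<\<Lambda>]) ! i"

text \<open>
  The term \<open>k = 0\<close> compares the entries in increasing order. On the circle of length \<open>\<Lambda>\<close>
  there is no first entry: which one comes first depends on the cut at \<open>0\<close>. The minimum over the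
  cyclic relabellings \<open>k\<close> of \<open>Y\<close> removes this dependence. With \<open>k = 0\<close> alone the exponential
  decay fails: for \<open>\<Lambda> = 2\<close> and \<open>0 < \<delta> < 1 / 2\<close> the solution starting from \<open>(1 + \<delta>, 2 - \<delta>)\<close>
  converges to \<open>(1, 2)\<close>, that is, modulo \<open>\<Lambda>\<close>, to the configuration \<open>(0, 1)\<close>, but the \<open>k = 0\<close>
  term of its distance to \<open>(0, 1)\<close> increases from \<open>sqrt 2 * (1 - \<delta>)\<close> to \<open>sqrt 2\<close>.
\<close>
definition config_dist :: "nat \<Rightarrow> (nat \<Rightarrow> real) \<Rightarrow> (nat \<Rightarrow> real) \<Rightarrow> real" where
  "config_dist \<Lambda> X Y = (MIN k\<in>{..<\<Lambda>}.
     sqrt (\<Sum>i<\<Lambda>. (per_abs \<Lambda> (ord_config \<Lambda> X i - ord_config \<Lambda> Y ((i + k) mod \<Lambda>)))\<^sup>2))"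

text \<open>
  The barycenter is \<open>X \<cdot> e\<close> with the unit vector \<open>e = \<Lambda>\<^sup>-\<^sup>1\<^sup>/\<^sup>2 (1, \<dots>, 1)\<close>, represented in
  \<open>[0, sqrt \<Lambda>)\<close>. Moving one particle by a period changes \<open>X \<cdot> e\<close> by \<open>sqrt \<Lambda>\<close>, so the
  barycenter of a configuration on the circle is defined modulo \<open>sqrt \<Lambda>\<close> (equivalently, the mean
  of the entries is defined modulo \<open>1\<close>). For \<open>\<Lambda> \<ge> 2\<close>, \<open>X \<cdot> e\<close> modulo \<open>1\<close> would not determine an
  element of \<open>crystals\<close> up to permutation, and would in general not be invariant under such moves.
\<close>
definition bar :: "nat \<Rightarrow> (nat \<Rightarrow> real) \<Rightarrow> real" where
  "bar \<Lambda> X = (\<Sum>i<\<Lambda>. X i * (1 / sqrt (real \<Lambda>))) rmod sqrt (real \<Lambda>)"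

text \<open>The sum of the Dirac masses at all points \<open>X i + \<Lambda> k\<close>, counted with multiplicity.\<close>
definition particle_measure :: "nat \<Rightarrow> (nat \<Rightarrow> real) \<Rightarrow> real measure" where
  "particle_measure \<Lambda> X =
     distr (count_space ({..<\<Lambda>} \<times> (UNIV :: int set))) borel (\<lambda>(i, k). X i + real \<Lambda> * of_int k)"

text \<open>
  \<open>u\<close> is locally integrable with distributional derivative \<open>dx - \<mu>\<close>, tested against compactly
  supported \<open>C\<^sup>1\<close> functions \<open>\<phi>\<close>. As \<open>dx - \<mu>\<close> is a signed Radon measure, such a \<open>u\<close> is in
  \<open>BV\<^sub>l\<^sub>o\<^sub>c\<close>.
\<close>
definition is_potential :: "nat \<Rightarrow> (nat \<Rightarrow> real) \<Rightarrow> (real \<Rightarrow> real) \<Rightarrow> bool" where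
  "is_potential \<Lambda> X u \<longleftrightarrow>
     (\<forall>a b. set_integrable lborel {a..b} u) \<and>
     (\<forall>\<phi> \<phi>'. (\<forall>x. (\<phi> has_real_derivative \<phi>' x) (at x)) \<and> continuous_on UNIV \<phi>' \<and>
            (\<exists>r. \<forall>x. \<bar>x\<bar> > r \<longrightarrow> \<phi> x = 0) \<longrightarrow>
        - (LINT x|lborel. u x * \<phi>' x) =
          (LINT x|lborel. \<phi> x) - (LINT x|particle_measure \<Lambda> X. \<phi> x))"

text \<open>
  Such a \<open>u\<close> is unique almost everywhere up to an additive constant, and the energy does not
  depend on the choice. The energy is defined for all \<open>X\<close> with real entries and depends on them
  only modulo \<open>\<Lambda>\<close>.
\<close>
definition potential :: "nat \<Rightarrow> (nat \<Rightarrow> real) \<Rightarrow> real \<Rightarrow> real" where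
  "potential \<Lambda> X = (SOME u. is_potential \<Lambda> X u)"

definition energy :: "real \<Rightarrow> nat \<Rightarrow> (nat \<Rightarrow> real) \<Rightarrow> real" where
  "energy s \<Lambda> X = 1 / 2 * (LINT x:{0..real \<Lambda>}|lborel. (LINT y|lborel.
     \<bar>potential \<Lambda> X x - potential \<Lambda> X y\<bar>\<^sup>2 / \<bar>x - y\<bar> powr (1 + 2 * s)))"

definition partial :: "nat \<Rightarrow> ((nat \<Rightarrow> real) \<Rightarrow> real) \<Rightarrow> (nat \<Rightarrow> real) \<Rightarrow> real" where
  "partial i F X = deriv (\<lambda>r. F (X(i := r))) (X i)"

definition hessian_bound :: "real \<Rightarrow> real \<Rightarrow> bool" where
  "hessian_bound s \<gamma> \<longleftrightarrow>
     (\<forall>\<Lambda>\<ge>1. \<forall>Y\<in>reg_configs \<Lambda>. (\<forall>i<\<Lambda>. 0 < Y i) \<longrightarrow>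
        (\<forall>h::nat \<Rightarrow> real. (\<Sum>i<\<Lambda>. h i) = 0 \<longrightarrow>
           (\<Sum>i<\<Lambda>. \<Sum>j<\<Lambda>. partial i (partial j (energy s \<Lambda>)) Y * h j * h i)
             \<ge> \<gamma> * real \<Lambda> powr (- 2 * s) * (\<Sum>i<\<Lambda>. (h i)\<^sup>2)))"

definition wrap :: "nat \<Rightarrow> (nat \<Rightarrow> real) \<Rightarrow> nat \<Rightarrow> real" where
  "wrap \<Lambda> X i = X i rmod real \<Lambda>"

text \<open>
  \<open>X t i\<close> is the position on the whole real line of the particle labelled \<open>i\<close>, which moves
  continuously and may leave \<open>[0, \<Lambda>)\<close>; the configuration at time \<open>t\<close> is \<open>wrap \<Lambda> (X t)\<close>.
\<close>
definition gradient_flow ::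
  "real \<Rightarrow> nat \<Rightarrow> (nat \<Rightarrow> real) \<Rightarrow> (real \<Rightarrow> nat \<Rightarrow> real) \<Rightarrow> bool" where
  "gradient_flow s \<Lambda> X0 X \<longleftrightarrow>
     (\<forall>i<\<Lambda>. X 0 i = X0 i) \<and>
     (\<forall>t\<ge>0. wrap \<Lambda> (X t) \<in> reg_configs \<Lambda>) \<and>
     (\<forall>t\<ge>0. \<forall>i<\<Lambda>.
        ((\<lambda>r. X r i) has_real_derivative - partial i (energy s \<Lambda>) (X t)) (at t within {0..}))"

end

theory Submission
  imports Defs
begin

text \<open>
  Up to a constant, the potential of \<open>X\<close> is the sum of the sawtooth functions \<open>frac ((x - X\<^sub>i) / \<Lambda>)\<close>.
  Substituting \<open>y = x + h\<close> and folding the kernel over the periods turns the energy into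
  \<open>1/2 \<Sum> G (X\<^sub>i - X\<^sub>j)\<close>, where \<open>G\<close> is even and \<open>\<Lambda>\<close>-periodic and
  \<open>G t = \<integral>\<^sub>0\<^sup>\<Lambda> w(h) (max 0 (h - t) + max 0 (h - \<Lambda> + t) - h\<^sup>2/\<Lambda>) dh\<close> for \<open>0 \<le> t < \<Lambda>\<close>,
  \<open>w\<close> being the folded kernel.
  Hence \<open>G'' t = w t + w (\<Lambda> - t) \<ge> 2 \<Lambda>\<^sup>-\<^sup>1\<^sup>-\<^sup>2\<^sup>s\<close>, which gives the Hessian bound with \<open>\<gamma> = 2\<close>.

  The particles never collide, so their cyclic order is preserved and the flow stays in a convex set
  on which the energy is strongly convex modulo translations. That set contains the lift of the
  crystal with the same sum of positions, a critical point, and Gronwall's inequality gives the decay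
  of the Euclidean distance to this lift. Finally, among all matchings of the initial
  particles with the crystal on the circle, this lift realises the smallest cost.
\<close>

subsection \<open>Uniqueness of the potential\<close>

text \<open>The energy integrates a potential picked by \<open>SOME\<close>, so nothing can be
  computed before potentials are known to agree almost everywhere up to a constant. The folded
  kernel is not integrable: it blows up like \<open>h powr (- 1 - 2 * s)\<close> at \<open>0\<close>
  and symmetrically at \<open>L\<close>. Subtracting the mean overlap \<open>h\<^sup>2 / L\<close>
  leaves a factor that vanishes linearly at both ends, and \<open>h powr (- 2 * s)\<close> is
  integrable because \<open>s < 1 / 2\<close>. Differentiation under the integral would bring the
  singularity back, so differences of \<open>G\<close> are written with primitives of the kernel
  instead. The constant 2 counts the two kernels in the second derivative of \<open>G\<close>, each
  at least \<open>L powr (- 1 - 2 * s)\<close>; the remaining factor \<Lambda> comes from summing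
  \<open>(h i - h j)\<^sup>2\<close> over all pairs. Convexity lives on lifts to the line, while
  \<open>config_dist\<close> sees wrapped and sorted entries. The two comparisons differ in
  strength: at time \<open>t\<close> one good relabelling is enough, but at time 0 the lift has to
  beat every cyclic shift and every choice of windings, which works because the barycenters
  agree.\<close>

lemma AE_zero_if_integral_cbox_zero:
  fixes f :: "real \<Rightarrow> real"
  assumes f: "integrable lborel f" and z: "\<And>a b. (LINT x:{a..b}|lborel. f x) = 0"
    and out: "\<And>x. x < c \<Longrightarrow> f x = 0"
  shows "AE x in lborel. f x = 0"
proof (rule density_unique_real[OF f, where f' = "\<lambda>_. 0"])
  have si: "set_integrable lborel A f" if "A \<in> sets borel" for A
    using f that unfolding set_integrable_def by (intro integrable_mult_indicator) auto
  have tot: "(LINT x|lborel. f x) = 0"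
  proof -
    have "(\<lambda>n. LINT x:{c - real n..real n}|lborel. f x) \<longlonglongrightarrow> (LINT x:UNIV|lborel. f x)"
    proof -
      have U: "(\<Union>n. {c - real n..real n}) = (UNIV :: real set)"
      proof (safe; simp)
        fix x :: real
        obtain n where "real n \<ge> \<bar>x\<bar> + \<bar>c\<bar>" using real_arch_simple by blast
        then show "\<exists>n. c - real n \<le> x \<and> x \<le> real n" by (intro exI[of _ n]) linarith
      qed
      have "(\<lambda>n. LINT x:{c - real n..real n}|lborel. f x) \<longlonglongrightarrow>
          (LINT x:(\<Union>n. {c - real n..real n})|lborel. f x)"
        by (rule set_integral_cont_up) (auto simp: incseq_def intro!: si)
      then show ?thesis using U by simp
    qed
    then show ?thesis using z by (simp add: LIMSEQ_const_iff set_lebesgue_integral_def)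
  qed
  have gen: "sets (borel :: real measure) = sigma_sets UNIV (range atMost)"
    unfolding borel_eq_atMost by (simp add: sets_measure_of)
  have IS: "Int_stable (range (atMost :: real \<Rightarrow> real set))" by (auto simp: Int_stable_def)
  \<comment> \<open>Dynkin induction over the half-lines \<open>{..a}\<close>, which are stable
    under intersection. Vanishing to the left of \<open>c\<close> turns a half-line into a compact
    interval, and \<open>tot\<close> handles complements.\<close>
  have "(LINT x:A|lborel. f x) = 0" if "A \<in> sigma_sets UNIV (range atMost)" for A
  proof (rule sigma_sets_induct_disjoint[OF IS _ that])
    fix A :: "real set" assume "A \<in> range atMost"
    then obtain a where A: "A = {..a}" by auto
    have "(LINT x:A|lborel. f x) = (LINT x:{c..a}|lborel. f x)"
      unfolding A set_lebesgue_integral_def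
      by (rule Bochner_Integration.integral_cong) (use out in \<open>auto simp: indicator_def\<close>)
    then show "(LINT x:A|lborel. f x) = 0" using z by simp
  next
    fix A :: "real set" assume A': "A \<in> sigma_sets UNIV (range atMost)" "(LINT x:A|lborel. f x) = 0"
    have A: "A \<in> sets borel" using A' gen by simp
    have "(LINT x:A \<union> (UNIV - A)|lborel. f x) = (LINT x:A|lborel. f x) + (LINT x:UNIV - A|lborel. f x)"
      using A by (intro set_integral_Un si) auto
    then show "(LINT x:UNIV - A|lborel. f x) = 0" using tot A' by (simp add: set_lebesgue_integral_def)
  next
    fix A :: "nat \<Rightarrow> real set"
    assume u: "disjoint_family A" "range A \<subseteq> sigma_sets UNIV (range atMost)"
      "\<And>i. (LINT x:A i|lborel. f x) = 0"
    have A: "range A \<subseteq> sets borel" using u gen by simp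
    have "(LINT x:(\<Union>i. A i)|lborel. f x) = (\<Sum>i. LINT x:A i|lborel. f x)"
      by (rule lebesgue_integral_countable_add)
         (use u A in \<open>auto simp: disjoint_family_on_def intro!: si\<close>)
    then show "(LINT x:(\<Union>i. A i)|lborel. f x) = 0" using u by simp
  qed (auto simp: set_lebesgue_integral_def)
  then show "\<And>A. A \<in> sets lborel \<Longrightarrow> (LINT x:A|lborel. f x) = (LINT x:A|lborel. 0)"
    using gen by (simp add: set_lebesgue_integral_def)
qed auto

definition locally_integrable :: "(real \<Rightarrow> real) \<Rightarrow> bool" where
  "locally_integrable f \<longleftrightarrow> (\<forall>a b. set_integrable lborel {a..b} f)"

lemma locally_integrable_measurable:
  assumes "locally_integrable f"
  shows "f \<in> borel_measurable lborel"
proof (rule borel_measurable_LIMSEQ_real)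
  show "(\<lambda>n. indicator {- real n..real n} x *\<^sub>R f x) \<longlonglongrightarrow> f x" for x
  proof (rule tendsto_eventually)
    obtain N where "real N \<ge> \<bar>x\<bar>" using real_arch_simple by blast
    then show "\<forall>\<^sub>F n in sequentially. indicator {- real n..real n} x *\<^sub>R f x = f x"
      by (intro eventually_sequentiallyI[of N]) (auto simp: indicator_def)
  qed
  show "(\<lambda>x. indicator {- real n..real n} x *\<^sub>R f x) \<in> borel_measurable lborel" for n
    using assms unfolding locally_integrable_def set_integrable_def
    by (blast dest: borel_measurable_integrable)
qed

lemma locally_integrable_mult_integrable:
  assumes f: "locally_integrable f" and [measurable]: "\<psi> \<in> borel_measurable borel"
    and B: "\<And>x. \<bar>\<psi> x\<bar> \<le> B" and supp: "\<And>x. \<bar>x\<bar> > r \<Longrightarrow> \<psi> x = 0"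
  shows "integrable lborel (\<lambda>x. f x * \<psi> x)"
proof (rule Bochner_Integration.integrable_bound)
  show "integrable lborel (\<lambda>x. B * (indicator {-r..r} x *\<^sub>R f x))"
    using f unfolding locally_integrable_def set_integrable_def by (intro integrable_mult_right) auto
  show "(\<lambda>x. f x * \<psi> x) \<in> borel_measurable lborel"
    using locally_integrable_measurable[OF f] by measurable
  have "\<bar>f x * \<psi> x\<bar> \<le> \<bar>B * (indicator {-r..r} x *\<^sub>R f x)\<bar>" for x
  proof (cases "\<bar>x\<bar> > r")
    case False
    have "\<bar>\<psi> x\<bar> \<le> \<bar>B\<bar>" using B[of x] by linarith
    then have "\<bar>f x\<bar> * \<bar>\<psi> x\<bar> \<le> \<bar>f x\<bar> * \<bar>B\<bar>" by (intro mult_left_mono) auto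
    with False show ?thesis by (auto simp: abs_mult indicator_def mult.commute)
  qed (simp add: supp)
  then show "AE x in lborel. norm (f x * \<psi> x) \<le> norm (B * (indicator {-r..r} x *\<^sub>R f x))" by simp
qed

lemma compact_support_bounded:
  fixes \<psi> :: "real \<Rightarrow> real"
  assumes "continuous_on UNIV \<psi>" "\<And>x. \<bar>x\<bar> > r \<Longrightarrow> \<psi> x = 0"
  obtains B where "\<And>x. \<bar>\<psi> x\<bar> \<le> B"
proof -
  have "bounded (\<psi> ` {-r..r})"
    by (intro compact_imp_bounded compact_continuous_image) (auto intro: continuous_on_subset[OF assms(1)])
  then obtain B where B: "\<And>x. x \<in> {-r..r} \<Longrightarrow> \<bar>\<psi> x\<bar> \<le> B"
    unfolding bounded_iff by (metis imageI real_norm_def)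
  have "\<bar>\<psi> x\<bar> \<le> max B 0" for x
  proof (cases "x \<in> {-r..r}")
    case True
    then show ?thesis using B[OF True] by linarith
  next
    case False
    then have "\<bar>x\<bar> > r" by auto
    then show ?thesis using assms(2) by simp
  qed
  then show thesis using that by blast
qed

lemma compact_support_integrable:
  fixes \<psi> :: "real \<Rightarrow> real"
  assumes "continuous_on UNIV \<psi>" "\<And>x. \<bar>x\<bar> > r \<Longrightarrow> \<psi> x = 0"
  shows "integrable lborel \<psi>"
proof -
  obtain B where "\<And>x. \<bar>\<psi> x\<bar> \<le> B" using compact_support_bounded[OF assms] by blast
  moreover have "locally_integrable (\<lambda>_. 1)"
    unfolding locally_integrable_def by (auto intro!: borel_integrable_atLeastAtMost')
  moreover have "\<psi> \<in> borel_measurable borel" by (intro borel_measurable_continuous_onI assms)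
  ultimately show ?thesis
    using locally_integrable_mult_integrable[of "\<lambda>_. 1" \<psi> B r] assms by simp
qed

lemma derivative_zero_outside:
  fixes \<phi> :: "real \<Rightarrow> real"
  assumes \<phi>: "\<And>x. (\<phi> has_real_derivative \<psi> x) (at x)" and s: "\<And>x. \<bar>x\<bar> > r \<Longrightarrow> \<phi> x = 0" and x: "\<bar>x\<bar> > r"
  shows "\<psi> x = 0"
proof -
  have "open {x :: real. \<bar>x\<bar> > r}" by (intro open_Collect_less continuous_intros)
  then have "((\<lambda>_. 0) has_real_derivative \<psi> x) (at x)"
    using s x by (intro has_field_derivative_transform_within_open[OF \<phi>]) auto
  then show ?thesis by (rule DERIV_unique) simp
qed

text \<open>Any primitive is constant on each side of the support, and the zero integral makes the
  two constants equal; subtracting the common value gives compact support.\<close>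

lemma zero_mean_primitive:
  fixes \<psi> :: "real \<Rightarrow> real"
  assumes cont: "continuous_on UNIV \<psi>" and supp: "\<And>x. \<bar>x\<bar> > r \<Longrightarrow> \<psi> x = 0"
    and zero: "(LINT x|lborel. \<psi> x) = 0"
  obtains \<phi> where "\<And>x. (\<phi> has_real_derivative \<psi> x) (at x)" "\<And>x. \<bar>x\<bar> > r \<Longrightarrow> \<phi> x = 0"
proof -
  have "\<exists>F. \<forall>x::real. (-\<infinity>::ereal) < x \<longrightarrow> ereal x < \<infinity> \<longrightarrow> (F has_vector_derivative \<psi> x) (at x)"
    using cont by (intro einterval_antiderivative) (auto simp: continuous_on_eq_continuous_at)
  then obtain F where F: "\<And>x. (F has_real_derivative \<psi> x) (at x)"
    by (auto simp: has_real_derivative_iff_has_vector_derivative)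
  have key: "F b = F a" if "\<bar>a\<bar> > r" "\<bar>b\<bar> > r" "a < b" for a b
  proof (cases "r < a \<or> b < - r")
    case True
    then have "\<psi> x = 0" if "x \<in> {a..b}" for x using that supp[of x] by auto
    moreover have "\<exists>z>a. z < b \<and> F b - F a = (b - a) * \<psi> z"
      using F \<open>a < b\<close> by (intro MVT2) auto
    ultimately show ?thesis by force
  next
    case False
    then have ab: "a < - r" "r < b" using that by linarith+
    have "(LINT x:{a..b}|lborel. \<psi> x) = F b - F a"
      unfolding set_lebesgue_integral_def real_scaleR_def
      using integral_FTC_Icc_real[of a b F \<psi>] that F cont
      by (simp add: continuous_on_eq_continuous_at mult.commute)
    moreover have "(LINT x:{a..b}|lborel. \<psi> x) = (LINT x|lborel. \<psi> x)"
      unfolding set_lebesgue_integral_def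
    proof (rule Bochner_Integration.integral_cong)
      fix x
      have "\<bar>x\<bar> > r" if "x \<notin> {a..b}" using that ab by auto
      then show "indicator {a..b} x *\<^sub>R \<psi> x = \<psi> x" using supp by (auto simp: indicator_def)
    qed simp
    ultimately show ?thesis using zero by simp
  qed
  \<comment> \<open>A reference point beyond the support whatever the sign of
    \<open>r\<close>.\<close>
  define c where "c = \<bar>r\<bar> + 1"
  have c: "\<bar>c\<bar> > r" by (simp add: c_def)
  have "F x - F c = 0" if "\<bar>x\<bar> > r" for x
    using key[of x c] key[of c x] that c by (cases x c rule: linorder_cases) auto
  moreover have "((\<lambda>x. F x - F c) has_real_derivative \<psi> x) (at x)" for x
    using F[of x] by (auto intro!: derivative_eq_intros)
  ultimately show thesis using that[of "\<lambda>x. F x - F c"] by blast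
qed

text \<open>Continuous trapezoids converge to the indicator of \<open>{a..b}\<close>, so by
  dominated convergence all integrals over compact intervals vanish.\<close>

lemma locally_integrable_zero_if_test_zero:
  assumes f: "locally_integrable f"
    and test: "\<And>\<psi> r. \<lbrakk>continuous_on UNIV \<psi>; \<And>x. \<bar>x\<bar> > r \<Longrightarrow> \<psi> x = 0\<rbrakk> \<Longrightarrow> (LINT x|lborel. f x * \<psi> x) = 0"
  shows "AE x in lborel. f x = 0"
proof -
  have Z: "(LINT x:{a..b}|lborel. f x) = 0" for a b
  proof (cases "a \<le> b")
    case True
    \<comment> \<open>The trapezoid is 1 on \<open>{a..b}\<close> and falls to 0 within distance
      \<open>1 / (n + 1)\<close>, so all supports lie in \<open>{a-1..b+1}\<close> and one
      dominating function serves every \<open>n\<close>.\<close>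
    define \<psi> where "\<psi> = (\<lambda>n x. max 0 (1 - real (Suc n) * max 0 (max (a - x) (x - b))))"
    define r where "r = \<bar>a\<bar> + \<bar>b\<bar> + 1"
    have supp: "\<psi> n x = 0" if x: "x \<notin> {a-1..b+1}" for n x
    proof -
      have "max 0 (max (a - x) (x - b)) \<ge> 1" using x by auto
      then have "1 * 1 \<le> real (Suc n) * max 0 (max (a - x) (x - b))" by (intro mult_mono) auto
      then show ?thesis unfolding \<psi>_def by simp
    qed
    have cont: "continuous_on UNIV (\<psi> n)" for n
      unfolding \<psi>_def by (intro continuous_intros)
    have [measurable]: "\<psi> n \<in> borel_measurable borel" for n
      by (intro borel_measurable_continuous_onI cont)
    have [measurable]: "f \<in> borel_measurable borel"
      using locally_integrable_measurable[OF f] by simp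
    have bd: "0 \<le> \<psi> n x" "\<psi> n x \<le> 1" for n x unfolding \<psi>_def by auto
    have "(\<lambda>n. LINT x|lborel. f x * \<psi> n x) \<longlonglongrightarrow> (LINT x|lborel. f x * indicator {a..b} x)"
    proof (rule integral_dominated_convergence[where w = "\<lambda>x. \<bar>indicator {a-1..b+1} x *\<^sub>R f x\<bar>"])
      show "integrable lborel (\<lambda>x. \<bar>indicator {a-1..b+1} x *\<^sub>R f x\<bar>)"
        using f unfolding locally_integrable_def set_integrable_def by (intro integrable_abs) auto
      have "(\<lambda>n. f x * \<psi> n x) \<longlonglongrightarrow> f x * indicator {a..b} x" for x
      proof (rule tendsto_mult[OF tendsto_const])
        define d where "d = max 0 (max (a - x) (x - b))"
        show "(\<lambda>n. \<psi> n x) \<longlonglongrightarrow> indicator {a..b} x"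
        proof (cases "x \<in> {a..b}")
          case True
          then have "\<psi> n x = 1" for n by (auto simp: \<psi>_def)
          with True show ?thesis by simp
        next
          case False
          then have d: "d > 0" by (auto simp: d_def)
          obtain N where N: "real N \<ge> 1 / d" using real_arch_simple by blast
          have "\<psi> n x = 0" if "n \<ge> N" for n
          proof -
            have "1 / d \<le> real (Suc n)" using N that by linarith
            then have "1 \<le> real (Suc n) * d" using d by (simp add: field_simps)
            then show ?thesis unfolding \<psi>_def d_def by simp
          qed
          then have "\<forall>\<^sub>F n in sequentially. \<psi> n x = 0" by (auto simp: eventually_sequentially)
          then show ?thesis using False by (simp add: tendsto_eventually)
        qed
      qed
      then show "AE x in lborel. (\<lambda>n. f x * \<psi> n x) \<longlonglongrightarrow> f x * indicator {a..b} x" by simp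
      have "\<bar>f x * \<psi> n x\<bar> \<le> \<bar>indicator {a-1..b+1} x *\<^sub>R f x\<bar>" for n x
      proof (cases "x \<in> {a-1..b+1}")
        case True
        have "\<bar>f x\<bar> * \<bar>\<psi> n x\<bar> \<le> \<bar>f x\<bar> * 1" using bd[of n x] by (intro mult_left_mono) auto
        then show ?thesis using True by (simp add: abs_mult)
      qed (simp add: supp)
      then show "AE x in lborel. norm (f x * \<psi> n x) \<le> \<bar>indicator {a-1..b+1} x *\<^sub>R f x\<bar>" for n by simp
    qed auto
    moreover have "(LINT x|lborel. f x * \<psi> n x) = 0" for n
      by (rule test[OF cont, of r]) (rule supp, auto simp: r_def)
    ultimately show ?thesis
      by (simp add: LIMSEQ_const_iff set_lebesgue_integral_def mult.commute)
  qed (simp add: set_lebesgue_integral_def)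
  \<comment> \<open>The truncations are integrable and vanish far to the left, as the Dynkin
    argument requires; countably many of them exhaust the line.\<close>
  have "AE x in lborel. indicator {- real n..real n} x *\<^sub>R f x = 0" for n
  proof (rule AE_zero_if_integral_cbox_zero)
    show "integrable lborel (\<lambda>x. indicator {- real n..real n} x *\<^sub>R f x)"
      using f unfolding locally_integrable_def set_integrable_def by auto
    show "indicator {- real n..real n} x *\<^sub>R f x = 0" if "x < - real n" for x using that by simp
    show "(LINT x:{a..b}|lborel. indicator {- real n..real n} x *\<^sub>R f x) = 0" for a b
    proof -
      have "(LINT x:{a..b}|lborel. indicator {- real n..real n} x *\<^sub>R f x) =
          (LINT x:{max a (- real n)..min b (real n)}|lborel. f x)"
        unfolding set_lebesgue_integral_def
        by (rule Bochner_Integration.integral_cong) (auto simp: indicator_def)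
      then show ?thesis using Z by simp
    qed
  qed
  then have "AE x in lborel. \<forall>n. indicator {- real n..real n} x *\<^sub>R f x = 0"
    unfolding AE_all_countable by blast
  then show ?thesis
  proof (rule AE_mp, intro AE_I2 impI)
    fix x :: real assume *: "\<forall>n. indicator {- real n..real n} x *\<^sub>R f x = 0"
    obtain n where "real n \<ge> \<bar>x\<bar>" using real_arch_simple by blast
    then show "f x = 0" using *[rule_format, of n] by (auto simp: indicator_def split: if_splits)
  qed
qed

text \<open>Subtracting a multiple of a fixed bump \<open>\<rho>\<close> from a test function makes
  its integral zero, hence makes it the derivative of a test function, on which \<open>f\<close>
  vanishes. The constant is therefore the \<open>\<rho>\<close>-weighted mean of
  \<open>f\<close>.\<close>

lemma du_Bois_Reymond:
  assumes f: "locally_integrable f"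
    and test: "\<And>\<phi> \<psi> r. \<lbrakk>\<And>x. (\<phi> has_real_derivative \<psi> x) (at x); continuous_on UNIV \<psi>;
      \<And>x. \<bar>x\<bar> > r \<Longrightarrow> \<phi> x = 0\<rbrakk> \<Longrightarrow> (LINT x|lborel. f x * \<psi> x) = 0"
  shows "\<exists>c. AE x in lborel. f x = c"
proof -
  define \<rho> :: "real \<Rightarrow> real" where "\<rho> = (\<lambda>x. max 0 (1 - \<bar>x\<bar>))"
  have \<rho>c: "continuous_on UNIV \<rho>" unfolding \<rho>_def by (intro continuous_intros)
  have \<rho>s: "\<rho> x = 0" if "\<bar>x\<bar> > 1" for x using that by (simp add: \<rho>_def)
  have \<rho>i: "integrable lborel \<rho>" using compact_support_integrable[OF \<rho>c \<rho>s] by blast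
  define I where "I = (LINT x|lborel. \<rho> x)"
  have "I \<noteq> 0"
  proof
    assume "I = 0"
    have "(LINT x|lborel. indicator {-1/2..1/2::real} x / (2::real)) \<le> I" unfolding I_def
    proof (rule integral_mono)
      show "integrable lborel (\<lambda>x. indicator {-1/2..1/2::real} x / (2::real))"
        by (intro integrable_divide integrable_real_indicator) auto
    qed (use \<rho>i in \<open>auto simp: indicator_def \<rho>_def\<close>)
    then show False using \<open>I = 0\<close> by simp
  qed
  define c where "c = (LINT x|lborel. f x * \<rho> x) / I"
  have "AE x in lborel. f x - c = 0"
  proof (rule locally_integrable_zero_if_test_zero)
    show "locally_integrable (\<lambda>x. f x - c)"
      using f unfolding locally_integrable_def
      by (auto intro!: set_integral_diff(1) borel_integrable_atLeastAtMost'[of _ _ "\<lambda>_. c"])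
    fix \<psi> :: "real \<Rightarrow> real" and r
    assume \<psi>c: "continuous_on UNIV \<psi>" and \<psi>s: "\<And>x. \<bar>x\<bar> > r \<Longrightarrow> \<psi> x = 0"
    have \<psi>i: "integrable lborel \<psi>" using compact_support_integrable[OF \<psi>c \<psi>s] by blast
    define J where "J = (LINT x|lborel. \<psi> x)"
    define \<eta> where "\<eta> = (\<lambda>x. \<psi> x - J / I * \<rho> x)"
    have \<eta>c: "continuous_on UNIV \<eta>" unfolding \<eta>_def using \<psi>c \<rho>c by (intro continuous_intros)
    have \<eta>s: "\<eta> x = 0" if "\<bar>x\<bar> > max r 1" for x using \<psi>s \<rho>s that by (simp add: \<eta>_def)
    have "(LINT x|lborel. \<eta> x) = 0"
      unfolding \<eta>_def using \<psi>i \<rho>i \<open>I \<noteq> 0\<close> by (simp add: I_def[symmetric] J_def[symmetric])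
    then obtain \<phi> where \<phi>: "\<And>x. (\<phi> has_real_derivative \<eta> x) (at x)" "\<And>x. \<bar>x\<bar> > max r 1 \<Longrightarrow> \<phi> x = 0"
      using zero_mean_primitive[OF \<eta>c \<eta>s] by metis
    have 0: "(LINT x|lborel. f x * \<eta> x) = 0" by (rule test[OF \<phi>(1) \<eta>c \<phi>(2)])
    obtain B B' where "\<And>x. \<bar>\<psi> x\<bar> \<le> B" "\<And>x. \<bar>\<rho> x\<bar> \<le> B'"
      using compact_support_bounded[OF \<psi>c \<psi>s] compact_support_bounded[OF \<rho>c \<rho>s] by metis
    then have i: "integrable lborel (\<lambda>x. f x * \<psi> x)" "integrable lborel (\<lambda>x. f x * \<rho> x)"
      using locally_integrable_mult_integrable[OF f borel_measurable_continuous_onI[OF \<psi>c] _ \<psi>s, of B]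
        locally_integrable_mult_integrable[OF f borel_measurable_continuous_onI[OF \<rho>c] _ \<rho>s, of B']
      by auto
    have "(LINT x|lborel. f x * \<eta> x) = (LINT x|lborel. f x * \<psi> x - J / I * (f x * \<rho> x))"
      unfolding \<eta>_def by (simp add: algebra_simps)
    also have "\<dots> = (LINT x|lborel. f x * \<psi> x) - J / I * (LINT x|lborel. f x * \<rho> x)"
      using i by simp
    finally have "(LINT x|lborel. f x * \<psi> x) = c * J" using 0 by (simp add: c_def)
    then show "(LINT x|lborel. (f x - c) * \<psi> x) = 0"
      using i \<psi>i by (simp add: left_diff_distrib J_def)
  qed
  then show ?thesis by auto
qed

lemma potential_unique:
  assumes "is_potential \<Lambda> X u" "is_potential \<Lambda> X v"
  shows "\<exists>c. AE x in lborel. u x = v x + c"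
proof -
  have li: "locally_integrable u" "locally_integrable v"
    using assms by (auto simp: is_potential_def locally_integrable_def)
  have "\<exists>c. AE x in lborel. u x - v x = c"
  proof (rule du_Bois_Reymond)
    show "locally_integrable (\<lambda>x. u x - v x)"
      using li unfolding locally_integrable_def by (auto intro!: set_integral_diff)
    fix \<phi> \<psi> :: "real \<Rightarrow> real" and r
    assume \<phi>: "\<And>x. (\<phi> has_real_derivative \<psi> x) (at x)" and c: "continuous_on UNIV \<psi>"
      and s: "\<And>x. \<bar>x\<bar> > r \<Longrightarrow> \<phi> x = 0"
    have \<psi>s: "\<psi> x = 0" if "\<bar>x\<bar> > r" for x using derivative_zero_outside[OF \<phi> s that] .
    obtain B where B: "\<And>x. \<bar>\<psi> x\<bar> \<le> B" using compact_support_bounded[OF c \<psi>s] by blast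
    have i: "integrable lborel (\<lambda>x. u x * \<psi> x)" "integrable lborel (\<lambda>x. v x * \<psi> x)"
      using li B \<psi>s borel_measurable_continuous_onI[OF c]
      by (auto intro!: locally_integrable_mult_integrable)
    have "(\<forall>x. (\<phi> has_real_derivative \<psi> x) (at x)) \<and> continuous_on UNIV \<psi> \<and>
        (\<exists>r. \<forall>x. \<bar>x\<bar> > r \<longrightarrow> \<phi> x = 0)"
      using \<phi> c s by blast
    then have "- (LINT x|lborel. u x * \<psi> x) = - (LINT x|lborel. v x * \<psi> x)"
      using assms unfolding is_potential_def by (metis (no_types))
    then show "(LINT x|lborel. (u x - v x) * \<psi> x) = 0"
      using i by (simp add: left_diff_distrib)
  qed
  then obtain c where "AE x in lborel. u x - v x = c" by blast
  then show ?thesis by (intro exI[of _ c]) (auto elim: eventually_mono)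
qed

subsection \<open>The sawtooth potential\<close>

text \<open>Each tooth has slope \<open>1 / \<Lambda>\<close> and drops by 1 at the points
  \<open>X i + \<Lambda> k\<close>. As there are as many teeth as units in the period, the total
  slope is 1 and the derivative is \<open>dx\<close> minus the particle measure.\<close>

definition sawtooth_sum :: "nat \<Rightarrow> (nat \<Rightarrow> real) \<Rightarrow> real \<Rightarrow> real" where
  "sawtooth_sum \<Lambda> X x = (\<Sum>i<\<Lambda>. frac ((x - X i) / real \<Lambda>))"

lemma frac_measurable [measurable]: "(frac :: real \<Rightarrow> real) \<in> borel_measurable borel"
  unfolding frac_def[abs_def] by measurable

lemma sawtooth_sum_measurable [measurable]: "sawtooth_sum \<Lambda> X \<in> borel_measurable borel"
  unfolding sawtooth_sum_def[abs_def] by measurable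

lemma sawtooth_sum_bounds: "0 \<le> sawtooth_sum \<Lambda> X x" "sawtooth_sum \<Lambda> X x \<le> real \<Lambda>"
proof -
  have "sawtooth_sum \<Lambda> X x \<le> (\<Sum>i<\<Lambda>. 1)"
    unfolding sawtooth_sum_def by (intro sum_mono) (simp add: frac_lt_1 less_imp_le)
  then show "sawtooth_sum \<Lambda> X x \<le> real \<Lambda>" by simp
  show "0 \<le> sawtooth_sum \<Lambda> X x"
    unfolding sawtooth_sum_def by (intro sum_nonneg) simp
qed

text \<open>Integration by parts on one tooth: the integrand is the derivative of
  \<open>(x - a) / L * \<phi> x\<close>. The surviving boundary value at the right end is the
  contribution of one Dirac mass.\<close>

lemma has_integral_sawtooth_period:
  fixes \<phi> \<psi> :: "real \<Rightarrow> real"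
  assumes L: "L > 0" and \<phi>: "\<And>x. (\<phi> has_real_derivative \<psi> x) (at x)"
  shows "((\<lambda>x. frac ((x - p) / L) * \<psi> x + \<phi> x / L) has_integral \<phi> (p + of_int (k + 1) * L))
    {p + of_int k * L..p + of_int (k + 1) * L}"
proof -
  define a where "a = p + of_int k * L"
  have b: "p + of_int (k + 1) * L = a + L" by (simp add: a_def algebra_simps)
  have "((\<lambda>x. (x - a) / L * \<psi> x + \<phi> x / L) has_integral
      (\<lambda>x. (x - a) / L * \<phi> x) (a + L) - (\<lambda>x. (x - a) / L * \<phi> x) a) {a..a + L}"
  proof (rule fundamental_theorem_of_calculus)
    show "((\<lambda>x. (x - a) / L * \<phi> x) has_vector_derivative (x - a) / L * \<psi> x + \<phi> x / L) (at x within {a..a + L})" for x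
      unfolding has_real_derivative_iff_has_vector_derivative[symmetric]
      using L by (auto intro!: derivative_eq_intros DERIV_subset[OF \<phi>] simp: field_simps)
  qed (use L in simp)
  then have "((\<lambda>x. (x - a) / L * \<psi> x + \<phi> x / L) has_integral \<phi> (a + L)) {a..a + L}"
    using L by simp
  then have "((\<lambda>x. frac ((x - p) / L) * \<psi> x + \<phi> x / L) has_integral \<phi> (a + L)) {a..a + L}"
  proof (rule has_integral_spike_finite[rotated 2])
    \<comment> \<open>The right endpoint is excluded because \<open>frac\<close> has already jumped
      back to 0 there.\<close>
    fix x assume x: "x \<in> {a..a + L} - {a + L}"
    have "frac ((x - p) / L) = (x - a) / L"
      unfolding frac_unique_iff
    proof (intro conjI)
      have "(x - p) / L - (x - a) / L = of_int k" using L by (simp add: a_def field_simps)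
      then show "(x - p) / L - (x - a) / L \<in> \<int>" by simp
    qed (use x L in auto)
    then show "frac ((x - p) / L) * \<psi> x + \<phi> x / L = (x - a) / L * \<psi> x + \<phi> x / L" by simp
  qed simp
  then show ?thesis unfolding b by (simp add: a_def)
qed

lemma has_integral_sawtooth_periods:
  fixes \<phi> \<psi> :: "real \<Rightarrow> real"
  assumes L: "L > 0" and \<phi>: "\<And>x. (\<phi> has_real_derivative \<psi> x) (at x)"
  shows "((\<lambda>x. frac ((x - p) / L) * \<psi> x + \<phi> x / L) has_integral
      (\<Sum>k = m + 1..m + int n. \<phi> (p + of_int k * L))) {p + of_int m * L..p + of_int (m + int n) * L}"
proof (induction n)
  case (Suc n)
  have "((\<lambda>x. frac ((x - p) / L) * \<psi> x + \<phi> x / L) has_integral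
      (\<Sum>k = m + 1..m + int n. \<phi> (p + of_int k * L)) + \<phi> (p + of_int (m + int n + 1) * L))
      {p + of_int m * L..p + of_int (m + int n + 1) * L}"
    by (rule has_integral_combine[OF _ _ Suc has_integral_sawtooth_period[OF L \<phi>]])
      (use L in \<open>auto intro!: mult_right_mono\<close>)
  moreover have "{m + 1..m + int (Suc n)} = insert (m + int n + 1) {m + 1..m + int n}" by auto
  ultimately show ?case by (simp add: algebra_simps)
qed auto

lemma integral_sawtooth_derivative:
  fixes \<phi> \<psi> :: "real \<Rightarrow> real"
  assumes L: "L > 0" and \<phi>: "\<And>x. (\<phi> has_real_derivative \<psi> x) (at x)" and c: "continuous_on UNIV \<psi>"
    and s: "\<And>x. \<bar>x\<bar> > r \<Longrightarrow> \<phi> x = 0" and N: "(real N - 1) * L > \<bar>r\<bar> + \<bar>p\<bar>"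
  shows "integrable lborel (\<lambda>x. frac ((x - p) / L) * \<psi> x)"
    and "- (LINT x|lborel. frac ((x - p) / L) * \<psi> x) =
      (LINT x|lborel. \<phi> x) / L - (\<Sum>k = - int N..int N. \<phi> (p + of_int k * L))"
proof -
  have \<psi>s: "\<psi> x = 0" if "\<bar>x\<bar> > r" for x using derivative_zero_outside[OF \<phi> s that] .
  have \<phi>c: "continuous_on UNIV \<phi>"
    using \<phi> by (auto simp: continuous_on_eq_continuous_at intro: DERIV_isCont)
  obtain B where B: "\<And>x. \<bar>\<psi> x\<bar> \<le> B" using compact_support_bounded[OF c \<psi>s] by blast
  have li: "locally_integrable (\<lambda>x. frac ((x - p) / L))"
    unfolding locally_integrable_def set_integrable_def
  proof (intro allI)
    fix a b
    show "integrable lborel (\<lambda>x. indicator {a..b} x *\<^sub>R frac ((x - p) / L))"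
    proof (rule Bochner_Integration.integrable_bound)
      show "integrable lborel (indicator {a..b} :: real \<Rightarrow> real)"
        by (auto simp: emeasure_lborel_Icc_eq)
      show "AE x in lborel. norm (indicator {a..b} x *\<^sub>R frac ((x - p) / L)) \<le> norm (indicator {a..b} x :: real)"
        by (auto simp: indicator_def frac_lt_1 less_imp_le)
    qed measurable
  qed
  show i: "integrable lborel (\<lambda>x. frac ((x - p) / L) * \<psi> x)"
    by (rule locally_integrable_mult_integrable[OF li _ B \<psi>s])
      (intro borel_measurable_continuous_onI c)
  have \<phi>i: "integrable lborel \<phi>" using compact_support_integrable[OF \<phi>c s] by blast
  define D where "D = {p - real N * L..p + real N * L}"
  have D: "x \<in> D" if "\<bar>x\<bar> \<le> r" for x
  proof -
    have "\<bar>x\<bar> + \<bar>p\<bar> \<le> \<bar>r\<bar> + \<bar>p\<bar>" using that by linarith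
    also have "\<dots> \<le> real N * L" using N L by (simp add: algebra_simps)
    finally show ?thesis unfolding D_def by auto
  qed
  have f0: "frac ((x - p) / L) * \<psi> x + \<phi> x / L = 0" if "x \<notin> D" for x
    using D[of x] that s[of x] \<psi>s[of x] by fastforce
  have "((\<lambda>x. frac ((x - p) / L) * \<psi> x + \<phi> x / L) has_integral
      (\<Sum>k = - int N + 1..int N. \<phi> (p + of_int k * L))) D"
    using has_integral_sawtooth_periods[OF L \<phi>, of p "- int N" "2 * N"] by (simp add: D_def)
  then have "((\<lambda>x. frac ((x - p) / L) * \<psi> x + \<phi> x / L) has_integral
      (\<Sum>k = - int N + 1..int N. \<phi> (p + of_int k * L))) UNIV"
    by (rule has_integral_on_superset) (use f0 in auto)
  moreover have "((\<lambda>x. frac ((x - p) / L) * \<psi> x + \<phi> x / L) has_integral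
      (LINT x|lborel. frac ((x - p) / L) * \<psi> x + \<phi> x / L)) UNIV"
    using i \<phi>i by (intro has_integral_integral_lborel) auto
  ultimately have "(LINT x|lborel. frac ((x - p) / L) * \<psi> x + \<phi> x / L) =
      (\<Sum>k = - int N + 1..int N. \<phi> (p + of_int k * L))"
    by (rule has_integral_unique[rotated])
  \<comment> \<open>Adding up 2 N teeth yields right endpoints only, so the sum starts at
    \<open>- N + 1\<close>; the term \<open>- N\<close> lies outside the support and makes the range
    symmetric.\<close>
  moreover have "\<phi> (p + of_int (- int N) * L) = 0"
  proof (rule s)
    have "(real N - 1) * L \<le> real N * L" using L by simp
    then have "real N * L > \<bar>r\<bar> + \<bar>p\<bar>" using N by linarith
    then have "real N * L - p > r" by linarith
    then show "\<bar>p + of_int (- int N) * L\<bar> > r" by simp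
  qed
  moreover have "{- int N..int N} = insert (- int N) {- int N + 1..int N}" by auto
  ultimately show "- (LINT x|lborel. frac ((x - p) / L) * \<psi> x) =
      (LINT x|lborel. \<phi> x) / L - (\<Sum>k = - int N..int N. \<phi> (p + of_int k * L))"
    using i \<phi>i by simp
qed

lemma integral_particle_measure:
  fixes \<phi> :: "real \<Rightarrow> real"
  assumes [measurable]: "\<phi> \<in> borel_measurable borel"
    and s: "\<And>i k. i < \<Lambda> \<Longrightarrow> \<bar>k\<bar> > int N \<Longrightarrow> \<phi> (X i + of_int k * real \<Lambda>) = 0"
  shows "(LINT x|particle_measure \<Lambda> X. \<phi> x) = (\<Sum>i<\<Lambda>. \<Sum>k = - int N..int N. \<phi> (X i + of_int k * real \<Lambda>))"
proof -
  define F where "F = (\<lambda>(i, k :: int). \<phi> (X i + of_int k * real \<Lambda>))"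
  have "(LINT x|particle_measure \<Lambda> X. \<phi> x) = (LINT y|count_space ({..<\<Lambda>} \<times> (UNIV :: int set)). F y)"
    unfolding particle_measure_def F_def
    by (subst integral_distr) (auto simp: case_prod_beta mult.commute intro!: Bochner_Integration.integral_cong)
  also have "\<dots> = (\<Sum>y\<in>{..<\<Lambda>} \<times> {- int N..int N}. F y)"
  proof -
    have "{y \<in> {..<\<Lambda>} \<times> (UNIV :: int set). F y \<noteq> 0} \<subseteq> {..<\<Lambda>} \<times> {- int N..int N}"
      using s by (force simp: F_def)
    then show ?thesis
      by (subst lebesgue_integral_count_space_finite_support)
        (auto intro: finite_subset intro!: sum.mono_neutral_left)
  qed
  also have "\<dots> = (\<Sum>i<\<Lambda>. \<Sum>k = - int N..int N. F (i, k))"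
    by (simp add: sum.cartesian_product)
  finally show ?thesis by (simp add: F_def)
qed

lemma is_potential_sawtooth_sum:
  assumes "\<Lambda> \<ge> 1"
  shows "is_potential \<Lambda> X (sawtooth_sum \<Lambda> X)"
  unfolding is_potential_def
proof (intro conjI allI impI)
  fix a b :: real
  show "set_integrable lborel {a..b} (sawtooth_sum \<Lambda> X)"
    unfolding set_integrable_def
  proof (rule Bochner_Integration.integrable_bound)
    show "integrable lborel (\<lambda>x. real \<Lambda> * indicator {a..b} x)"
      by (intro integrable_mult_right) (auto simp: emeasure_lborel_Icc_eq)
    show "AE x in lborel. norm (indicator {a..b} x *\<^sub>R sawtooth_sum \<Lambda> X x)
        \<le> norm (real \<Lambda> * indicator {a..b} x :: real)"
      using sawtooth_sum_bounds[of \<Lambda> X] by (auto simp: indicator_def)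
  qed measurable
next
  fix \<phi> \<psi> :: "real \<Rightarrow> real"
  assume "(\<forall>x. (\<phi> has_real_derivative \<psi> x) (at x)) \<and> continuous_on UNIV \<psi> \<and> (\<exists>r. \<forall>x. \<bar>x\<bar> > r \<longrightarrow> \<phi> x = 0)"
  then obtain r where \<phi>: "\<And>x. (\<phi> has_real_derivative \<psi> x) (at x)" and c: "continuous_on UNIV \<psi>"
    and s: "\<And>x. \<bar>x\<bar> > r \<Longrightarrow> \<phi> x = 0" by auto
  define L where "L = real \<Lambda>"
  have L: "L > 0" "L \<ge> 1" using assms by (auto simp: L_def)
  obtain M where M: "real M > \<bar>r\<bar> + (\<Sum>i<\<Lambda>. \<bar>X i\<bar>)" using reals_Archimedean2 by blast
  define N where "N = Suc M"
  have N: "(real N - 1) * L > \<bar>r\<bar> + \<bar>X i\<bar>" if "i < \<Lambda>" for i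
  proof -
    have "\<bar>X i\<bar> \<le> (\<Sum>i<\<Lambda>. \<bar>X i\<bar>)" using that by (intro member_le_sum) auto
    moreover have "real M * 1 \<le> real M * L" using L by (intro mult_left_mono) auto
    ultimately show ?thesis using M by (simp add: N_def)
  qed
  note key = integral_sawtooth_derivative[OF L(1) \<phi> c s N]
  have "- (LINT x|lborel. sawtooth_sum \<Lambda> X x * \<psi> x) =
      (\<Sum>i<\<Lambda>. - (LINT x|lborel. frac ((x - X i) / L) * \<psi> x))"
    unfolding sawtooth_sum_def sum_distrib_right L_def[symmetric]
    by (subst Bochner_Integration.integral_sum) (auto simp: sum_negf intro!: key)
  also have "\<dots> = (\<Sum>i<\<Lambda>. (LINT x|lborel. \<phi> x) / L - (\<Sum>k = - int N..int N. \<phi> (X i + of_int k * L)))"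
    by (intro sum.cong refl key) auto
  also have "\<dots> = (LINT x|lborel. \<phi> x) - (\<Sum>i<\<Lambda>. \<Sum>k = - int N..int N. \<phi> (X i + of_int k * L))"
    using L by (simp add: sum_subtractf L_def)
  also have "(\<Sum>i<\<Lambda>. \<Sum>k = - int N..int N. \<phi> (X i + of_int k * L)) = (LINT x|particle_measure \<Lambda> X. \<phi> x)"
    unfolding L_def
  proof (rule integral_particle_measure[symmetric])
    show "\<phi> \<in> borel_measurable borel"
      using \<phi> by (intro borel_measurable_continuous_onI) (auto simp: continuous_on_eq_continuous_at intro: DERIV_isCont)
    fix i k assume ik: "i < \<Lambda>" "\<bar>k\<bar> > int N"
    have "(real N - 1) * L \<le> \<bar>of_int k\<bar> * L" using L ik by (intro mult_right_mono) auto
    then have "\<bar>r\<bar> + \<bar>X i\<bar> < \<bar>of_int k * L\<bar>" using N[OF ik(1)] L by (simp only: abs_mult)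
    then show "\<phi> (X i + of_int k * real \<Lambda>) = 0" unfolding L_def[symmetric] by (intro s) linarith
  qed
  finally show "- (LINT x|lborel. sawtooth_sum \<Lambda> X x * \<psi> x) =
      (LINT x|lborel. \<phi> x) - (LINT x|particle_measure \<Lambda> X. \<phi> x)" .
qed

subsection \<open>Integrals of periodic functions\<close>

lemma periodic_of_int:
  assumes "\<And>x. f (x + L) = (f x :: 'a)"
  shows "f (x + of_int k * (L :: real)) = f x"
proof -
  have n: "f (x + of_nat n * L) = f x" for n x
  proof (induction n arbitrary: x)
    case (Suc n)
    have "f (x + of_nat (Suc n) * L) = f ((x + of_nat n * L) + L)" by (simp add: algebra_simps)
    then show ?case using assms Suc by simp
  qed simp
  show ?thesis
  proof (cases "k \<ge> 0")
    case True
    then show ?thesis using n[of x "nat k"] by simp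
  next
    case False
    then have "(x + of_int k * L) + of_nat (nat (- k)) * L = x" by (simp add: algebra_simps)
    then show ?thesis using n[of "x + of_int k * L" "nat (- k)"] by (simp only:)
  qed
qed

lemma bounded_set_integrable:
  fixes f :: "real \<Rightarrow> real"
  assumes [measurable]: "f \<in> borel_measurable borel" and B: "\<And>x. x \<in> A \<Longrightarrow> \<bar>f x\<bar> \<le> B"
    and [measurable]: "A \<in> sets borel" and A: "A \<subseteq> {a..b}"
  shows "set_integrable lborel A f"
  unfolding set_integrable_def
proof (rule Bochner_Integration.integrable_bound)
  show "integrable lborel (\<lambda>x. B * indicator {a..b} x)"
    by (intro integrable_mult_right) (auto simp: emeasure_lborel_Icc_eq)
  show "AE x in lborel. norm (indicator A x *\<^sub>R f x) \<le> norm (B * indicator {a..b} x :: real)"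
    using A B by (force simp: indicator_def intro!: AE_I2)
qed measurable

lemma integral_periodic_shift:
  fixes f :: "real \<Rightarrow> real"
  assumes L: "L > 0" and [measurable]: "f \<in> borel_measurable borel" and B: "\<And>x. \<bar>f x\<bar> \<le> B"
    and per: "\<And>x. f (x + L) = f x"
  shows "(LINT x:{0..<L}|lborel. f (x + a)) = (LINT x:{0..<L}|lborel. f x)"
proof -
  define r where "r = a rmod L"
  have r: "0 \<le> r" "r < L" using L by (auto simp: r_def rmod_nonneg rmod_less)
  have fa: "f (x + a) = f (x + r)" for x
  proof -
    have "x + a = x + r + of_int \<lfloor>a / L\<rfloor> * L" using L by (simp add: r_def rmod_def)
    then show ?thesis using periodic_of_int[of f L "x + r" "\<lfloor>a / L\<rfloor>"] per by (simp only:)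
  qed
  have si: "set_integrable lborel {c..<d} f" for c d
    using B by (intro bounded_set_integrable[where B = B and a = c and b = d]) auto
  have shift: "(LINT x:{c..<d}|lborel. f (x + e)) = (LINT x:{c + e..<d + e}|lborel. f x)" for c d e
    unfolding set_lebesgue_integral_def
    by (subst (2) lborel_integral_real_affine[of 1 _ e]) (auto simp: indicator_def algebra_simps)
  have split: "(LINT x:{c..<e}|lborel. f x) = (LINT x:{c..<d}|lborel. f x) + (LINT x:{d..<e}|lborel. f x)"
    if "c \<le> d" "d \<le> e" for c d e
  proof -
    have "{c..<e} = {c..<d} \<union> {d..<e}" using that by auto
    then show ?thesis using si by (simp add: set_integral_Un)
  qed
  have "(LINT x:{0..<L}|lborel. f (x + a)) = (LINT x:{r..<L + r}|lborel. f x)"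
    using fa shift[of 0 L r] by simp
  also have "\<dots> = (LINT x:{r..<L}|lborel. f x) + (LINT x:{L..<L + r}|lborel. f x)"
    using r by (intro split) auto
  also have "(LINT x:{L..<L + r}|lborel. f x) = (LINT x:{0..<r}|lborel. f (x + L))"
    using shift[of 0 r L] by (simp add: add.commute)
  also have "\<dots> = (LINT x:{0..<r}|lborel. f x)" using per by simp
  also have "(LINT x:{r..<L}|lborel. f x) + (LINT x:{0..<r}|lborel. f x) = (LINT x:{0..<L}|lborel. f x)"
    using split[of 0 r L] r by simp
  finally show ?thesis .
qed

text \<open>The periods number \<open>n\<close> and \<open>- (n + 1)\<close> are paired, so that the
  series runs over the naturals. It is stated for \<open>ennreal\<close> because it is applied
  before any finiteness is known.\<close>

lemma nn_integral_fold_periods: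
  fixes f :: "real \<Rightarrow> ennreal"
  assumes L: "L > 0" and [measurable]: "f \<in> borel_measurable borel"
  shows "(\<integral>\<^sup>+x. f x \<partial>lborel) =
    (\<Sum>n. (\<integral>\<^sup>+x\<in>{0..<L}. f (x + real n * L) \<partial>lborel) + (\<integral>\<^sup>+x\<in>{0..<L}. f (x - real (Suc n) * L) \<partial>lborel))"
proof -
  define I where "I = (\<lambda>k :: int. {of_int k * L..<of_int (k + 1) * L})"
  have I: "x \<in> I k \<longleftrightarrow> \<lfloor>x / L\<rfloor> = k" for x k
    using L by (simp add: I_def floor_eq_iff field_simps)
  have Imeas [measurable]: "I k \<in> sets borel" for k by (simp add: I_def)
  define J where "J = (\<lambda>n :: nat. I (int n) \<union> I (- int (Suc n)))"
  have "disjoint_family J" unfolding disjoint_family_on_def J_def by (auto simp: I)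
  moreover have "(\<Union>n. J n) = UNIV"
  proof (intro set_eqI iffI UNIV_I)
    fix x
    show "x \<in> (\<Union>n. J n)"
    proof (cases "\<lfloor>x / L\<rfloor> \<ge> 0")
      case True
      then have "x \<in> J (nat \<lfloor>x / L\<rfloor>)" by (simp add: J_def I)
      then show ?thesis by blast
    next
      case False
      then have "x \<in> J (nat (- \<lfloor>x / L\<rfloor> - 1))" by (simp add: J_def I)
      then show ?thesis by blast
    qed
  qed
  ultimately have "(\<integral>\<^sup>+x. f x \<partial>lborel) = (\<Sum>n. \<integral>\<^sup>+x\<in>J n. f x \<partial>lborel)"
    using nn_integral_disjoint_family[of f lborel J] by (simp add: J_def)
  moreover have "(\<integral>\<^sup>+x\<in>J n. f x \<partial>lborel) = (\<integral>\<^sup>+x\<in>I (int n). f x \<partial>lborel) + (\<integral>\<^sup>+x\<in>I (- int (Suc n)). f x \<partial>lborel)" for n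
    unfolding J_def by (rule nn_integral_disjoint_pair) (auto simp: I)
  moreover have shift: "(\<integral>\<^sup>+x\<in>I k. f x \<partial>lborel) = (\<integral>\<^sup>+x\<in>{0..<L}. f (x + of_int k * L) \<partial>lborel)" for k
  proof -
    have "(\<integral>\<^sup>+x\<in>I k. f x \<partial>lborel) =
        (\<integral>\<^sup>+x. f (of_int k * L + 1 * x) * indicator (I k) (of_int k * L + 1 * x) \<partial>lborel)"
      by (subst nn_integral_real_affine[of _ 1 "of_int k * L"]) auto
    also have "\<dots> = (\<integral>\<^sup>+x\<in>{0..<L}. f (x + of_int k * L) \<partial>lborel)"
      by (intro nn_integral_cong) (auto simp: indicator_def I_def algebra_simps)
    finally show ?thesis .
  qed
  moreover have "x + of_int (- int (Suc n)) * L = x - real (Suc n) * L" for x n by (simp add: algebra_simps)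
  ultimately show ?thesis by simp
qed

lemma measure_lborel_Ico_max: "measure lborel {a..<b} = max 0 (b - a)"
  by (cases "a \<le> b") auto

lemma integrable_indicator_Ico: "integrable lborel (indicator {a..<b :: real} :: real \<Rightarrow> real)"
  by (cases "a \<le> b") auto

subsection \<open>Squared increments of the potential\<close>

text \<open>The length of the intersection of two arcs of length \<open>h\<close> on a circle of
  length \<open>L\<close>, displaced by \<open>t\<close>. There are two terms because long arcs can
  meet at both ends.\<close>

definition arc_overlap :: "real \<Rightarrow> real \<Rightarrow> real \<Rightarrow> real" where
  "arc_overlap L h t = max 0 (h - t rmod L) + max 0 (h - (L - t rmod L))"

lemma rmod_measurable [measurable]: "(\<lambda>x. x rmod L) \<in> borel_measurable borel"
  unfolding rmod_def by measurable

lemma frac_divide_rmod: "L > 0 \<Longrightarrow> frac (x / L) = x rmod L / L"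
  by (simp add: rmod_conv_frac)

lemma rmod_eq_iff: "L > 0 \<Longrightarrow> 0 \<le> y \<Longrightarrow> y < L \<Longrightarrow> x = y + of_int k * L \<Longrightarrow> x rmod L = y"
  by (rule rmod_unique[of _ _ _ k]) auto

lemma rmod_add_self [simp]: "(x + L) rmod L = x rmod L" if "L > 0" for L :: real
proof (rule rmod_eq_iff[where k = "\<lfloor>x / L\<rfloor> + 1"])
  show "x + L = x rmod L + of_int (\<lfloor>x / L\<rfloor> + 1) * L"
    using that by (simp add: rmod_def algebra_simps)
qed (use that in \<open>auto simp: rmod_nonneg rmod_less\<close>)

lemma arc_overlap_integral:
  assumes L: "L > 0" and h: "0 \<le> h" "h < L"
  shows "(LINT x:{0..<L}|lborel. of_bool (x rmod L \<ge> L - h) * of_bool ((x + t) rmod L \<ge> L - h)) = arc_overlap L h t"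
proof -
  define r where "r = t rmod L"
  have r: "0 \<le> r" "r < L" using L by (auto simp: r_def rmod_nonneg rmod_less)
  have t: "t = r + of_int \<lfloor>t / L\<rfloor> * L" using L by (simp add: r_def rmod_def)
  \<comment> \<open>The two intervals collect the \<open>x\<close> for which adding \<open>r\<close>
    stays below \<open>L\<close> and those for which it wraps around once.\<close>
  have *: "indicator {0..<L} x * (of_bool (x rmod L \<ge> L - h) * of_bool ((x + t) rmod L \<ge> L - h)) =
      (indicator {L - h..<L - r} x + indicator {max (L - r) (2 * L - h - r)..<L} x :: real)" for x
  proof (cases "0 \<le> x \<and> x < L")
    case x: True
    have 1: "x rmod L = x" using L x by simp
    show ?thesis
    proof (cases "x + r < L")
      case True
      have "(x + t) rmod L = x + r"
        by (rule rmod_eq_iff[where k = "\<lfloor>t / L\<rfloor>"]) (use t L x r True in auto)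
      then show ?thesis using 1 x r h True by (auto simp: indicator_def)
    next
      case False
      have "(x + t) rmod L = x + r - L"
        by (rule rmod_eq_iff[where k = "\<lfloor>t / L\<rfloor> + 1"]) (use t L x r False in \<open>auto simp: algebra_simps\<close>)
      then show ?thesis using 1 x r h False by (auto simp: indicator_def)
    qed
  qed (use h r in \<open>auto simp: indicator_def\<close>)
  have "(LINT x:{0..<L}|lborel. of_bool (x rmod L \<ge> L - h) * of_bool ((x + t) rmod L \<ge> L - h)) =
      (LINT x|lborel. indicator {L - h..<L - r} x + indicator {max (L - r) (2 * L - h - r)..<L} x :: real)"
    unfolding set_lebesgue_integral_def real_scaleR_def * ..
  also have "\<dots> = measure lborel {L - h..<L - r} + measure lborel {max (L - r) (2 * L - h - r)..<L}"
    by (subst Bochner_Integration.integral_add) (auto intro: integrable_indicator_Ico)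
  also have "\<dots> = arc_overlap L h t"
    using r h by (auto simp: measure_lborel_Ico_max arc_overlap_def r_def[symmetric] max_def)
  finally show ?thesis .
qed

text \<open>A step of length \<open>h\<close> raises each tooth by \<open>h / \<Lambda>\<close>, and
  lowers it by 1 exactly if the jump is crossed, that is, if the starting point lies within
  \<open>h\<close> of the end of its period.\<close>

lemma sawtooth_sum_increment:
  assumes "\<Lambda> \<ge> 1" "0 \<le> h" "h < real \<Lambda>"
  shows "sawtooth_sum \<Lambda> X (x + h) - sawtooth_sum \<Lambda> X x =
    (\<Sum>i<\<Lambda>. h / real \<Lambda> - of_bool ((x - X i) rmod real \<Lambda> \<ge> real \<Lambda> - h))"
proof -
  have "frac ((x + h - X i) / real \<Lambda>) - frac ((x - X i) / real \<Lambda>) =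
      h / real \<Lambda> - of_bool ((x - X i) rmod real \<Lambda> \<ge> real \<Lambda> - h)" for i
  proof -
    define L where "L = real \<Lambda>"
    have L: "L > 0" "h < L" using assms by (auto simp: L_def)
    have "frac (h / L) = h / L" using assms L by (simp add: frac_eq)
    then have "frac ((x - X i) / L + h / L) - frac ((x - X i) / L) = h / L - of_bool ((x - X i) rmod L \<ge> L - h)"
      unfolding frac_add using L by (auto simp: frac_divide_rmod field_simps)
    moreover have "(x + h - X i) / L = (x - X i) / L + h / L" by (simp add: diff_divide_distrib add_divide_distrib)
    ultimately show ?thesis by (simp add: L_def)
  qed
  then show ?thesis unfolding sawtooth_sum_def sum_subtractf[symmetric] by (intro sum.cong refl) auto
qed

text \<open>Expanding the square over pairs of particles, the constant part integrates to
  \<open>h\<^sup>2 / L\<close>, the two mixed parts to \<open>- h\<^sup>2 / L\<close> each, and the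
  product of the jump indicators to the overlap of two arcs.\<close>

lemma increment_square_integral:
  fixes \<Lambda> :: nat and h :: real and X :: "nat \<Rightarrow> real"
  defines "L \<equiv> real \<Lambda>"
  assumes \<Lambda>: "\<Lambda> \<ge> 1" and h: "0 \<le> h" "h < L"
  shows "(LINT x:{0..<L}|lborel. (sawtooth_sum \<Lambda> X (x + h) - sawtooth_sum \<Lambda> X x)\<^sup>2) =
    (\<Sum>i<\<Lambda>. \<Sum>j<\<Lambda>. arc_overlap L h (X i - X j) - h\<^sup>2 / L)"
proof -
  have L: "L > 0" using \<Lambda> by (simp add: L_def)
  define \<eta> :: "real \<Rightarrow> real" where "\<eta> = (\<lambda>x. of_bool (x rmod L \<ge> L - h))"
  have [measurable]: "\<eta> \<in> borel_measurable borel" unfolding \<eta>_def by measurable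
  have \<eta>01: "0 \<le> \<eta> x" "\<eta> x \<le> 1" for x by (auto simp: \<eta>_def)
  have per: "\<eta> (x + L) = \<eta> x" for x using L by (simp add: \<eta>_def)
  have si: "set_integrable lborel {0..<L} f" if "f \<in> borel_measurable borel" "\<And>x. \<bar>f x\<bar> \<le> 1" for f :: "real \<Rightarrow> real"
    using that by (intro bounded_set_integrable[where B = 1 and a = 0 and b = L]) auto
  have ov: "(LINT x:{0..<L}|lborel. \<eta> x * \<eta> (x + t)) = arc_overlap L h t" for t
    unfolding \<eta>_def by (rule arc_overlap_integral[OF L h])
  have prod: "(LINT x:{0..<L}|lborel. \<eta> (x - a) * \<eta> (x - b)) = arc_overlap L h (a - b)" for a b
  proof -
    have "(LINT x:{0..<L}|lborel. \<eta> (x + - a) * \<eta> (x + - a + (a - b))) = (LINT x:{0..<L}|lborel. \<eta> x * \<eta> (x + (a - b)))"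
    proof (rule integral_periodic_shift[where f = "\<lambda>x. \<eta> x * \<eta> (x + (a - b))" and B = 1])
      show "\<bar>\<eta> x * \<eta> (x + (a - b))\<bar> \<le> 1" for x
        by (auto simp: \<eta>_def)
      show "\<eta> (x + L) * \<eta> (x + L + (a - b)) = \<eta> x * \<eta> (x + (a - b))" for x
        using per[of x] per[of "x + (a - b)"] by (simp add: algebra_simps)
    qed (use L in auto)
    then show ?thesis using ov by simp
  qed
  have single: "(LINT x:{0..<L}|lborel. \<eta> (x - a)) = h" for a
  proof -
    \<comment> \<open>The indicator is idempotent, so its integral is the overlap of an arc with
      itself.\<close>
    have "\<eta> (x - a) * \<eta> (x - a) = \<eta> (x - a)" for x by (auto simp: \<eta>_def)
    then have "(LINT x:{0..<L}|lborel. \<eta> (x - a)) = (LINT x:{0..<L}|lborel. \<eta> (x - a) * \<eta> (x - a))" by (simp only:)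
    then show ?thesis using prod[of a a] h by (simp add: arc_overlap_def)
  qed
  have one: "(LINT x:{0..<L}|lborel. c) = c * L" for c
    using L by (simp add: set_lebesgue_integral_def)
  have i1: "set_integrable lborel {0..<L} (\<lambda>x. \<eta> (x - a))" for a
    using \<eta>01 by (intro si) auto
  have i2: "set_integrable lborel {0..<L} (\<lambda>x. \<eta> (x - a) * \<eta> (x - b))" for a b
    by (intro si) (auto simp: \<eta>_def)
  have i0: "set_integrable lborel {0..<L} (\<lambda>x. c)" for c :: real
    by (intro bounded_set_integrable[where B = "\<bar>c\<bar>" and a = 0 and b = L]) auto
  have pair: "set_integrable lborel {0..<L} (\<lambda>x. (h / L - \<eta> (x - a)) * (h / L - \<eta> (x - b)))"
    "(LINT x:{0..<L}|lborel. (h / L - \<eta> (x - a)) * (h / L - \<eta> (x - b))) = arc_overlap L h (a - b) - h\<^sup>2 / L" for a b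
  proof -
    have eq: "(\<lambda>x. (h / L - \<eta> (x - a)) * (h / L - \<eta> (x - b))) =
        (\<lambda>x. (h / L)\<^sup>2 - h / L * \<eta> (x - a) - h / L * \<eta> (x - b) + \<eta> (x - a) * \<eta> (x - b))"
      by (simp add: algebra_simps power2_eq_square)
    show "set_integrable lborel {0..<L} (\<lambda>x. (h / L - \<eta> (x - a)) * (h / L - \<eta> (x - b)))"
      unfolding eq by (intro set_integral_add set_integral_diff set_integrable_mult_right i0 i1 i2)
    have "(LINT x:{0..<L}|lborel. (h / L - \<eta> (x - a)) * (h / L - \<eta> (x - b))) =
        (h / L)\<^sup>2 * L - h / L * h - h / L * h + arc_overlap L h (a - b)"
      unfolding eq
      by (simp add: set_integral_add set_integral_diff set_integrable_mult_right i0 i1 i2 one single prod)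
    also have "\<dots> = arc_overlap L h (a - b) - h\<^sup>2 / L"
      using L by (simp add: power2_eq_square)
    finally show "(LINT x:{0..<L}|lborel. (h / L - \<eta> (x - a)) * (h / L - \<eta> (x - b))) = arc_overlap L h (a - b) - h\<^sup>2 / L" .
  qed
  have "(sawtooth_sum \<Lambda> X (x + h) - sawtooth_sum \<Lambda> X x)\<^sup>2 =
      (\<Sum>i<\<Lambda>. \<Sum>j<\<Lambda>. (h / L - \<eta> (x - X i)) * (h / L - \<eta> (x - X j)))" for x
    using sawtooth_sum_increment[OF \<Lambda> h(1), of X x] h(2)
    by (simp add: L_def \<eta>_def power2_eq_square sum_product)
  then have "(LINT x:{0..<L}|lborel. (sawtooth_sum \<Lambda> X (x + h) - sawtooth_sum \<Lambda> X x)\<^sup>2) =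
      (LINT x|lborel. (\<Sum>i<\<Lambda>. \<Sum>j<\<Lambda>. indicator {0..<L} x *\<^sub>R ((h / L - \<eta> (x - X i)) * (h / L - \<eta> (x - X j)))))"
    by (simp add: set_lebesgue_integral_def sum_distrib_left)
  also have "\<dots> = (\<Sum>i<\<Lambda>. \<Sum>j<\<Lambda>. LINT x|lborel. indicator {0..<L} x *\<^sub>R ((h / L - \<eta> (x - X i)) * (h / L - \<eta> (x - X j))))"
    using pair(1) unfolding set_integrable_def
    by (subst Bochner_Integration.integral_sum, intro Bochner_Integration.integrable_sum, simp)
      (subst Bochner_Integration.integral_sum, auto)
  also have "\<dots> = (\<Sum>i<\<Lambda>. \<Sum>j<\<Lambda>. arc_overlap L h (X i - X j) - h\<^sup>2 / L)"
    using pair(2) unfolding set_lebesgue_integral_def by simp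
  finally show ?thesis .
qed

subsection \<open>The folded kernel\<close>

text \<open>Grouping the shifts \<open>n\<close> and \<open>- (n + 1)\<close> matches the pairing in
  \<open>nn_integral_fold_periods\<close> and leaves both singularities, at \<open>0\<close> and at
  \<open>L\<close>, in the term \<open>n = 0\<close>.\<close>

definition kernel_term :: "real \<Rightarrow> real \<Rightarrow> nat \<Rightarrow> real \<Rightarrow> real" where
  "kernel_term s L n h = (h + real n * L) powr (- 1 - 2 * s) + (real (Suc n) * L - h) powr (- 1 - 2 * s)"

text \<open>For \<open>0 < h < L\<close> this is the sum of \<open>|h + k L|\<^sup>-\<^sup>1\<^sup>-\<^sup>2\<^sup>s\<close> over all integers \<open>k\<close>.\<close>
definition per_kernel :: "real \<Rightarrow> real \<Rightarrow> real \<Rightarrow> real" where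
  "per_kernel s L h = (\<Sum>n. kernel_term s L n h)"

lemma kernel_term_nonneg: "kernel_term s L n h \<ge> 0"
  by (simp add: kernel_term_def)

text \<open>Beyond the nearest images both distances are at least \<open>(n + 1) L\<close>. The
  bound is summable and uniform in \<open>h\<close>, as the M-test for the tail needs.\<close>

lemma kernel_term_Suc_le:
  assumes "s > 0" "L > 0" "0 \<le> h" "h < L"
  shows "kernel_term s L (Suc n) h \<le> 2 * L powr (- 1 - 2 * s) * real (Suc n) powr (- 1 - 2 * s)"
proof -
  have pos: "real (Suc n) * L > 0" using assms by simp
  have "(h + real (Suc n) * L) powr (- 1 - 2 * s) \<le> (real (Suc n) * L) powr (- 1 - 2 * s)"
    using assms pos by (intro powr_mono2') auto
  moreover have "(real (Suc (Suc n)) * L - h) powr (- 1 - 2 * s) \<le> (real (Suc n) * L) powr (- 1 - 2 * s)"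
    using assms pos by (intro powr_mono2') (auto simp: distrib_right)
  moreover have "(real (Suc n) * L) powr (- 1 - 2 * s) = L powr (- 1 - 2 * s) * real (Suc n) powr (- 1 - 2 * s)"
    by (simp add: powr_mult mult.commute)
  ultimately show ?thesis unfolding kernel_term_def by linarith
qed

lemma summable_kernel_bound: "s > 0 \<Longrightarrow> summable (\<lambda>n. 2 * L powr (- 1 - 2 * s) * real (Suc n) powr (- 1 - 2 * s))"
  by (intro summable_mult) (subst summable_Suc_iff, simp add: summable_real_powr_iff)

context
  fixes s L :: real
  assumes s: "0 < s" "s < 1 / 2" and L: "L > 0"
begin

lemma summable_kernel_term_Suc:
  assumes "0 \<le> h" "h < L"
  shows "summable (\<lambda>n. kernel_term s L (Suc n) h)"
proof (rule summable_comparison_test'[OF summable_kernel_bound[of s L]])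
  show "norm (kernel_term s L (Suc n) h) \<le> 2 * L powr (- 1 - 2 * s) * real (Suc n) powr (- 1 - 2 * s)" for n
    using kernel_term_Suc_le[of s L h n] kernel_term_nonneg[of s L "Suc n" h] s L assms by simp
qed (use s in auto)

lemma summable_kernel_term:
  assumes "0 \<le> h" "h < L"
  shows "summable (\<lambda>n. kernel_term s L n h)"
  using summable_kernel_term_Suc[OF assms] by (subst (asm) summable_Suc_iff)

lemma per_kernel_split:
  assumes "0 \<le> h" "h < L"
  shows "per_kernel s L h = h powr (- 1 - 2 * s) + (L - h) powr (- 1 - 2 * s) + (\<Sum>n. kernel_term s L (Suc n) h)"
  using suminf_split_head[OF summable_kernel_term[OF assms]]
  by (simp add: per_kernel_def) (simp add: kernel_term_def)

text \<open>All other terms are nonnegative. At \<open>h = 0\<close> this only says that the kernel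
  is nonnegative, since \<open>0 powr a = 0\<close>.\<close>

lemma per_kernel_ge:
  assumes "0 \<le> h" "h < L"
  shows "per_kernel s L h \<ge> h powr (- 1 - 2 * s)"
  unfolding per_kernel_split[OF assms]
  using suminf_nonneg[OF summable_kernel_term_Suc[OF assms]] kernel_term_nonneg
  by (simp add: add_increasing2)

lemma per_kernel_nonneg: "0 \<le> h \<Longrightarrow> h < L \<Longrightarrow> per_kernel s L h \<ge> 0"
  using per_kernel_ge[of h] order_trans[OF powr_ge_zero] by blast

text \<open>Isolates the two singularities; \<open>C\<close> is the sum of the uniform bounds of the
  tail.\<close>

lemma per_kernel_le:
  obtains C where "C \<ge> 0" "\<And>h. 0 \<le> h \<Longrightarrow> h < L \<Longrightarrow>
    per_kernel s L h \<le> h powr (- 1 - 2 * s) + (L - h) powr (- 1 - 2 * s) + C"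
proof
  define b where "b = (\<lambda>n. 2 * L powr (- 1 - 2 * s) * real (Suc n) powr (- 1 - 2 * s))"
  have b: "summable b" unfolding b_def using summable_kernel_bound s by blast
  show "(\<Sum>n. b n) \<ge> 0" by (intro suminf_nonneg b) (simp add: b_def)
  fix h assume h: "0 \<le> h" "h < L"
  have "(\<Sum>n. kernel_term s L (Suc n) h) \<le> (\<Sum>n. b n)"
    unfolding b_def using kernel_term_Suc_le[of s L h] s L h
    by (intro suminf_le summable_kernel_term_Suc summable_kernel_bound) auto
  then show "per_kernel s L h \<le> h powr (- 1 - 2 * s) + (L - h) powr (- 1 - 2 * s) + (\<Sum>n. b n)"
    unfolding per_kernel_split[OF h] by simp
qed

lemma continuous_on_per_kernel: "continuous_on {0<..<L} (per_kernel s L)"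
proof -
  have "continuous_on {0<..<L} (\<lambda>h. \<Sum>n. kernel_term s L (Suc n) h)"
  proof (rule uniform_limit_theorem[OF _ Weierstrass_m_test[OF _ summable_kernel_bound[of s L]]])
    show "norm (kernel_term s L (Suc n) h) \<le> 2 * L powr (- 1 - 2 * s) * real (Suc n) powr (- 1 - 2 * s)"
      if "h \<in> {0<..<L}" for n h
      using kernel_term_Suc_le[of s L h n] kernel_term_nonneg[of s L "Suc n" h] s L that by simp
    have pos: "h + real (Suc n) * L \<noteq> 0" "real (Suc (Suc n)) * L - h \<noteq> 0" if "h \<in> {0<..<L}" for h n
    proof -
      define q where "q = real n * L"
      have q: "q \<ge> 0" "h + real (Suc n) * L = h + q + L" "real (Suc (Suc n)) * L - h = q + 2 * L - h"
        using L by (auto simp: q_def algebra_simps)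
      show "h + real (Suc n) * L \<noteq> 0" "real (Suc (Suc n)) * L - h \<noteq> 0"
        unfolding q(2,3) using that q(1) by auto
    qed
    have "continuous_on {0<..<L} (kernel_term s L (Suc n))" for n
      unfolding kernel_term_def[abs_def] using pos by (intro continuous_intros) auto
    then show "\<forall>\<^sub>F n in sequentially. continuous_on {0<..<L} (\<lambda>h. \<Sum>i<n. kernel_term s L (Suc i) h)"
      by (intro always_eventually allI continuous_on_sum) auto
  qed (use s in auto)
  then have "continuous_on {0<..<L} (\<lambda>h. h powr (- 1 - 2 * s) + (L - h) powr (- 1 - 2 * s) + (\<Sum>n. kernel_term s L (Suc n) h))"
    by (intro continuous_intros) auto
  then show ?thesis by (rule continuous_on_eq) (simp add: per_kernel_split)
qed

lemma per_kernel_measurable [measurable]: "per_kernel s L \<in> borel_measurable borel"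
  unfolding per_kernel_def[abs_def] kernel_term_def by measurable

text \<open>The overlap lies between \<open>max 0 (2 * h - L)\<close> and \<open>h\<close>, and
  \<open>h\<^sup>2 / L\<close> lies between them too. The bound vanishes linearly at
  \<open>0\<close> and at \<open>L\<close>, exactly where the kernel is singular.\<close>

lemma arc_overlap_bound:
  assumes h: "0 \<le> h" "h < L"
  shows "\<bar>arc_overlap L h t - h\<^sup>2 / L\<bar> \<le> h * (L - h) / L"
proof -
  define r where "r = t rmod L"
  have r: "0 \<le> r" "r < L" using L by (auto simp: r_def rmod_nonneg rmod_less)
  have ao: "arc_overlap L h t = max 0 (h - r) + max 0 (h - (L - r))" by (simp add: arc_overlap_def r_def)
  have u: "arc_overlap L h t \<le> h" and l: "arc_overlap L h t \<ge> 0" "arc_overlap L h t \<ge> 2 * h - L"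
    unfolding ao using r h by (auto simp: max_def)
  have "L * arc_overlap L h t \<le> L * h" using u L by (intro mult_left_mono) auto
  then have "arc_overlap L h t - h\<^sup>2 / L \<le> h * (L - h) / L"
    using L by (simp add: field_simps power2_eq_square)
  moreover have "- (h * (L - h) / L) \<le> arc_overlap L h t - h\<^sup>2 / L"
  proof (cases "2 * h \<le> L")
    case True
    have "h\<^sup>2 \<le> h * (L - h)" unfolding power2_eq_square using True h by (intro mult_left_mono) auto
    then have "h\<^sup>2 / L \<le> h * (L - h) / L" using L by (intro divide_right_mono) auto
    then show ?thesis using l by linarith
  next
    case False
    have "(L - h) * (L - h) \<le> h * (L - h)" using False h by (intro mult_right_mono) auto
    then have "(L - h) * (L - h) / L \<le> h * (L - h) / L" using L by (intro divide_right_mono) auto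
    moreover have "(L - h) * (L - h) / L = L - 2 * h + h\<^sup>2 / L"
      using L by (simp add: field_simps power2_eq_square)
    ultimately show ?thesis using l by linarith
  qed
  ultimately show ?thesis by linarith
qed

lemma powr_set_integrable: "set_integrable lborel {0..<L} (\<lambda>h. h powr (- 2 * s))"
proof -
  have "((\<lambda>x. x powr (- 2 * s)) has_integral (L powr (- 2 * s + 1) / (- 2 * s + 1))) {0..L}"
    using s L by (intro has_integral_powr_from_0) auto
  moreover have "(\<lambda>x. indicator {0..L} x * x powr (- 2 * s)) = (\<lambda>x. if x \<in> {0..L} then x powr (- 2 * s) else 0)"
    by auto
  ultimately have *: "((\<lambda>x. indicator {0..L} x * x powr (- 2 * s)) has_integral (L powr (- 2 * s + 1) / (- 2 * s + 1))) UNIV"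
    by (simp only: has_integral_restrict_UNIV)
  have "integral\<^sup>N lborel (\<lambda>x. indicator {0..L} x * x powr (- 2 * s)) = ennreal (L powr (- 2 * s + 1) / (- 2 * s + 1))"
    by (rule nn_integral_has_integral_lborel[OF _ _ *]) auto
  then have "integrable lborel (\<lambda>x. indicator {0..L} x * x powr (- 2 * s))"
    by (intro integrableI_nonneg) auto
  then have "set_integrable lborel {0..L} (\<lambda>h. h powr (- 2 * s))" by (simp add: set_integrable_def)
  then show ?thesis by (rule set_integrable_subset) auto
qed

lemma powr_set_integrable_reflect: "set_integrable lborel {0..<L} (\<lambda>h. (L - h) powr (- 2 * s))"
proof -
  have "set_integrable lborel {0<..<L} (\<lambda>h. h powr (- 2 * s))"
    by (rule set_integrable_subset[OF powr_set_integrable]) auto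
  then have "integrable lborel (\<lambda>h. indicator {0<..<L} (L + - 1 * h) *\<^sub>R (L + - 1 * h) powr (- 2 * s))"
    unfolding set_integrable_def by (rule lborel_integrable_real_affine) simp
  then have "integrable lborel (\<lambda>h. indicator {0<..<L} h *\<^sub>R (L - h) powr (- 2 * s))"
    by (rule Bochner_Integration.integrable_cong[THEN iffD1, rotated 2]) (auto simp: indicator_def)
  then show ?thesis unfolding set_integrable_def
  proof (rule integrable_cong_AE_imp)
    show "AE x in lborel. indicator {0<..<L} x *\<^sub>R (L - x) powr (- 2 * s) = indicator {0..<L} x *\<^sub>R (L - x) powr (- 2 * s)"
      using AE_lborel_singleton[of "0 :: real"] by eventually_elim (auto simp: indicator_def)
  qed measurable
qed

text \<open>The linear zero of the overlap term gains one power at each end, leaving singularities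
  of order \<open>- 2 * s > - 1\<close>.\<close>

lemma kernel_overlap_integrable: "set_integrable lborel {0..<L} (\<lambda>h. per_kernel s L h * (arc_overlap L h t - h\<^sup>2 / L))"
proof -
  obtain C where C: "C \<ge> 0" "\<And>h. 0 \<le> h \<Longrightarrow> h < L \<Longrightarrow>
    per_kernel s L h \<le> h powr (- 1 - 2 * s) + (L - h) powr (- 1 - 2 * s) + C" using per_kernel_le by blast
  have dom: "\<bar>per_kernel s L h * (arc_overlap L h t - h\<^sup>2 / L)\<bar> \<le> h powr (- 2 * s) + (L - h) powr (- 2 * s) + C * L"
    if h: "0 \<le> h" "h < L" for h
  proof -
    define m where "m = h * (L - h) / L"
    have m0: "m \<ge> 0" using h L by (simp add: m_def)
    have "h * (L - h) \<le> h * L" "h * (L - h) \<le> L * (L - h)" using h by (auto intro!: mult_left_mono mult_right_mono)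
    \<comment> \<open>Each singular part of the kernel is paired with the estimate of
      \<open>m\<close> that vanishes at its own end.\<close>
    then have m: "m \<le> h" "m \<le> L - h" using L by (auto simp: m_def field_simps)
    have p: "x powr (- 1 - 2 * s) * x = x powr (- 2 * s)" if "x \<ge> 0" for x
      using that by (cases "x = 0") (auto simp: powr_mult_base mult.commute)
    have "\<bar>per_kernel s L h * (arc_overlap L h t - h\<^sup>2 / L)\<bar> \<le> per_kernel s L h * m"
      unfolding abs_mult abs_of_nonneg[OF per_kernel_nonneg[OF h]] m_def
      using arc_overlap_bound[OF h, of t] per_kernel_nonneg[OF h] by (rule mult_left_mono)
    also have "\<dots> \<le> (h powr (- 1 - 2 * s) + (L - h) powr (- 1 - 2 * s) + C) * m"
      using C(2)[OF h] m0 by (rule mult_right_mono)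
    also have "\<dots> = h powr (- 1 - 2 * s) * m + (L - h) powr (- 1 - 2 * s) * m + C * m"
      by (simp add: algebra_simps)
    also have "\<dots> \<le> h powr (- 1 - 2 * s) * h + (L - h) powr (- 1 - 2 * s) * (L - h) + C * L"
      using m m0 h C(1) by (intro add_mono mult_left_mono) auto
    also have "\<dots> = h powr (- 2 * s) + (L - h) powr (- 2 * s) + C * L"
      using p h by simp
    finally show ?thesis .
  qed
  have [measurable]: "(\<lambda>h. arc_overlap L h t) \<in> borel_measurable borel"
    unfolding arc_overlap_def by measurable
  have "set_integrable lborel {0..<L} (\<lambda>_. C * L)"
    by (rule bounded_set_integrable[where B = "\<bar>C * L\<bar>" and a = 0 and b = L]) auto
  then have "set_integrable lborel {0..<L} (\<lambda>h. h powr (- 2 * s) + (L - h) powr (- 2 * s) + C * L)"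
    using powr_set_integrable powr_set_integrable_reflect by (intro set_integral_add)
  then show ?thesis unfolding set_integrable_def
  proof (rule Bochner_Integration.integrable_bound)
    show "AE h in lborel. norm (indicator {0..<L} h *\<^sub>R (per_kernel s L h * (arc_overlap L h t - h\<^sup>2 / L))) \<le>
        norm (indicator {0..<L} h *\<^sub>R (h powr (- 2 * s) + (L - h) powr (- 2 * s) + C * L))"
    proof (intro AE_I2)
      fix h
      show "norm (indicator {0..<L} h *\<^sub>R (per_kernel s L h * (arc_overlap L h t - h\<^sup>2 / L))) \<le>
        norm (indicator {0..<L} h *\<^sub>R (h powr (- 2 * s) + (L - h) powr (- 2 * s) + C * L))"
        using dom[of h] by (cases "h \<in> {0..<L}") auto
    qed
  qed measurable
qed

end

subsection \<open>The energy as a sum of pair interactions\<close>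

text \<open>The subtracted \<open>h\<^sup>2 / L\<close> tends to \<open>L\<close> like the overlap
  as \<open>h\<close> approaches \<open>L\<close>; without it the kernel singularity there would be
  uncompensated.\<close>

definition pair_energy :: "real \<Rightarrow> real \<Rightarrow> real \<Rightarrow> real" where
  "pair_energy s L t = (LINT h:{0..<L}|lborel. per_kernel s L h * (arc_overlap L h t - h\<^sup>2 / L))"

lemma sawtooth_sum_periodic: "sawtooth_sum \<Lambda> X (x + of_int k * real \<Lambda>) = sawtooth_sum \<Lambda> X x"
proof (cases "\<Lambda> = 0")
  case False
  then have "(x + of_int k * real \<Lambda> - a) / real \<Lambda> = (x - a) / real \<Lambda> + of_int k" for a
    by (simp add: field_simps)
  then show ?thesis unfolding sawtooth_sum_def by simp
qed simp

text \<open>Substitute \<open>y = x + h\<close> and fold: the squared increment is periodic in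
  \<open>h\<close>, so only the kernel is summed over periods. At individual \<open>x\<close> both
  sides may be infinite, hence the nonnegative integrals.\<close>

lemma nn_integral_interaction:
  fixes \<Lambda> :: nat and X :: "nat \<Rightarrow> real"
  assumes s: "0 < s" "s < 1 / 2" and \<Lambda>: "\<Lambda> \<ge> 1"
  defines "v \<equiv> sawtooth_sum \<Lambda> X" and "L \<equiv> real \<Lambda>"
  shows "(\<integral>\<^sup>+y. ennreal (\<bar>v x - v y\<bar>\<^sup>2 / \<bar>x - y\<bar> powr (1 + 2 * s)) \<partial>lborel) =
    (\<integral>\<^sup>+h\<in>{0..<L}. ennreal (per_kernel s L h * (v (x + h) - v x)\<^sup>2) \<partial>lborel)"
proof -
  have L: "L > 0" using \<Lambda> by (simp add: L_def)
  have [measurable]: "v \<in> borel_measurable borel" by (simp add: v_def)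
  define F where "F = (\<lambda>y. ennreal (\<bar>v x - v y\<bar>\<^sup>2 / \<bar>x - y\<bar> powr (1 + 2 * s)))"
  have [measurable]: "F \<in> borel_measurable borel" unfolding F_def by measurable
  have p: "c / \<bar>a\<bar> powr (1 + 2 * s) = c * \<bar>a\<bar> powr (- 1 - 2 * s)" for a c :: real
    using powr_minus_divide[of "\<bar>a\<bar>" "1 + 2 * s"] by (simp add: algebra_simps)
  define D where "D = (\<lambda>h. (v (x + h) - v x)\<^sup>2)"
  have [measurable]: "D \<in> borel_measurable borel" unfolding D_def by measurable
  have 1: "F (x + (h + real n * L)) = ennreal (D h * (h + real n * L) powr (- 1 - 2 * s))" if "h \<ge> 0" for h n
  proof -
    have "v (x + (h + real n * L)) = v (x + h)"
      using sawtooth_sum_periodic[of \<Lambda> X "x + h" "int n"] by (simp add: v_def L_def algebra_simps)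
    moreover have "real n * L \<ge> 0" using L by simp
    then have "\<bar>x - (x + (h + real n * L))\<bar> = h + real n * L" using that by linarith
    ultimately show ?thesis using p[of _ "x - (x + (h + real n * L))"]
      by (simp add: F_def D_def power2_commute)
  qed
  have 2: "F (x + (h - real (Suc n) * L)) = ennreal (D h * (real (Suc n) * L - h) powr (- 1 - 2 * s))" if "h < L" for h n
  proof -
    have "v (x + (h - real (Suc n) * L)) = v (x + h)"
      using sawtooth_sum_periodic[of \<Lambda> X "x + h" "- int (Suc n)"] by (simp add: v_def L_def algebra_simps)
    moreover have "real n * L \<ge> 0" using L by simp
    then have "\<bar>x - (x + (h - real (Suc n) * L))\<bar> = real (Suc n) * L - h" using that by (simp add: algebra_simps)
    ultimately show ?thesis using p[of _ "x - (x + (h - real (Suc n) * L))"]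
      by (simp add: F_def D_def power2_commute)
  qed
  have "(\<integral>\<^sup>+y. F y \<partial>lborel) = (\<integral>\<^sup>+h. F (x + h) \<partial>lborel)"
    by (subst nn_integral_real_affine[of _ 1 x]) auto
  also have "\<dots> = (\<Sum>n. (\<integral>\<^sup>+h\<in>{0..<L}. F (x + (h + real n * L)) \<partial>lborel) +
      (\<integral>\<^sup>+h\<in>{0..<L}. F (x + (h - real (Suc n) * L)) \<partial>lborel))"
    by (subst nn_integral_fold_periods[OF L]) auto
  also have "\<dots> = (\<Sum>n. \<integral>\<^sup>+h\<in>{0..<L}. ennreal (kernel_term s L n h * D h) \<partial>lborel)"
  proof (rule suminf_cong)
    fix n
    have "(\<integral>\<^sup>+h\<in>{0..<L}. F (x + (h + real n * L)) \<partial>lborel) + (\<integral>\<^sup>+h\<in>{0..<L}. F (x + (h - real (Suc n) * L)) \<partial>lborel) =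
        (\<integral>\<^sup>+h. F (x + (h + real n * L)) * indicator {0..<L} h + F (x + (h - real (Suc n) * L)) * indicator {0..<L} h \<partial>lborel)"
      by (rule nn_integral_add[symmetric]) auto
    also have "\<dots> = (\<integral>\<^sup>+h\<in>{0..<L}. ennreal (kernel_term s L n h * D h) \<partial>lborel)"
    proof (rule nn_integral_cong)
      fix h
      show "F (x + (h + real n * L)) * indicator {0..<L} h + F (x + (h - real (Suc n) * L)) * indicator {0..<L} h =
          ennreal (kernel_term s L n h * D h) * indicator {0..<L} h"
      proof (cases "h \<in> {0..<L}")
        case True
        then show ?thesis using 1[of h n] 2[of h n]
          by (simp add: kernel_term_def D_def ennreal_plus[symmetric] algebra_simps del: ennreal_plus)
      qed simp
    qed
    finally show "(\<integral>\<^sup>+h\<in>{0..<L}. F (x + (h + real n * L)) \<partial>lborel) + (\<integral>\<^sup>+h\<in>{0..<L}. F (x + (h - real (Suc n) * L)) \<partial>lborel) =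
        (\<integral>\<^sup>+h\<in>{0..<L}. ennreal (kernel_term s L n h * D h) \<partial>lborel)" .
  qed
  also have "\<dots> = (\<integral>\<^sup>+h. (\<Sum>n. ennreal (kernel_term s L n h * D h) * indicator {0..<L} h) \<partial>lborel)"
    by (rule nn_integral_suminf[symmetric]) (simp add: kernel_term_def[abs_def])
  also have "\<dots> = (\<integral>\<^sup>+h\<in>{0..<L}. ennreal (per_kernel s L h * D h) \<partial>lborel)"
  proof (rule nn_integral_cong)
    fix h
    show "(\<Sum>n. ennreal (kernel_term s L n h * D h) * indicator {0..<L} h) = ennreal (per_kernel s L h * D h) * indicator {0..<L} h"
    proof (cases "h \<in> {0..<L}")
      case True
      then have h: "0 \<le> h" "h < L" by auto
      have "(\<Sum>n. ennreal (kernel_term s L n h * D h)) = ennreal (\<Sum>n. kernel_term s L n h * D h)"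
        using summable_kernel_term[OF s L h]
        by (intro suminf_ennreal2 summable_mult2) (auto simp: kernel_term_nonneg D_def)
      also have "\<dots> = ennreal (per_kernel s L h * D h)"
        using summable_kernel_term[OF s L h] by (simp add: suminf_mult2 per_kernel_def)
      finally show ?thesis using True by simp
    qed simp
  qed
  finally show ?thesis by (simp add: F_def D_def)
qed


text \<open>Tonelli exchanges \<open>x\<close> and \<open>h\<close>, after which the inner integral
  is \<open>increment_square_integral\<close>. Only then may the sum over pairs be split, because
  the single pair terms have no sign.\<close>

lemma sawtooth_energy:
  fixes \<Lambda> :: nat and X :: "nat \<Rightarrow> real"
  assumes s: "0 < s" "s < 1 / 2" and \<Lambda>: "\<Lambda> \<ge> 1"
  defines "v \<equiv> sawtooth_sum \<Lambda> X" and "L \<equiv> real \<Lambda>"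
  shows "(LINT x:{0..L}|lborel. (LINT y|lborel. \<bar>v x - v y\<bar>\<^sup>2 / \<bar>x - y\<bar> powr (1 + 2 * s))) =
    (\<Sum>i<\<Lambda>. \<Sum>j<\<Lambda>. pair_energy s L (X i - X j))"
proof -
  have L: "L > 0" using \<Lambda> by (simp add: L_def)
  have [measurable]: "v \<in> borel_measurable borel" by (simp add: v_def)
  have [measurable]: "per_kernel s L \<in> borel_measurable borel" by (rule per_kernel_measurable[OF s L])
  define F where "F = (\<lambda>x y. \<bar>v x - v y\<bar>\<^sup>2 / \<bar>x - y\<bar> powr (1 + 2 * s))"
  have [measurable]: "case_prod F \<in> borel_measurable (lborel \<Otimes>\<^sub>M lborel)"
    unfolding F_def by measurable
  have [measurable]: "F x \<in> borel_measurable borel" for x unfolding F_def by measurable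
  define N where "N = (\<lambda>x. \<integral>\<^sup>+y. ennreal (F x y) \<partial>lborel)"
  have [measurable]: "N \<in> borel_measurable borel" unfolding N_def by measurable
  define V where "V = (\<lambda>h. LINT x:{0..<L}|lborel. (v (x + h) - v x)\<^sup>2)"
  have V0: "V h \<ge> 0" for h unfolding V_def set_lebesgue_integral_def
    by (rule Bochner_Integration.integral_nonneg) simp
  have V: "V h = (\<Sum>i<\<Lambda>. \<Sum>j<\<Lambda>. arc_overlap L h (X i - X j) - h\<^sup>2 / L)" if "0 \<le> h" "h < L" for h
    using increment_square_integral[OF \<Lambda>, of h X] that by (simp add: V_def v_def L_def)
  define W where "W = (\<lambda>h. \<Sum>i<\<Lambda>. \<Sum>j<\<Lambda>. per_kernel s L h * (arc_overlap L h (X i - X j) - h\<^sup>2 / L))"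
  have W: "per_kernel s L h * V h = W h" if "0 \<le> h" "h < L" for h
    using V[OF that] by (simp add: W_def sum_distrib_left)
  define g where "g = (\<lambda>i j h. indicator {0..<L} h *\<^sub>R (per_kernel s L h * (arc_overlap L h (X i - X j) - h\<^sup>2 / L)))"
  have gi: "integrable lborel (g i j)" for i j
    unfolding g_def using kernel_overlap_integrable[OF s L] by (simp add: set_integrable_def)
  have eqW: "(\<lambda>h. indicator {0..<L} h *\<^sub>R W h) = (\<lambda>h. \<Sum>i<\<Lambda>. \<Sum>j<\<Lambda>. g i j h)"
    by (simp add: W_def g_def sum_distrib_left)
  \<comment> \<open>This finiteness is what later allows the return from nonnegative to Bochner
    integrals.\<close>
  have Wi: "set_integrable lborel {0..<L} W"
    unfolding set_integrable_def eqW using gi by (intro Bochner_Integration.integrable_sum)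
  have "(LINT h:{0..<L}|lborel. W h) = (\<Sum>i<\<Lambda>. \<Sum>j<\<Lambda>. LINT h|lborel. g i j h)"
    unfolding set_lebesgue_integral_def eqW using gi
    by (simp add: Bochner_Integration.integral_sum Bochner_Integration.integrable_sum)
  then have LW: "(LINT h:{0..<L}|lborel. W h) = (\<Sum>i<\<Lambda>. \<Sum>j<\<Lambda>. pair_energy s L (X i - X j))"
    by (simp add: g_def pair_energy_def set_lebesgue_integral_def)
  have T: "(\<integral>\<^sup>+x\<in>{0..<L}. N x \<partial>lborel) = ennreal (LINT h:{0..<L}|lborel. W h)"
  proof -
    have "(\<integral>\<^sup>+x\<in>{0..<L}. N x \<partial>lborel) =
        (\<integral>\<^sup>+x. (\<integral>\<^sup>+h. ennreal (per_kernel s L h * (v (x + h) - v x)\<^sup>2) * indicator {0..<L} h * indicator {0..<L} x \<partial>lborel) \<partial>lborel)"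
      unfolding N_def F_def v_def L_def nn_integral_interaction[OF s \<Lambda>]
      by (intro nn_integral_cong nn_integral_multc[symmetric]) (simp add: L_def[symmetric] v_def[symmetric])
    also have "\<dots> = (\<integral>\<^sup>+h. (\<integral>\<^sup>+x. ennreal (per_kernel s L h * (v (x + h) - v x)\<^sup>2) * indicator {0..<L} h * indicator {0..<L} x \<partial>lborel) \<partial>lborel)"
      by (rule lborel_pair.Fubini') measurable
    also have "\<dots> = (\<integral>\<^sup>+h. ennreal (indicator {0..<L} h *\<^sub>R W h) \<partial>lborel)"
    proof (rule nn_integral_cong)
      fix h
      show "(\<integral>\<^sup>+x. ennreal (per_kernel s L h * (v (x + h) - v x)\<^sup>2) * indicator {0..<L} h * indicator {0..<L} x \<partial>lborel) =
          ennreal (indicator {0..<L} h *\<^sub>R W h)"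
      proof (cases "h \<in> {0..<L}")
        case True
        then have h: "0 \<le> h" "h < L" by auto
        have w: "per_kernel s L h \<ge> 0" by (rule per_kernel_nonneg[OF s L h])
        have si: "integrable lborel (\<lambda>x. indicator {0..<L} x *\<^sub>R (v (x + h) - v x)\<^sup>2)"
        proof -
          have "\<bar>(v (x + h) - v x)\<^sup>2\<bar> \<le> L\<^sup>2" for x
            using sawtooth_sum_bounds[of \<Lambda> X "x + h"] sawtooth_sum_bounds[of \<Lambda> X x]
            by (simp add: v_def L_def abs_le_square_iff[symmetric])
          then have "set_integrable lborel {0..<L} (\<lambda>x. (v (x + h) - v x)\<^sup>2)"
            by (intro bounded_set_integrable[where B = "L\<^sup>2" and a = 0 and b = L]) auto
          then show ?thesis by (simp add: set_integrable_def)
        qed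
        have "(\<integral>\<^sup>+x. ennreal (per_kernel s L h * (v (x + h) - v x)\<^sup>2) * indicator {0..<L} h * indicator {0..<L} x \<partial>lborel) =
            (\<integral>\<^sup>+x. ennreal (per_kernel s L h) * ennreal (indicator {0..<L} x *\<^sub>R (v (x + h) - v x)\<^sup>2) \<partial>lborel)"
          using w True by (intro nn_integral_cong) (auto simp: indicator_def ennreal_mult)
        also have "\<dots> = ennreal (per_kernel s L h) * (\<integral>\<^sup>+x. ennreal (indicator {0..<L} x *\<^sub>R (v (x + h) - v x)\<^sup>2) \<partial>lborel)"
          by (rule nn_integral_cmult) measurable
        also have "(\<integral>\<^sup>+x. ennreal (indicator {0..<L} x *\<^sub>R (v (x + h) - v x)\<^sup>2) \<partial>lborel) = ennreal (V h)"
          unfolding V_def set_lebesgue_integral_def by (rule nn_integral_eq_integral[OF si]) simp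
        also have "ennreal (per_kernel s L h) * ennreal (V h) = ennreal (W h)"
          using w V0 by (simp add: ennreal_mult[symmetric] W[OF h])
        finally show ?thesis using True by simp
      qed simp
    qed
    also have "\<dots> = ennreal (LINT h:{0..<L}|lborel. W h)"
      unfolding set_lebesgue_integral_def
    proof (rule nn_integral_eq_integral)
      show "AE h in lborel. 0 \<le> indicator {0..<L} h *\<^sub>R W h"
        using W V0 per_kernel_nonneg[OF s L] by (intro AE_I2) (metis atLeastLessThan_iff indicator_simps(2)
          mult_nonneg_nonneg indicator_simps(1) scaleR_one scaleR_zero_left order_refl)
    qed (use Wi in \<open>simp add: set_integrable_def\<close>)
    finally show ?thesis .
  qed
  \<comment> \<open>Where \<open>N x\<close> is infinite, the Bochner integral and
    \<open>enn2real\<close> both take the value 0; finiteness of the total makes these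
    \<open>x\<close> a null set.\<close>
  have fin: "AE x in lborel. N x * indicator {0..<L} x \<noteq> \<infinity>"
    by (rule nn_integral_PInf_AE) (use T in auto)
  have R: "(LINT y|lborel. F x y) = enn2real (N x)" for x
    unfolding N_def by (rule integral_eq_nn_integral) (auto simp: F_def)
  have "(LINT x:{0..L}|lborel. (LINT y|lborel. F x y)) = enn2real (\<integral>\<^sup>+x. ennreal (indicator {0..L} x * enn2real (N x)) \<partial>lborel)"
    unfolding set_lebesgue_integral_def R real_scaleR_def by (rule integral_eq_nn_integral) auto
  also have "(\<integral>\<^sup>+x. ennreal (indicator {0..L} x * enn2real (N x)) \<partial>lborel) = (\<integral>\<^sup>+x\<in>{0..<L}. N x \<partial>lborel)"
  proof (rule nn_integral_cong_AE)
    show "AE x in lborel. ennreal (indicator {0..L} x * enn2real (N x)) = N x * indicator {0..<L} x"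
      using fin AE_lborel_singleton[of L]
    proof eventually_elim
      case (elim x)
      then show ?case by (auto simp: indicator_def less_top)
    qed
  qed
  also have "\<dots> = ennreal (LINT h:{0..<L}|lborel. W h)" by (rule T)
  also have "enn2real \<dots> = (LINT h:{0..<L}|lborel. W h)"
  proof (rule enn2real_ennreal)
    show "0 \<le> (LINT h:{0..<L}|lborel. W h)"
      unfolding set_lebesgue_integral_def
    proof (rule Bochner_Integration.integral_nonneg)
      show "0 \<le> indicator {0..<L} h *\<^sub>R W h" for h
        using W[of h] V0[of h] per_kernel_nonneg[OF s L, of h]
        by (cases "h \<in> {0..<L}") (auto simp flip: W)
    qed
  qed
  finally show ?thesis by (simp add: F_def LW)
qed

theorem energy_eq_pair_energy:
  assumes s: "0 < s" "s < 1 / 2" and \<Lambda>: "\<Lambda> \<ge> 1"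
  shows "energy s \<Lambda> X = 1 / 2 * (\<Sum>i<\<Lambda>. \<Sum>j<\<Lambda>. pair_energy s (real \<Lambda>) (X i - X j))"
proof -
  define u where "u = potential \<Lambda> X"
  define v where "v = sawtooth_sum \<Lambda> X"
  have v: "is_potential \<Lambda> X v" unfolding v_def by (rule is_potential_sawtooth_sum[OF \<Lambda>])
  then have u: "is_potential \<Lambda> X u" unfolding u_def potential_def using someI[of "is_potential \<Lambda> X" v] by blast
  obtain c where c: "AE x in lborel. u x = v x + c" using potential_unique[OF u v] by blast
  have [measurable]: "u \<in> borel_measurable borel"
    using u locally_integrable_measurable[of u] by (simp add: is_potential_def locally_integrable_def)
  have [measurable]: "v \<in> borel_measurable borel" by (simp add: v_def)
  have inner: "AE x in lborel. (LINT y|lborel. \<bar>u x - u y\<bar>\<^sup>2 / \<bar>x - y\<bar> powr (1 + 2 * s)) =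
      (LINT y|lborel. \<bar>v x - v y\<bar>\<^sup>2 / \<bar>x - y\<bar> powr (1 + 2 * s))"
    using c
  proof eventually_elim
    case (elim x)
    show ?case
    proof (rule integral_cong_AE)
      show "AE y in lborel. \<bar>u x - u y\<bar>\<^sup>2 / \<bar>x - y\<bar> powr (1 + 2 * s) = \<bar>v x - v y\<bar>\<^sup>2 / \<bar>x - y\<bar> powr (1 + 2 * s)"
        using c by eventually_elim (simp add: elim)
    qed measurable
  qed
  have "(LINT x:{0..real \<Lambda>}|lborel. (LINT y|lborel. \<bar>u x - u y\<bar>\<^sup>2 / \<bar>x - y\<bar> powr (1 + 2 * s))) =
      (LINT x:{0..real \<Lambda>}|lborel. (LINT y|lborel. \<bar>v x - v y\<bar>\<^sup>2 / \<bar>x - y\<bar> powr (1 + 2 * s)))"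
    unfolding set_lebesgue_integral_def
  proof (rule integral_cong_AE)
    show "AE x in lborel. indicator {0..real \<Lambda>} x *\<^sub>R (LINT y|lborel. \<bar>u x - u y\<bar>\<^sup>2 / \<bar>x - y\<bar> powr (1 + 2 * s)) =
        indicator {0..real \<Lambda>} x *\<^sub>R (LINT y|lborel. \<bar>v x - v y\<bar>\<^sup>2 / \<bar>x - y\<bar> powr (1 + 2 * s))"
      using inner by eventually_elim simp
  qed measurable
  then show ?thesis
    unfolding energy_def u_def[symmetric] using sawtooth_energy[OF s \<Lambda>, of X] by (simp add: v_def)
qed

subsection \<open>Derivatives of the pair interaction\<close>

text \<open>An equation between choice terms, valid also where no derivative exists. It makes the
  derivatives of the pair energy periodic at collisions as well.\<close>

lemma deriv_shift: "deriv f (x + z) = deriv (\<lambda>x. f (x + z)) x" for f :: "real \<Rightarrow> real"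
  unfolding deriv_def DERIV_shift ..

lemma rmod_minus: "L > 0 \<Longrightarrow> (- t) rmod L = (if t rmod L = 0 then 0 else L - t rmod L)"
proof -
  assume L: "L > 0"
  have t: "t = t rmod L + of_int \<lfloor>t / L\<rfloor> * L" using L by (simp add: rmod_def)
  have b: "0 \<le> t rmod L" "t rmod L < L" using L by (auto simp: rmod_nonneg rmod_less)
  show ?thesis
  proof (cases "t rmod L = 0")
    case True
    have "(- t) rmod L = 0"
      by (rule rmod_eq_iff[where k = "- \<lfloor>t / L\<rfloor>"]) (use t L True in auto)
    then show ?thesis using True by simp
  next
    case False
    have "(- t) rmod L = L - t rmod L"
    proof (rule rmod_eq_iff[where k = "- \<lfloor>t / L\<rfloor> - 1"])
      show "- t = L - t rmod L + of_int (- \<lfloor>t / L\<rfloor> - 1) * L"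
        using t by (simp add: algebra_simps)
    qed (use b False L in auto)
    then show ?thesis using False by simp
  qed
qed

context
  fixes s L :: real
  assumes s: "0 < s" "s < 1 / 2" and L: "L > 0"
begin

lemma pair_energy_periodic: "pair_energy s L (t + L) = pair_energy s L t"
  using L by (simp add: pair_energy_def arc_overlap_def)

lemma pair_energy_even: "pair_energy s L (- t) = pair_energy s L t"
proof -
  have "arc_overlap L h (- t) = arc_overlap L h t" if "h < L" for h
    using that L by (simp add: arc_overlap_def rmod_minus)
  then have "indicator {0..<L} h *\<^sub>R (per_kernel s L h * (arc_overlap L h (- t) - h\<^sup>2 / L)) =
      indicator {0..<L} h *\<^sub>R (per_kernel s L h * (arc_overlap L h t - h\<^sup>2 / L))" for h
    by (auto simp: indicator_def)
  then show ?thesis unfolding pair_energy_def set_lebesgue_integral_def by (simp only:)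
qed

text \<open>\<open>U\<close> is a second primitive of the kernel on the open period. Differences are
  used because for \<open>h\<close> near \<open>0\<close> or \<open>L\<close> the overlaps for
  \<open>t\<close> and \<open>t'\<close> coincide, so the singular ends cancel and only a compact
  interval remains.\<close>

lemma pair_energy_primitives:
  obtains U W where "\<And>t. 0 < t \<Longrightarrow> t < L \<Longrightarrow> (U has_real_derivative W t) (at t)"
    "\<And>t. 0 < t \<Longrightarrow> t < L \<Longrightarrow> (W has_real_derivative per_kernel s L t) (at t)"
    "\<And>t t'. 0 < t \<Longrightarrow> t < L \<Longrightarrow> 0 < t' \<Longrightarrow> t' < L \<Longrightarrow>
      pair_energy s L t - pair_energy s L t' = U t + U (L - t) - U t' - U (L - t')"
proof -
  define w where "w = per_kernel s L"
  have wc: "isCont w t" if "0 < t" "t < L" for t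
    using continuous_on_per_kernel[OF s L] that unfolding w_def
    by (simp add: continuous_on_eq_continuous_at)
  have "\<exists>F. \<forall>x::real. ereal 0 < x \<longrightarrow> x < ereal L \<longrightarrow> (F has_vector_derivative w x) (at x)"
    using L wc by (intro einterval_antiderivative) auto
  then obtain W where W: "(W has_real_derivative w t) (at t)" if "0 < t" "t < L" for t
    by (auto simp: has_real_derivative_iff_has_vector_derivative)
  have "\<exists>F. \<forall>x::real. ereal 0 < x \<longrightarrow> x < ereal L \<longrightarrow> (F has_vector_derivative W x) (at x)"
    using L W by (intro einterval_antiderivative) (auto intro: DERIV_isCont)
  then obtain U where U: "(U has_real_derivative W t) (at t)" if "0 < t" "t < L" for t
    by (auto simp: has_real_derivative_iff_has_vector_derivative)
  show thesis
  proof (rule that[of U W])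
    fix t t' assume t: "0 < t" "t < L" "0 < t'" "t' < L"
    \<comment> \<open>Chosen so that \<open>{a..L - a}\<close> contains all four kinks
      \<open>t\<close>, \<open>L - t\<close>, \<open>t'\<close>, \<open>L - t'\<close>.\<close>
    define a where "a = min (min t (L - t)) (min t' (L - t'))"
    define b where "b = L - a"
    have a: "0 < a" "a \<le> t" "t \<le> b" "a \<le> t'" "t' \<le> b" "b < L" "a \<le> L - t" "L - t \<le> b" "a \<le> L - t'" "L - t' \<le> b"
      using t by (auto simp: a_def b_def)
    define I where "I = (\<lambda>r. LINT h:{a..b}|lborel. w h * max 0 (h - r))"
    have int: "set_integrable lborel {a..b} (\<lambda>h. w h * max 0 (h - r))" for r
    proof (rule borel_integrable_atLeastAtMost')
      have "continuous_on {a..b} w"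
        using wc a by (auto simp: continuous_on_eq_continuous_within intro: continuous_at_imp_continuous_at_within)
      then show "continuous_on {a..b} (\<lambda>h. w h * max 0 (h - r))" by (intro continuous_intros)
    qed
    \<comment> \<open>Integration by parts: \<open>W h * (h - r) - U h\<close> is a primitive of the
      kernel times \<open>h - r\<close>.\<close>
    have I: "I r = W b * (b - r) - U b + U r" if r: "a \<le> r" "r \<le> b" for r
    proof -
      have "I r = (LINT h|lborel. (w h * (h - r)) * indicator {r..b} h)"
        unfolding I_def set_lebesgue_integral_def
        by (rule Bochner_Integration.integral_cong) (use r in \<open>auto simp: indicator_def\<close>)
      also have "\<dots> = (W b * (b - r) - U b) - (W r * (r - r) - U r)"
      proof (rule integral_FTC_Icc_real)
        fix x assume x: "r \<le> x" "x \<le> b"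
        then have x': "0 < x" "x < L" using a r by auto
        show "((\<lambda>h. W h * (h - r) - U h) has_real_derivative w x * (x - r)) (at x)"
          using W[OF x'] U[OF x'] by (auto intro!: derivative_eq_intros)
        show "isCont (\<lambda>h. w h * (h - r)) x"
          using wc[OF x'] by (intro continuous_intros)
      qed (use r in simp)
      finally show ?thesis by simp
    qed
    have rm: "t rmod L = t" "t' rmod L = t'" using t by simp_all
    define A where "A = (\<lambda>h r. per_kernel s L h * (arc_overlap L h r - h\<^sup>2 / L))"
    have Ai: "integrable lborel (\<lambda>h. indicator {0..<L} h *\<^sub>R A h r)" for r
      using kernel_overlap_integrable[OF s L, of r] unfolding A_def set_integrable_def .
    have Ii: "integrable lborel (\<lambda>h. indicator {a..b} h *\<^sub>R (w h * max 0 (h - r)))" for r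
      using int unfolding set_integrable_def .
    have pt: "indicator {0..<L} h *\<^sub>R A h t - indicator {0..<L} h *\<^sub>R A h t' =
        indicator {a..b} h *\<^sub>R (w h * max 0 (h - t)) + indicator {a..b} h *\<^sub>R (w h * max 0 (h - (L - t))) -
        (indicator {a..b} h *\<^sub>R (w h * max 0 (h - t')) + indicator {a..b} h *\<^sub>R (w h * max 0 (h - (L - t'))))" for h
    proof -
      \<comment> \<open>For \<open>h < a\<close> both overlaps are 0, and for \<open>h > b\<close>
        both equal \<open>2 * h - L\<close>.\<close>
      consider "h < 0 \<or> h \<ge> L" | "0 \<le> h" "h < a" | "a \<le> h" "h \<le> b" | "b < h" "h < L" by linarith
      then show ?thesis
      proof cases
        case 2
        then have "arc_overlap L h t = arc_overlap L h t'" using a by (simp add: arc_overlap_def rm)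
        then show ?thesis using 2 by (simp add: A_def)
      next
        case 3
        then show ?thesis using a by (simp add: A_def w_def arc_overlap_def rm algebra_simps)
      next
        case 4
        then have "arc_overlap L h t = arc_overlap L h t'" using a by (simp add: arc_overlap_def rm)
        then show ?thesis using 4 by (simp add: A_def)
      qed (use a in auto)
    qed
    have "pair_energy s L t - pair_energy s L t' =
        (LINT h|lborel. indicator {0..<L} h *\<^sub>R A h t - indicator {0..<L} h *\<^sub>R A h t')"
      using Ai by (simp add: pair_energy_def set_lebesgue_integral_def A_def)
    also have "\<dots> = I t + I (L - t) - (I t' + I (L - t'))"
      unfolding pt I_def set_lebesgue_integral_def using Ii by simp
    also have "\<dots> = U t + U (L - t) - U t' - U (L - t')"
      using a by (simp add: I algebra_simps)
    finally show "pair_energy s L t - pair_energy s L t' = U t + U (L - t) - U t' - U (L - t')" .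
  qed (use U W in \<open>auto simp: w_def\<close>)
qed

lemma pair_energy_derivs_period:
  assumes "0 < t" "t < L"
  shows "(pair_energy s L has_real_derivative deriv (pair_energy s L) t) (at t)"
    and "(deriv (pair_energy s L) has_real_derivative per_kernel s L t + per_kernel s L (L - t)) (at t)"
proof -
  obtain U W where U: "\<And>t. 0 < t \<Longrightarrow> t < L \<Longrightarrow> (U has_real_derivative W t) (at t)"
    and W: "\<And>t. 0 < t \<Longrightarrow> t < L \<Longrightarrow> (W has_real_derivative per_kernel s L t) (at t)"
    and G: "\<And>t t'. 0 < t \<Longrightarrow> t < L \<Longrightarrow> 0 < t' \<Longrightarrow> t' < L \<Longrightarrow>
      pair_energy s L t - pair_energy s L t' = U t + U (L - t) - U t' - U (L - t')"
    using pair_energy_primitives by blast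
  \<comment> \<open>The midpoint serves as the fixed comparison point \<open>t'\<close>, turning the
    difference formula into one for the pair energy itself.\<close>
  define c where "c = pair_energy s L (L / 2) - U (L / 2) - U (L - L / 2)"
  have D: "(pair_energy s L has_real_derivative W t - W (L - t)) (at t)" if t: "0 < t" "t < L" for t
  proof (rule has_field_derivative_transform_within_open[where S = "{0<..<L}"])
    show "((\<lambda>t. c + U t + U (L - t)) has_real_derivative W t - W (L - t)) (at t)"
      using U[OF t] U[of "L - t"] t
      by (auto intro!: derivative_eq_intros DERIV_chain2[where f = U])
    show "c + U x + U (L - x) = pair_energy s L x" if "x \<in> {0<..<L}" for x
      using G[of x "L / 2"] that L by (simp add: c_def)
  qed (use t in auto)
  have g: "deriv (pair_energy s L) t = W t - W (L - t)" if t: "0 < t" "t < L" for t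
    using D[OF t] by (rule DERIV_imp_deriv)
  show "(pair_energy s L has_real_derivative deriv (pair_energy s L) t) (at t)"
    using D[OF assms] g[OF assms] by simp
  show "(deriv (pair_energy s L) has_real_derivative per_kernel s L t + per_kernel s L (L - t)) (at t)"
  proof (rule has_field_derivative_transform_within_open[where S = "{0<..<L}"])
    show "((\<lambda>t. W t - W (L - t)) has_real_derivative per_kernel s L t + per_kernel s L (L - t)) (at t)"
      using W[OF assms] W[of "L - t"] assms
      by (auto intro!: derivative_eq_intros DERIV_chain2[where f = W])
  qed (use assms g in auto)
qed

lemma deriv_pair_energy_periodic: "deriv (pair_energy s L) (t + L) = deriv (pair_energy s L) t"
  unfolding deriv_shift by (simp add: pair_energy_periodic)

lemma deriv2_pair_energy_periodic: "deriv (deriv (pair_energy s L)) (t + L) = deriv (deriv (pair_energy s L)) t"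
  unfolding deriv_shift[of "deriv (pair_energy s L)"] by (simp add: deriv_pair_energy_periodic)

lemma pair_energy_derivs:
  assumes "t rmod L \<noteq> 0"
  shows "(pair_energy s L has_real_derivative deriv (pair_energy s L) t) (at t)"
    and "(deriv (pair_energy s L) has_real_derivative deriv (deriv (pair_energy s L)) t) (at t)"
    and "deriv (deriv (pair_energy s L)) t \<ge> 2 * L powr (- 1 - 2 * s)"
proof -
  define r where "r = t rmod L"
  define z where "z = of_int \<lfloor>t / L\<rfloor> * L"
  have r: "0 < r" "r < L" using L assms rmod_nonneg[of L t] by (auto simp: r_def rmod_less)
  have t: "t = r + z" using L by (simp add: r_def z_def rmod_def)
  have per: "pair_energy s L (x + z) = pair_energy s L x"
    "deriv (pair_energy s L) (x + z) = deriv (pair_energy s L) x"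
    "deriv (deriv (pair_energy s L)) (x + z) = deriv (deriv (pair_energy s L)) x" for x
    unfolding z_def using periodic_of_int pair_energy_periodic deriv_pair_energy_periodic deriv2_pair_energy_periodic by blast+
  note D = pair_energy_derivs_period[OF r]
  have d2: "deriv (deriv (pair_energy s L)) r = per_kernel s L r + per_kernel s L (L - r)"
    using D(2) by (rule DERIV_imp_deriv)
  show "(pair_energy s L has_real_derivative deriv (pair_energy s L) t) (at t)"
    unfolding t DERIV_shift per using D(1) .
  show "(deriv (pair_energy s L) has_real_derivative deriv (deriv (pair_energy s L)) t) (at t)"
    unfolding t DERIV_shift per using D(2) d2 by simp
  \<comment> \<open>The second derivative is a sum of two kernel values, and the nearest image alone
    bounds each of them; this gives the factor 2.\<close>
  have "L powr (- 1 - 2 * s) \<le> x powr (- 1 - 2 * s)" if "0 < x" "x < L" for x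
    using that s by (intro powr_mono2') auto
  then have "L powr (- 1 - 2 * s) \<le> per_kernel s L x" if "0 < x" "x < L" for x
    using per_kernel_ge[OF s L, of x] that by (meson less_imp_le order_trans)
  from this[of r] this[of "L - r"] show "deriv (deriv (pair_energy s L)) t \<ge> 2 * L powr (- 1 - 2 * s)"
    unfolding t per d2 using r by simp
qed

end

subsection \<open>Periodic pair interactions\<close>

lemma DERIV_minus_const:
  fixes F :: "real \<Rightarrow> real"
  assumes "(F has_real_derivative D) (at (x - c))"
  shows "((\<lambda>r. F (r - c)) has_real_derivative D) (at x)"
  using DERIV_shift[of F D x "- c"] assms by simp

lemma DERIV_const_minus:
  fixes F :: "real \<Rightarrow> real"
  assumes "(F has_real_derivative D) (at (c - x))"
  shows "((\<lambda>r. F (c - r)) has_real_derivative - D) (at x)"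
proof -
  have "((\<lambda>r. c - r) has_real_derivative - 1) (at x)" by (auto intro!: derivative_eq_intros)
  from DERIV_chain[of F D "\<lambda>r. c - r" x, OF assms this] show ?thesis by (simp add: o_def)
qed

text \<open>Differentiability is asked only away from multiples of \<open>L\<close>: coinciding
  particles are singular for the pair energy. \<open>g\<close> and \<open>f\<close> stand for its
  first and second derivatives.\<close>

locale periodic_pair_interaction =
  fixes L :: real and G g f :: "real \<Rightarrow> real"
  assumes L: "L > 0"
    and G_even: "G (- t) = G t"
    and G_deriv: "t rmod L \<noteq> 0 \<Longrightarrow> (G has_real_derivative g t) (at t)"
    and g_deriv: "t rmod L \<noteq> 0 \<Longrightarrow> (g has_real_derivative f t) (at t)"
    and g_periodic: "g (t + L) = g t"
    and f_periodic: "f (t + L) = f t"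
begin

lemma rmod_minus_eq_0: "(- t) rmod L = 0 \<longleftrightarrow> t rmod L = 0"
  using rmod_minus[OF L, of t] L rmod_less[of L t] by auto

lemma open_noncollision: "open {t. t rmod L \<noteq> 0}"
proof -
  have "{t. t rmod L \<noteq> 0} = - ((\<lambda>t. t / L) -` \<int>)"
    using L by (auto simp: rmod_conv_frac)
  moreover have "closed ((\<lambda>t :: real. t / L) -` \<int>)"
    using L by (intro continuous_closed_vimage closed_Ints) (auto intro!: continuous_intros)
  ultimately show ?thesis by (simp add: open_Compl)
qed

lemma g_odd:
  assumes "t rmod L \<noteq> 0"
  shows "g (- t) = - g t"
proof -
  have "((\<lambda>x. G (- x)) has_real_derivative - g (- t)) (at t)"
    using G_deriv[of "- t"] assms by (intro DERIV_mirror[THEN iffD1]) (simp add: rmod_minus_eq_0)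
  then have "(G has_real_derivative - g (- t)) (at t)" by (simp add: G_even)
  then show ?thesis using G_deriv[OF assms] DERIV_unique by fastforce
qed

lemma f_even:
  assumes "t rmod L \<noteq> 0"
  shows "f (- t) = f t"
proof -
  have "((\<lambda>x. g (- x)) has_real_derivative - f (- t)) (at t)"
    using g_deriv[of "- t"] assms by (intro DERIV_mirror[THEN iffD1]) (simp add: rmod_minus_eq_0)
  moreover have "((\<lambda>x. g (- x)) has_real_derivative - f t) (at t)"
  \<comment> \<open>Oddness of \<open>g\<close> is known off collisions only, so differentiating it
    requires that this set be open.\<close>
  proof (rule has_field_derivative_transform_within_open[OF _ open_noncollision])
    show "((\<lambda>x. - g x) has_real_derivative - f t) (at t)"
      using g_deriv[OF assms] by (rule DERIV_minus)
  qed (use assms g_odd in auto)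
  ultimately show ?thesis using DERIV_unique by fastforce
qed

section \<open>First and second derivatives of the total energy\<close>

definition noncolliding :: "nat \<Rightarrow> (nat \<Rightarrow> real) \<Rightarrow> bool" where
  "noncolliding n X \<longleftrightarrow> (\<forall>i<n. \<forall>j<n. i \<noteq> j \<longrightarrow> (X i - X j) rmod L \<noteq> 0)"

definition total_energy :: "nat \<Rightarrow> (nat \<Rightarrow> real) \<Rightarrow> real" where
  "total_energy n X = 1 / 2 * (\<Sum>i<n. \<Sum>j<n. G (X i - X j))"

definition force :: "nat \<Rightarrow> (nat \<Rightarrow> real) \<Rightarrow> nat \<Rightarrow> real" where
  "force n X i = (\<Sum>j\<in>{..<n} - {i}. g (X i - X j))"

text \<open>Isolates the dependence on one particle. Evenness merges its two rows of interactions,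
  which cancels the factor 1/2, and the self-interaction becomes the constant \<open>G 0\<close>, so
  the singularity at 0 is never differentiated.\<close>

lemma total_energy_upd:
  assumes i: "i < n"
  shows "total_energy n (X(i := r)) = 1 / 2 * G 0 + (\<Sum>j\<in>{..<n} - {i}. G (r - X j)) +
    1 / 2 * (\<Sum>j\<in>{..<n} - {i}. \<Sum>k\<in>{..<n} - {i}. G (X j - X k))"
proof -
  let ?I = "{..<n} - {i}"
  have split: "sum h {..<n} = h i + sum h ?I" for h :: "nat \<Rightarrow> real"
    using i by (intro sum.remove) auto
  have G': "G (X j - r) = G (r - X j)" for j using G_even[of "r - X j"] by simp
  show ?thesis
    unfolding total_energy_def split by (simp add: sum.distrib G' algebra_simps)
qed

lemma partial_total_energy:
  assumes X: "noncolliding n X" and i: "i < n"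
  shows "partial i (total_energy n) X = force n X i"
  unfolding partial_def total_energy_upd[OF i] force_def
proof (rule DERIV_imp_deriv)
  have "((\<lambda>r. \<Sum>j\<in>{..<n} - {i}. G (r - X j)) has_real_derivative (\<Sum>j\<in>{..<n} - {i}. g (X i - X j))) (at (X i))"
  proof (rule DERIV_sum)
    fix j assume "j \<in> {..<n} - {i}"
    then have "(X i - X j) rmod L \<noteq> 0" using X i by (auto simp: noncolliding_def)
    then show "((\<lambda>r. G (r - X j)) has_real_derivative g (X i - X j)) (at (X i))"
      by (intro DERIV_minus_const G_deriv)
  qed
  from DERIV_add[OF DERIV_add[OF DERIV_const this] DERIV_const]
  show "((\<lambda>r. 1 / 2 * G 0 + (\<Sum>j\<in>{..<n} - {i}. G (r - X j)) +
      1 / 2 * (\<Sum>j\<in>{..<n} - {i}. \<Sum>k\<in>{..<n} - {i}. G (X j - X k)))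
      has_real_derivative (\<Sum>j\<in>{..<n} - {i}. g (X i - X j))) (at (X i))"
    by simp
qed

text \<open>A second partial derivative needs the formula for the first one on a whole
  neighbourhood.\<close>

lemma eventually_noncolliding_upd:
  assumes X: "noncolliding n X" and j: "j < n"
  shows "\<forall>\<^sub>F r in nhds (X j). noncolliding n (X(j := r))"
proof -
  have "\<forall>\<^sub>F r in nhds (X j). \<forall>k\<in>{..<n} - {j}. (r - X k) rmod L \<noteq> 0"
  proof (intro eventually_ball_finite ballI)
    fix k assume k: "k \<in> {..<n} - {j}"
    have "open ((\<lambda>r. r - X k) -` {t. t rmod L \<noteq> 0})"
      by (intro open_vimage open_noncollision continuous_intros)
    moreover have "X j \<in> (\<lambda>r. r - X k) -` {t. t rmod L \<noteq> 0}"
      using X j k by (auto simp: noncolliding_def)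
    ultimately show "\<forall>\<^sub>F r in nhds (X j). (r - X k) rmod L \<noteq> 0"
      unfolding eventually_nhds by blast
  qed auto
  then show ?thesis
  proof eventually_elim
    case (elim r)
    have "(X k - r) rmod L \<noteq> 0" if "k < n" "k \<noteq> j" for k
      using elim that rmod_minus_eq_0[of "r - X k"] by auto
    then show ?case using elim X by (auto simp: noncolliding_def)
  qed
qed

lemma partial_partial_total_energy:
  assumes X: "noncolliding n X" and i: "i < n" and j: "j < n"
  shows "partial j (partial i (total_energy n)) X =
    (if i = j then \<Sum>k\<in>{..<n} - {i}. f (X i - X k) else - f (X i - X j))"
proof -
  have ev: "\<forall>\<^sub>F r in nhds (X j). partial i (total_energy n) (X(j := r)) = force n (X(j := r)) i"
    using eventually_noncolliding_upd[OF X j] by eventually_elim (rule partial_total_energy[OF _ i])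
  have D: "((\<lambda>r. g ((X(j := r)) i - (X(j := r)) k)) has_real_derivative
      (if i = j then f (X i - X k) else if k = j then - f (X i - X j) else 0)) (at (X j))"
    if k: "k \<in> {..<n} - {i}" for k
  proof -
    have nc: "(X i - X k) rmod L \<noteq> 0" using X i k by (auto simp: noncolliding_def)
    consider "i = j" | "i \<noteq> j" "k = j" | "i \<noteq> j" "k \<noteq> j" by blast
    then show ?thesis
    proof cases
      case 1
      then have "k \<noteq> j" using k by auto
      then show ?thesis using 1 DERIV_minus_const[OF g_deriv, of "X j" "X k"] nc by simp
    next
      case 2
      then show ?thesis using DERIV_const_minus[OF g_deriv, of "X i" "X j"] nc by simp
    qed auto
  qed
  have "((\<lambda>r. force n (X(j := r)) i) has_real_derivative
      (\<Sum>k\<in>{..<n} - {i}. if i = j then f (X i - X k) else if k = j then - f (X i - X j) else 0)) (at (X j))"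
    unfolding force_def by (intro DERIV_sum D)
  also have "(\<Sum>k\<in>{..<n} - {i}. if i = j then f (X i - X k) else if k = j then - f (X i - X j) else 0) =
      (if i = j then \<Sum>k\<in>{..<n} - {i}. f (X i - X k) else - f (X i - X j))"
    using j by (auto simp: sum.delta)
  finally show ?thesis
    unfolding partial_def[of j] deriv_cong_ev[OF ev refl] by (rule DERIV_imp_deriv)
qed

text \<open>The Hessian has the sum of the \<open>f\<close> values on the diagonal and
  \<open>- f\<close> off it, as a weighted graph Laplacian does; its rows sum to zero, so only
  differences of \<open>h\<close> occur.\<close>

definition hess_form :: "nat \<Rightarrow> (nat \<Rightarrow> real) \<Rightarrow> (nat \<Rightarrow> real) \<Rightarrow> real" where
  "hess_form n X h = (\<Sum>i<n. \<Sum>j\<in>{..<n} - {i}. f (X i - X j) * (h i - h j) * h i)"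

lemma hessian_eq_hess_form:
  assumes X: "noncolliding n X"
  shows "(\<Sum>i<n. \<Sum>j<n. partial i (partial j (total_energy n)) X * h j * h i) = hess_form n X h"
  unfolding hess_form_def
proof (rule sum.cong[OF refl])
  fix i assume "i \<in> {..<n}"
  then have i: "i < n" by simp
  have "(\<Sum>j<n. partial i (partial j (total_energy n)) X * h j * h i) =
      partial i (partial i (total_energy n)) X * h i * h i +
      (\<Sum>j\<in>{..<n} - {i}. partial i (partial j (total_energy n)) X * h j * h i)"
    using i by (intro sum.remove) auto
  also have "partial i (partial i (total_energy n)) X = (\<Sum>j\<in>{..<n} - {i}. f (X i - X j))"
    using partial_partial_total_energy[OF X i i] by simp
  also have "(\<Sum>j\<in>{..<n} - {i}. partial i (partial j (total_energy n)) X * h j * h i) =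
      (\<Sum>j\<in>{..<n} - {i}. - f (X i - X j) * h j * h i)"
  proof (rule sum.cong[OF refl])
    fix j assume j: "j \<in> {..<n} - {i}"
    have "(X i - X j) rmod L \<noteq> 0" using X i j by (auto simp: noncolliding_def)
    then have "f (X j - X i) = f (X i - X j)" using f_even by fastforce
    then show "partial i (partial j (total_energy n)) X * h j * h i = - f (X i - X j) * h j * h i"
      using partial_partial_total_energy[OF X, of j i] i j by auto
  qed
  finally show "(\<Sum>j<n. partial i (partial j (total_energy n)) X * h j * h i) =
      (\<Sum>j\<in>{..<n} - {i}. f (X i - X j) * (h i - h j) * h i)"
    by (simp only: sum_distrib_right sum.distrib[symmetric]) (simp add: algebra_simps)
qed

lemma sum_offdiag_swap:
  fixes a :: "nat \<Rightarrow> nat \<Rightarrow> real"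
  shows "(\<Sum>i<n. \<Sum>j\<in>{..<n} - {i}. a i j) = (\<Sum>i<n. \<Sum>j\<in>{..<n} - {i}. a j i)"
proof -
  have "(\<Sum>i<n. \<Sum>j\<in>{..<n} - {i}. a i j) = (\<Sum>i<n. \<Sum>j<n. if i \<noteq> j then a i j else 0)" for a :: "nat \<Rightarrow> nat \<Rightarrow> real"
    by (intro sum.cong refl sum.mono_neutral_cong_left) auto
  note * = this
  show ?thesis unfolding * by (subst sum.swap) (intro sum.cong refl, auto)
qed

text \<open>Averaging with the sum in which \<open>i\<close> and \<open>j\<close> are exchanged,
  using that \<open>f\<close> is even, exhibits the form as a sum of squares.\<close>

lemma hess_form_symmetric:
  assumes X: "noncolliding n X"
  shows "2 * hess_form n X h = (\<Sum>i<n. \<Sum>j\<in>{..<n} - {i}. f (X i - X j) * (h i - h j)\<^sup>2)"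
proof -
  have "hess_form n X h = (\<Sum>i<n. \<Sum>j\<in>{..<n} - {i}. f (X j - X i) * (h j - h i) * h j)"
    unfolding hess_form_def by (rule sum_offdiag_swap)
  also have "\<dots> = (\<Sum>i<n. \<Sum>j\<in>{..<n} - {i}. f (X i - X j) * (h j - h i) * h j)"
  proof (intro sum.cong refl)
    fix i j assume "i \<in> {..<n}" "j \<in> {..<n} - {i}"
    then have "(X i - X j) rmod L \<noteq> 0" using X by (auto simp: noncolliding_def)
    then have "f (X j - X i) = f (X i - X j)" using f_even by fastforce
    then show "f (X j - X i) * (h j - h i) * h j = f (X i - X j) * (h j - h i) * h j" by simp
  qed
  finally have "2 * hess_form n X h =
      (\<Sum>i<n. \<Sum>j\<in>{..<n} - {i}. f (X i - X j) * (h i - h j) * h i) +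
      (\<Sum>i<n. \<Sum>j\<in>{..<n} - {i}. f (X i - X j) * (h j - h i) * h j)"
    unfolding mult_2 by (simp add: hess_form_def)
  also have "\<dots> = (\<Sum>i<n. \<Sum>j\<in>{..<n} - {i}. f (X i - X j) * (h i - h j)\<^sup>2)"
    unfolding sum.distrib[symmetric] by (intro sum.cong refl) (simp add: power2_eq_square algebra_simps)
  finally show ?thesis .
qed

text \<open>For \<open>h\<close> with zero sum, the squared differences over all pairs add up to
  \<open>2 * n\<close> times the squared norm. This factor \<open>n\<close> later improves the power
  \<open>- 1 - 2 * s\<close> of \<Lambda> to \<open>- 2 * s\<close>.\<close>

lemma hess_form_ge:
  assumes X: "noncolliding n X" and m: "\<And>t. t rmod L \<noteq> 0 \<Longrightarrow> f t \<ge> m" and h: "(\<Sum>i<n. h i) = 0"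
  shows "hess_form n X h \<ge> m * real n * (\<Sum>i<n. (h i)\<^sup>2)"
proof -
  have "(\<Sum>i<n. \<Sum>j<n. (h i - h j)\<^sup>2) = (\<Sum>i<n. \<Sum>j<n. (h i)\<^sup>2 + (h j)\<^sup>2 - 2 * (h i * h j))"
    by (intro sum.cong refl) (simp add: power2_diff)
  also have "\<dots> = 2 * real n * (\<Sum>i<n. (h i)\<^sup>2) - 2 * (\<Sum>i<n. h i) * (\<Sum>j<n. h j)"
    by (simp add: sum.distrib sum_subtractf sum_product sum_distrib_left algebra_simps)
  finally have 1: "(\<Sum>i<n. \<Sum>j<n. (h i - h j)\<^sup>2) = 2 * real n * (\<Sum>i<n. (h i)\<^sup>2)" using h by simp
  have "m * (\<Sum>i<n. \<Sum>j<n. (h i - h j)\<^sup>2) = (\<Sum>i<n. \<Sum>j\<in>{..<n} - {i}. m * (h i - h j)\<^sup>2)"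
    unfolding sum_distrib_left by (intro sum.cong refl sum.mono_neutral_right) auto
  also have "\<dots> \<le> (\<Sum>i<n. \<Sum>j\<in>{..<n} - {i}. f (X i - X j) * (h i - h j)\<^sup>2)"
    using X m by (intro sum_mono mult_right_mono) (auto simp: noncolliding_def)
  also have "\<dots> = 2 * hess_form n X h" using hess_form_symmetric[OF X] by simp
  finally show ?thesis unfolding 1 by simp
qed

text \<open>Action equals reaction, since \<open>g\<close> is odd; hence the flow preserves the sum
  of the positions.\<close>

lemma sum_force_eq_0:
  assumes X: "noncolliding n X"
  shows "(\<Sum>i<n. force n X i) = 0"
proof -
  have "(\<Sum>i<n. force n X i) = (\<Sum>i<n. \<Sum>j\<in>{..<n} - {i}. g (X j - X i))"
    unfolding force_def by (rule sum_offdiag_swap)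
  also have "\<dots> = (\<Sum>i<n. \<Sum>j\<in>{..<n} - {i}. - g (X i - X j))"
  proof (intro sum.cong refl)
    fix i j assume "i \<in> {..<n}" "j \<in> {..<n} - {i}"
    then have "(X i - X j) rmod L \<noteq> 0" using X by (auto simp: noncolliding_def)
    then show "g (X j - X i) = - g (X i - X j)" using g_odd by fastforce
  qed
  also have "\<dots> = - (\<Sum>i<n. force n X i)" by (simp add: force_def sum_negf)
  finally show ?thesis by simp
qed

section \<open>Chambers, monotonicity of the force and gradient descent\<close>

text \<open>The components of the set of collision-free configurations, which are convex.\<close>
definition same_chamber :: "nat \<Rightarrow> (nat \<Rightarrow> real) \<Rightarrow> (nat \<Rightarrow> real) \<Rightarrow> bool" where
  "same_chamber n Y Z \<longleftrightarrow> (\<forall>i<n. \<forall>j<n. i \<noteq> j \<longrightarrow>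
    (\<exists>k :: int. Y i - Y j \<in> {of_int k * L<..<of_int (k + 1) * L} \<and> Z i - Z j \<in> {of_int k * L<..<of_int (k + 1) * L}))"

lemma open_period_noncollision: "t \<in> {of_int k * L<..<of_int (k + 1) * L} \<Longrightarrow> t rmod L \<noteq> 0"
proof -
  assume t: "t \<in> {of_int k * L<..<of_int (k + 1) * L}"
  have "t rmod L = t - of_int k * L"
    by (rule rmod_eq_iff[where k = k]) (use t L in \<open>auto simp: algebra_simps\<close>)
  then show ?thesis using t by auto
qed

lemma same_chamber_convex:
  assumes "same_chamber n Y Z" "0 \<le> \<theta>" "\<theta> \<le> 1"
  shows "noncolliding n (\<lambda>i. Z i + \<theta> * (Y i - Z i))"
  unfolding noncolliding_def
proof (intro allI impI)
  fix i j assume ij: "i < n" "j < n" "i \<noteq> j"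
  then obtain k :: int where k: "Y i - Y j \<in> {of_int k * L<..<of_int (k + 1) * L}" "Z i - Z j \<in> {of_int k * L<..<of_int (k + 1) * L}"
    using assms(1) unfolding same_chamber_def by blast
  have "(1 - \<theta>) *\<^sub>R (Z i - Z j) + \<theta> *\<^sub>R (Y i - Y j) \<in> {of_int k * L<..<of_int (k + 1) * L}"
    using k assms by (intro convexD_alt convex_real_interval) auto
  then have "Z i + \<theta> * (Y i - Z i) - (Z j + \<theta> * (Y j - Z j)) \<in> {of_int k * L<..<of_int (k + 1) * L}"
    by (simp add: algebra_simps)
  then show "(Z i + \<theta> * (Y i - Z i) - (Z j + \<theta> * (Y j - Z j))) rmod L \<noteq> 0"
    by (rule open_period_noncollision)
qed

text \<open>Mean value theorem along the segment from \<open>Z\<close> to \<open>Y\<close>, which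
  stays collision-free by convexity of the chamber: the force paired with \<open>h = Y - Z\<close>
  has the Hessian form as its derivative.\<close>

lemma force_strongly_monotone:
  assumes ch: "same_chamber n Y Z" and sum: "(\<Sum>i<n. Y i - Z i) = 0"
    and hess: "\<And>X h. noncolliding n X \<Longrightarrow> (\<Sum>i<n. h i) = 0 \<Longrightarrow> hess_form n X h \<ge> \<kappa> * (\<Sum>i<n. (h i)\<^sup>2)"
  shows "(\<Sum>i<n. (force n Y i - force n Z i) * (Y i - Z i)) \<ge> \<kappa> * (\<Sum>i<n. (Y i - Z i)\<^sup>2)"
proof -
  define h where "h = (\<lambda>i. Y i - Z i)"
  define P where "P = (\<lambda>\<theta> i. Z i + \<theta> * h i)"
  have nc: "noncolliding n (P \<theta>)" if "0 \<le> \<theta>" "\<theta> \<le> 1" for \<theta>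
    using same_chamber_convex[OF ch that] by (simp add: P_def h_def)
  define \<psi> where "\<psi> = (\<lambda>\<theta>. \<Sum>i<n. force n (P \<theta>) i * h i)"
  have D: "(\<psi> has_real_derivative hess_form n (P \<theta>) h) (at \<theta>)" if \<theta>: "0 \<le> \<theta>" "\<theta> \<le> 1" for \<theta>
  proof -
    have "((\<lambda>\<theta>. force n (P \<theta>) i) has_real_derivative (\<Sum>j\<in>{..<n} - {i}. f (P \<theta> i - P \<theta> j) * (h i - h j))) (at \<theta>)"
      if i: "i < n" for i
      unfolding force_def
    proof (rule DERIV_sum)
      fix j assume "j \<in> {..<n} - {i}"
      then have "(P \<theta> i - P \<theta> j) rmod L \<noteq> 0" using nc[OF \<theta>] i by (auto simp: noncolliding_def)
      then have gd: "(g has_real_derivative f (P \<theta> i - P \<theta> j)) (at (P \<theta> i - P \<theta> j))" by (rule g_deriv)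
      have "((\<lambda>\<theta>. P \<theta> i - P \<theta> j) has_real_derivative h i - h j) (at \<theta>)"
        unfolding P_def by (auto intro!: derivative_eq_intros)
      then show "((\<lambda>\<theta>. g (P \<theta> i - P \<theta> j)) has_real_derivative f (P \<theta> i - P \<theta> j) * (h i - h j)) (at \<theta>)"
        using DERIV_chain[of g _ "\<lambda>\<theta>. P \<theta> i - P \<theta> j" \<theta>, OF gd] by (simp add: o_def)
    qed
    then have "(\<psi> has_real_derivative (\<Sum>i<n. (\<Sum>j\<in>{..<n} - {i}. f (P \<theta> i - P \<theta> j) * (h i - h j)) * h i)) (at \<theta>)"
      unfolding \<psi>_def by (intro DERIV_sum DERIV_cmult_right) auto
    then show ?thesis by (simp add: hess_form_def sum_distrib_right)
  qed
  obtain \<xi> where \<xi>: "0 < \<xi>" "\<xi> < 1" "\<psi> 1 - \<psi> 0 = (1 - 0) * hess_form n (P \<xi>) h"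
    using MVT2[of 0 1 \<psi> "\<lambda>\<theta>. hess_form n (P \<theta>) h"] D by auto
  have "hess_form n (P \<xi>) h \<ge> \<kappa> * (\<Sum>i<n. (h i)\<^sup>2)"
    using \<xi> sum by (intro hess nc) (auto simp: h_def)
  moreover have "\<psi> 1 - \<psi> 0 = (\<Sum>i<n. (force n Y i - force n Z i) * (Y i - Z i))"
    by (simp add: \<psi>_def P_def h_def sum_subtractf[symmetric] algebra_simps)
  ultimately show ?thesis using \<xi>(3) by (simp add: h_def)
qed

text \<open>The reflection of the lattice about the site of particle \<open>i\<close> permutes the
  other sites and reverses the sign of \<open>g\<close>, so the force equals its own
  negative.\<close>

lemma lattice_force_eq_0:
  assumes n: "L = real n" and r: "bij_betw r {..<n} {..<n}" and i: "i < n"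
  shows "force n (\<lambda>i. \<tau> + real (r i)) i = 0"
proof -
  define a where "a = r i"
  have a: "a < n" using r i by (auto simp: a_def bij_betw_def)
  have inj: "inj_on r {..<n}" using r by (auto simp: bij_betw_def)
  have bij: "bij_betw r ({..<n} - {i}) ({..<n} - {a})"
    using r i unfolding a_def by (intro bij_betw_DiffI) (auto simp: bij_betw_def)
  define S where "S = (\<Sum>m\<in>{..<n} - {a}. g (real a - real m))"
  have F: "force n (\<lambda>i. \<tau> + real (r i)) i = S"
    unfolding force_def S_def a_def[symmetric] using sum.reindex_bij_betw[OF bij, of "\<lambda>m. g (real a - real m)"]
    by (simp add: a_def)
  have n0: "n > 0" using a by simp
  \<comment> \<open>Reflection about \<open>a\<close> modulo \<open>n\<close>. It may fix an
    antipodal site as well, which is harmless as \<open>g\<close> then vanishes there by oddness and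
    periodicity.\<close>
  define \<rho> where "\<rho> = (\<lambda>m. nat ((2 * int a - int m) mod int n))"
  have \<rho>_int: "int (\<rho> m) = (2 * int a - int m) mod int n" for m using n0 by (simp add: \<rho>_def)
  have \<rho>_less: "\<rho> m < n" for m using n0 by (simp add: \<rho>_def nat_less_iff)
  have \<rho>\<rho>: "\<rho> (\<rho> m) = m" if "m < n" for m
  proof -
    have "int (\<rho> (\<rho> m)) = (2 * int a - (2 * int a - int m)) mod int n"
      by (simp only: \<rho>_int mod_diff_right_eq)
    then show ?thesis using that by simp
  qed
  have \<rho>a: "\<rho> a = a" using a by (simp add: \<rho>_def)
  have g\<rho>: "g (real a - real (\<rho> m)) = - g (real a - real m)" if m: "m \<in> {..<n} - {a}" for m
  proof -
    define q where "q = (2 * int a - int m) div int n"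
    have "int (\<rho> m) = 2 * int a - int m - int n * q"
      unfolding \<rho>_int q_def by (rule minus_mult_div_eq_mod[symmetric])
    then have "real_of_int (int (\<rho> m)) = real_of_int (2 * int a - int m - int n * q)" by (simp only:)
    then have "real a - real (\<rho> m) = - (real a - real m) + of_int q * L" by (simp add: n mult.commute)
    then have "g (real a - real (\<rho> m)) = g (- (real a - real m))"
      using periodic_of_int[of g L, OF g_periodic] by (simp only:)
    moreover have "(real a - real m) rmod L \<noteq> 0"
    proof
      assume "(real a - real m) rmod L = 0"
      then have "real a - real m = of_int \<lfloor>(real a - real m) / L\<rfloor> * L" using L by (simp add: rmod_def mult.commute)
      then obtain k :: int where k: "real a - real m = of_int k * L" by blast
      have "\<bar>real a - real m\<bar> < L" using a m by (auto simp: n)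
      then have "\<bar>of_int k\<bar> * L < 1 * L" using k L by (simp add: abs_mult)
      then have "k = 0" using L by (simp del: of_int_abs add: of_int_abs[symmetric])
      then show False using k m by auto
    qed
    ultimately show ?thesis using g_odd[of "real a - real m"] by simp
  qed
  have "S = (\<Sum>m\<in>{..<n} - {a}. g (real a - real (\<rho> m)))"
    unfolding S_def
    by (rule sum.reindex_bij_witness[of _ \<rho> \<rho>]) (auto simp: \<rho>\<rho> \<rho>_less, (metis \<rho>\<rho> \<rho>a)+)
  also have "\<dots> = - S" unfolding S_def sum_negf[symmetric] by (intro sum.cong refl g\<rho>)
  finally show ?thesis using F by simp
qed

text \<open>To leave its interval, a difference of two positions would have to take a multiple of
  \<open>L\<close> as a value, by the intermediate value theorem; that is a collision.\<close>

lemma noncolliding_path_same_chamber: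
  fixes X :: "real \<Rightarrow> nat \<Rightarrow> real"
  assumes cont: "\<And>i. i < n \<Longrightarrow> continuous_on {0..} (\<lambda>t. X t i)"
    and nc: "\<And>t. t \<ge> 0 \<Longrightarrow> noncolliding n (X t)" and t: "t \<ge> 0"
    and ch: "same_chamber n (X 0) c"
  shows "same_chamber n (X t) c"
  unfolding same_chamber_def
proof (intro allI impI)
  fix i j assume ij: "i < n" "j < n" "i \<noteq> j"
  then obtain k :: int where k: "X 0 i - X 0 j \<in> {of_int k * L<..<of_int (k + 1) * L}"
    "c i - c j \<in> {of_int k * L<..<of_int (k + 1) * L}"
    using ch unfolding same_chamber_def by blast
  have c: "continuous_on {0..t} (\<lambda>r. X r i - X r j)"
    using ij by (intro continuous_intros continuous_on_subset[OF cont]) auto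
  have avoid: "X r i - X r j \<noteq> of_int m * L" if "r \<ge> 0" for r and m :: int
  proof
    assume "X r i - X r j = of_int m * L"
    then have "(X r i - X r j) rmod L = 0" by simp
    then show False using nc[OF that] ij by (auto simp: noncolliding_def)
  qed
  have "X t i - X t j > of_int k * L"
  proof (rule ccontr)
    assume "\<not> X t i - X t j > of_int k * L"
    then obtain r where "0 \<le> r" "X r i - X r j = of_int k * L"
      using IVT2'[of "\<lambda>r. X r i - X r j" t "of_int k * L" 0] c k t by auto
    then show False using avoid by blast
  qed
  moreover have "X t i - X t j < of_int (k + 1) * L"
  proof (rule ccontr)
    assume "\<not> X t i - X t j < of_int (k + 1) * L"
    then obtain r where "0 \<le> r" "X r i - X r j = of_int (k + 1) * L"
      using IVT'[of "\<lambda>r. X r i - X r j" 0 "of_int (k + 1) * L" t] c k t by auto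
    then show False using avoid by blast
  qed
  ultimately show "\<exists>k :: int. X t i - X t j \<in> {of_int k * L<..<of_int (k + 1) * L} \<and>
      c i - c j \<in> {of_int k * L<..<of_int (k + 1) * L}"
    using k by auto
qed

text \<open>The squared distance \<open>N\<close> has derivative \<open>- 2 * M\<close>, and strong
  monotonicity against the critical point \<open>c\<close> gives
  \<open>M \<ge> \<kappa> * N\<close>. It applies at all times because the chamber and the sum are
  preserved.\<close>

lemma gradient_descent_decay:
  fixes X :: "real \<Rightarrow> nat \<Rightarrow> real"
  assumes D: "\<And>t i. t \<ge> 0 \<Longrightarrow> i < n \<Longrightarrow> ((\<lambda>r. X r i) has_real_derivative - force n (X t) i) (at t within {0..})"
    and nc: "\<And>t. t \<ge> 0 \<Longrightarrow> noncolliding n (X t)"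
    and ch: "same_chamber n (X 0) c" and sum: "(\<Sum>i<n. X 0 i) = (\<Sum>i<n. c i)"
    and crit: "\<And>i. i < n \<Longrightarrow> force n c i = 0"
    and hess: "\<And>Y h. noncolliding n Y \<Longrightarrow> (\<Sum>i<n. h i) = 0 \<Longrightarrow> hess_form n Y h \<ge> \<kappa> * (\<Sum>i<n. (h i)\<^sup>2)"
    and t: "t \<ge> 0"
  shows "same_chamber n (X t) c"
    and "(\<Sum>i<n. (X t i - c i)\<^sup>2) \<le> (\<Sum>i<n. (X 0 i - c i)\<^sup>2) * exp (- 2 * \<kappa> * t)"
proof -
  have cont: "continuous_on {0..} (\<lambda>t. X t i)" if "i < n" for i
    unfolding continuous_on_eq_continuous_within
    using D[OF _ that] by (auto intro: DERIV_continuous)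
  have chamber: "same_chamber n (X r) c" if "r \<ge> 0" for r
    using noncolliding_path_same_chamber[OF cont nc that ch] .
  then show "same_chamber n (X t) c" using t by blast
  \<comment> \<open>At time 0 the derivative is one-sided; two-sided derivatives are used for
    positive times, and continuity covers the endpoint.\<close>
  have D': "((\<lambda>r. X r i) has_real_derivative - force n (X r) i) (at r)" if "r > 0" "i < n" for r i
  proof -
    have "at r within {0..} = at r"
      using that by (intro at_within_interior) (simp add: interior_real_atLeast)
    then show ?thesis using D[OF less_imp_le[OF that(1)] that(2)] by (simp only:)
  qed
  have sum': "(\<Sum>i<n. X r i) = (\<Sum>i<n. c i)" if "r \<ge> 0" for r
  proof (cases "r = 0")
    case False
    then have r: "0 < r" using that by simp
    have "(\<lambda>q. \<Sum>i<n. X q i) r = (\<lambda>q. \<Sum>i<n. X q i) 0"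
    proof (rule DERIV_isconst2[OF r])
      show "continuous_on {0..r} (\<lambda>q. \<Sum>i<n. X q i)"
        by (intro continuous_on_sum continuous_on_subset[OF cont]) auto
      fix q assume q: "0 < q" "q < r"
      have "((\<lambda>q. \<Sum>i<n. X q i) has_real_derivative (\<Sum>i<n. - force n (X q) i)) (at q)"
        using q by (intro DERIV_sum D') auto
      then show "((\<lambda>q. \<Sum>i<n. X q i) has_real_derivative 0) (at q)"
        using sum_force_eq_0[OF nc[of q]] q by (simp add: sum_negf)
    qed (use r in auto)
    then show ?thesis using sum by simp
  qed (use sum in simp)
  define N where "N = (\<lambda>r. \<Sum>i<n. (X r i - c i)\<^sup>2)"
  define F where "F = (\<lambda>r. N r * exp (2 * \<kappa> * r))"
  have "F t \<le> F 0"
  proof (rule DERIV_nonpos_imp_decreasing_open[OF t])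
    show "continuous_on {0..t} F"
      unfolding F_def N_def
      by (intro continuous_intros continuous_on_subset[OF cont]) auto
    fix r assume r: "0 < r" "r < t"
    define M where "M = (\<Sum>i<n. force n (X r) i * (X r i - c i))"
    have "(N has_real_derivative (\<Sum>i<n. 2 * (X r i - c i) * (- force n (X r) i))) (at r)"
      unfolding N_def
    proof (rule DERIV_sum)
      fix i assume "i \<in> {..<n}"
      then show "((\<lambda>r. (X r i - c i)\<^sup>2) has_real_derivative 2 * (X r i - c i) * - force n (X r) i) (at r)"
        using D'[OF r(1), of i] by (auto intro!: derivative_eq_intros)
    qed
    also have "(\<Sum>i<n. 2 * (X r i - c i) * (- force n (X r) i)) = - 2 * M"
      unfolding M_def sum_distrib_left by (intro sum.cong refl) (simp add: algebra_simps)
    finally have ND: "(N has_real_derivative - 2 * M) (at r)" .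
    have "(F has_real_derivative (2 * \<kappa> * N r - 2 * M) * exp (2 * \<kappa> * r)) (at r)"
      unfolding F_def using ND by (auto intro!: derivative_eq_intros simp: algebra_simps)
    moreover have "M \<ge> \<kappa> * N r"
    proof -
      have "(\<Sum>i<n. X r i - c i) = 0" using sum'[of r] r by (simp add: sum_subtractf)
      from force_strongly_monotone[OF chamber this hess] show ?thesis
        using r crit by (simp add: M_def N_def)
    qed
    then have "(2 * \<kappa> * N r - 2 * M) * exp (2 * \<kappa> * r) \<le> 0"
      by (intro mult_nonpos_nonneg) auto
    ultimately show "\<exists>y. (F has_real_derivative y) (at r) \<and> y \<le> 0" by blast
  qed
  then have "N t * exp (2 * \<kappa> * t) * exp (- 2 * \<kappa> * t) \<le> N 0 * exp (- 2 * \<kappa> * t)"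
    unfolding F_def by (intro mult_right_mono) auto
  then show "(\<Sum>i<n. (X t i - c i)\<^sup>2) \<le> (\<Sum>i<n. (X 0 i - c i)\<^sup>2) * exp (- 2 * \<kappa> * t)"
    by (simp add: N_def mult.assoc exp_add[symmetric])
qed

end

subsection \<open>Distances on the circle\<close>

lemma per_abs_le: "per_abs \<Lambda> t \<le> \<bar>t + real \<Lambda> * of_int z\<bar>"
  unfolding per_abs_def by (rule cINF_lower[OF bdd_belowI[of _ 0]]) auto

lemma per_abs_nonneg: "per_abs \<Lambda> t \<ge> 0"
  unfolding per_abs_def by (rule cINF_greatest) auto

lemma per_abs_attained:
  assumes "\<Lambda> \<ge> 1"
  obtains z :: int where "per_abs \<Lambda> t = \<bar>t + real \<Lambda> * of_int z\<bar>"
proof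
  define L where "L = real \<Lambda>"
  have L: "L > 0" using assms by (simp add: L_def)
  define z0 where "z0 = - round (t / L)"
  have "\<bar>t + L * of_int z0\<bar> \<le> \<bar>t + L * of_int z\<bar>" for z
  proof -
    have "\<bar>t / L - of_int (round (t / L))\<bar> \<le> \<bar>t / L - of_int (- z)\<bar>" by (rule round_diff_minimal)
    then have "L * \<bar>t / L - of_int (round (t / L))\<bar> \<le> L * \<bar>t / L - of_int (- z)\<bar>" using L by (intro mult_left_mono) auto
    moreover have "L * \<bar>t / L - of_int k\<bar> = \<bar>t + L * of_int (- k)\<bar>" for k
      using L abs_mult[of L "t / L - of_int k"] by (simp add: algebra_simps)
    ultimately show ?thesis by (simp only: z0_def minus_minus)
  qed
  then have "\<bar>t + L * of_int z0\<bar> \<le> per_abs \<Lambda> t"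
    unfolding per_abs_def L_def by (intro cINF_greatest) auto
  then show "per_abs \<Lambda> t = \<bar>t + real \<Lambda> * of_int z0\<bar>"
    using per_abs_le[of \<Lambda> t z0] by (simp add: L_def)
qed

lemma sum_sgn_diff:
  assumes "i < n"
  shows "(\<Sum>j<n. sgn (real i - real j)) = 2 * real i - (real n - 1)"
proof -
  have "{..<n} = insert i ({..<i} \<union> {Suc i..<n})" using assms by auto
  then have "(\<Sum>j<n. sgn (real i - real j)) = (\<Sum>j\<in>insert i ({..<i} \<union> {Suc i..<n}). sgn (real i - real j))"
    by (simp only:)
  also have "\<dots> = (\<Sum>j<i. sgn (real i - real j)) + (\<Sum>j = Suc i..<n. sgn (real i - real j))"
    by (subst sum.insert, simp, simp, subst sum.union_disjoint) auto
  also have "(\<Sum>j<i. sgn (real i - real j)) = (\<Sum>j<i. 1)" by (intro sum.cong) auto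
  also have "(\<Sum>j = Suc i..<n. sgn (real i - real j)) = (\<Sum>j = Suc i..<n. - 1)" by (intro sum.cong) auto
  finally show ?thesis using assms by (simp add: of_nat_diff)
qed

text \<open>The polarised variance identity; if one factor has zero sum, only the scalar product
  survives.\<close>

lemma sum_diff_products:
  fixes a b :: "nat \<Rightarrow> real"
  shows "(\<Sum>i<n. \<Sum>j<n. (a i - a j) * (b i - b j)) = 2 * real n * (\<Sum>i<n. a i * b i) - 2 * (\<Sum>i<n. a i) * (\<Sum>i<n. b i)"
proof -
  have "(\<Sum>i<n. \<Sum>j<n. (a i - a j) * (b i - b j)) =
      (\<Sum>i<n. \<Sum>j<n. a i * b i + a j * b j - a i * b j - b i * a j)"
    by (intro sum.cong refl) (simp add: algebra_simps)
  also have "\<dots> = real n * (\<Sum>i<n. a i * b i) + real n * (\<Sum>i<n. a i * b i) -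
      (\<Sum>i<n. a i) * (\<Sum>i<n. b i) - (\<Sum>i<n. b i) * (\<Sum>i<n. a i)"
  proof -
    have "(\<Sum>i<n. \<Sum>j<n. a i * b i) = real n * (\<Sum>i<n. a i * b i)"
      "(\<Sum>i<n. \<Sum>j<n. a j * b j) = real n * (\<Sum>i<n. a i * b i)"
      by (simp_all add: sum_distrib_left)
    then show ?thesis by (simp only: sum.distrib sum_subtractf sum_product)
  qed
  finally show ?thesis by simp
qed

lemma real_sum_lessThan: "(\<Sum>i<n. real i) = real n * (real n - 1) / 2"
  by (induction n) (auto simp: field_simps)

text \<open>
  The monotone matching with the right barycenter minimises the transport cost on the circle.
  Since \<open>\<Sum> (i - j) (z\<^sub>i - z\<^sub>j) = n / 2 \<Sum> sgn (i - j) (z\<^sub>i - z\<^sub>j)\<close>, the mixed term is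
  a combination of the numbers \<open>y\<^sub>i - y\<^sub>j - n / 2 sgn (i - j)\<close>, which are at most \<open>n / 2\<close> in modulus.
\<close>
lemma monotone_matching_optimal:
  fixes y :: "nat \<Rightarrow> real" and z :: "nat \<Rightarrow> int" and k :: int
  assumes y: "\<And>i j. i < j \<Longrightarrow> j < n \<Longrightarrow> y i \<le> y j \<and> y j \<le> y i + real n"
    and a: "\<And>i. a i = y i - real i - \<tau>" and zero: "(\<Sum>i<n. a i) = 0"
  shows "(\<Sum>i<n. (a i)\<^sup>2) \<le> (\<Sum>i<n. (a i - of_int k - real n * of_int (z i))\<^sup>2)"
proof -
  define x where "x = (\<lambda>i. real_of_int (z i))"
  define N where "N = real n"
  define S where "S = (\<Sum>i<n. x i)"
  define Q where "Q = (\<Sum>i<n. (x i)\<^sup>2)"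
  define P where "P = (\<Sum>i<n. x i * a i)"
  have idx: "(\<Sum>i<n. \<Sum>j<n. (x i - x j) * (real i - real j)) =
      N / 2 * (\<Sum>i<n. \<Sum>j<n. (x i - x j) * sgn (real i - real j))"
  proof -
    have "(\<Sum>i<n. \<Sum>j<n. (x i - x j) * sgn (real i - real j)) =
        (\<Sum>i<n. \<Sum>j<n. x i * sgn (real i - real j)) + (\<Sum>i<n. \<Sum>j<n. x j * sgn (real j - real i))"
      unfolding sum.distrib[symmetric]
      by (intro sum.cong refl) (simp add: left_diff_distrib sgn_minus[symmetric] flip: mult_minus_right)
    also have "(\<Sum>i<n. \<Sum>j<n. x j * sgn (real j - real i)) = (\<Sum>i<n. \<Sum>j<n. x i * sgn (real i - real j))"
      by (rule sum.swap)
    also have "(\<Sum>i<n. \<Sum>j<n. x i * sgn (real i - real j)) = (\<Sum>i<n. x i * (2 * real i - (N - 1)))"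
      unfolding sum_distrib_left[symmetric] by (intro sum.cong refl) (simp add: sum_sgn_diff N_def)
    also have "\<dots> = 2 * (\<Sum>i<n. x i * real i) - S * (N - 1)"
      unfolding S_def sum_distrib_right sum_distrib_left sum_subtractf[symmetric]
      by (intro sum.cong refl) (simp add: algebra_simps)
    finally have T: "(\<Sum>i<n. \<Sum>j<n. (x i - x j) * sgn (real i - real j)) =
        2 * (\<Sum>i<n. x i * real i) - S * (N - 1) + (2 * (\<Sum>i<n. x i * real i) - S * (N - 1))" .
    show ?thesis
      unfolding T sum_diff_products real_sum_lessThan S_def N_def by (simp add: field_simps)
  qed
  have "2 * N * P = (\<Sum>i<n. \<Sum>j<n. (x i - x j) * (a i - a j))"
    unfolding sum_diff_products zero by (simp add: P_def N_def)
  also have "\<dots> = (\<Sum>i<n. \<Sum>j<n. (x i - x j) * (y i - y j)) - (\<Sum>i<n. \<Sum>j<n. (x i - x j) * (real i - real j))"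
    unfolding sum_subtractf[symmetric] by (intro sum.cong refl) (simp add: a algebra_simps)
  also have "\<dots> = (\<Sum>i<n. \<Sum>j<n. (x i - x j) * (y i - y j - N / 2 * sgn (real i - real j)))"
  proof -
    have "d * e - c * (d * w) = d * (e - c * w)" for c d e w :: real by (simp add: algebra_simps)
    then show ?thesis
      unfolding idx sum_distrib_left sum_subtractf[symmetric] by (intro sum.cong refl) (simp only:)
  qed
  also have "\<dots> \<le> (\<Sum>i<n. \<Sum>j<n. N / 2 * ((x i - x j) * (x i - x j)))"
  proof (intro sum_mono)
    fix i j assume ij: "i \<in> {..<n}" "j \<in> {..<n}"
    have b: "\<bar>y i - y j - N / 2 * sgn (real i - real j)\<bar> \<le> N / 2"
      unfolding abs_le_iff using y[of i j] y[of j i] ij by (cases i j rule: linorder_cases) (auto simp: N_def)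
    \<comment> \<open>Here integrality matters: an integer is at most its square in modulus, so the
      linear mixed term is dominated by the quadratic one.\<close>
    have "\<bar>z i - z j\<bar> * 1 \<le> \<bar>z i - z j\<bar> * \<bar>z i - z j\<bar>"
    proof (cases "z i = z j")
      case False
      then have "1 \<le> \<bar>z i - z j\<bar>" by simp
      then show ?thesis by (rule mult_left_mono) (rule abs_ge_zero)
    qed simp
    then have "\<bar>z i - z j\<bar> \<le> (z i - z j) * (z i - z j)" by (simp only: mult_1_right abs_mult_self_eq)
    then have "real_of_int \<bar>z i - z j\<bar> \<le> real_of_int ((z i - z j) * (z i - z j))" by (simp only: of_int_le_iff)
    then have c: "\<bar>x i - x j\<bar> \<le> (x i - x j) * (x i - x j)" by (simp add: x_def)
    have "(x i - x j) * (y i - y j - N / 2 * sgn (real i - real j)) \<le>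
        \<bar>x i - x j\<bar> * \<bar>y i - y j - N / 2 * sgn (real i - real j)\<bar>"
      by (metis abs_ge_self abs_mult)
    also have "\<dots> \<le> ((x i - x j) * (x i - x j)) * (N / 2)" using b c by (intro mult_mono) auto
    finally show "(x i - x j) * (y i - y j - N / 2 * sgn (real i - real j)) \<le> N / 2 * ((x i - x j) * (x i - x j))"
      by (simp add: mult.commute)
  qed
  also have "\<dots> = N / 2 * (2 * N * Q - 2 * S * S)"
    unfolding sum_distrib_left[symmetric] sum_diff_products by (simp add: Q_def S_def N_def power2_eq_square)
  finally have main: "2 * N * P \<le> N * (N * Q - S * S)" by (simp add: algebra_simps)
  have "(\<Sum>i<n. (a i - of_int k - real n * of_int (z i))\<^sup>2) =
      (\<Sum>i<n. (a i)\<^sup>2 - 2 * of_int k * a i - 2 * N * (x i * a i) + (of_int k)\<^sup>2 + 2 * of_int k * N * x i + N\<^sup>2 * (x i)\<^sup>2)"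
    by (intro sum.cong refl) (simp add: N_def x_def power2_eq_square algebra_simps)
  also have "\<dots> = (\<Sum>i<n. (a i)\<^sup>2) - 2 * of_int k * (\<Sum>i<n. a i) - 2 * N * P + N * (of_int k)\<^sup>2 + 2 * of_int k * N * S + N\<^sup>2 * Q"
    by (simp add: sum.distrib sum_subtractf sum_distrib_left P_def S_def Q_def N_def)
  \<comment> \<open>Completing the square in \<open>k + S\<close> accounts for the common shift; the
    remaining bracket is nonnegative by \<open>main\<close>.\<close>
  also have "\<dots> = (\<Sum>i<n. (a i)\<^sup>2) + (N * (N * Q - S * S) - 2 * N * P) + N * (of_int k + S)\<^sup>2"
    unfolding zero by (simp add: power2_eq_square algebra_simps)
  finally have "(\<Sum>i<n. (a i - of_int k - real n * of_int (z i))\<^sup>2) =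
      (\<Sum>i<n. (a i)\<^sup>2) + (N * (N * Q - S * S) - 2 * N * P) + N * (of_int k + S)\<^sup>2" .
  moreover have "N * (of_int k + S)\<^sup>2 \<ge> 0" by (simp add: N_def)
  ultimately show ?thesis using main by linarith
qed

subsection \<open>Ordered configurations, crystals and barycenters\<close>

lemma ord_config_eqI:
  assumes "inj_on X {..<n}" "X ` {..<n} = set ys" "sorted ys" "distinct ys" "i < n"
  shows "ord_config n X i = ys ! i"
proof -
  have "distinct (map X [0..<n])" using assms(1) by (simp add: distinct_map atLeast0LessThan)
  then have "sort (map X [0..<n]) = ys"
    using assms by (intro sorted_distinct_set_unique) (auto simp: atLeast0LessThan)
  then show ?thesis by (simp add: ord_config_def)
qed

lemma ord_config_strict_mono:
  assumes "inj_on X {..<n}" "i < j" "j < n"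
  shows "ord_config n X i < ord_config n X j"
proof -
  have "distinct (map X [0..<n])" using assms(1) by (simp add: distinct_map atLeast0LessThan)
  then have "sorted_wrt (<) (sort (map X [0..<n]))" by (simp add: strict_sorted_iff)
  from sorted_wrt_nth_less[OF this assms(2)] show ?thesis unfolding ord_config_def using assms by simp
qed

lemma rank_exists:
  assumes X: "inj_on X {..<n}"
  obtains r where "bij_betw r {..<n} {..<n}" "\<And>i. i < n \<Longrightarrow> X i = ord_config n X (r i)"
proof -
  have "distinct (map X [0..<n])" using X by (simp add: distinct_map atLeast0LessThan)
  then have b: "bij_betw (ord_config n X) {..<n} (X ` {..<n})"
    unfolding ord_config_def[abs_def] by (intro bij_betw_nth) (auto simp: atLeast0LessThan)
  have bX: "bij_betw X {..<n} (X ` {..<n})" using X by (simp add: bij_betw_def)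
  define r where "r = inv_into {..<n} (ord_config n X) \<circ> X"
  show thesis
  proof
    show "bij_betw r {..<n} {..<n}" unfolding r_def by (rule bij_betw_trans[OF bX bij_betw_inv_into[OF b]])
    show "X i = ord_config n X (r i)" if "i < n" for i
      unfolding r_def o_def using that by (intro bij_betw_inv_into_right[OF b, symmetric]) auto
  qed
qed

lemma crystal_ord_config:
  assumes "inj_on X {..<n}" "X ` {..<n} = (\<lambda>j. real j + \<tau>) ` {..<n}" "i < n"
  shows "ord_config n X i = real i + \<tau>"
  using ord_config_eqI[OF assms(1), of "map (\<lambda>j. real j + \<tau>) [0..<n]" i] assms
  by (auto simp: atLeast0LessThan sorted_map distinct_map inj_on_def sorted_wrt_upt intro!: sorted_wrt_mono_rel[OF _ sorted_wrt_upt])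

lemma crystal_sum:
  assumes "inj_on X {..<n}" "X ` {..<n} = (\<lambda>j. real j + \<tau>) ` {..<n}"
  shows "(\<Sum>i<n. X i) = real n * \<tau> + real n * (real n - 1) / 2"
proof -
  have "(\<Sum>i<n. X i) = \<Sum>(X ` {..<n})" by (rule sum.reindex_cong[OF assms(1), symmetric]) auto
  also have "\<dots> = (\<Sum>j<n. real j + \<tau>)" unfolding assms(2)
    by (subst sum.reindex) (auto simp: inj_on_def)
  finally show ?thesis by (simp add: sum.distrib real_sum_lessThan)
qed

text \<open>Multiplication by \<open>sqrt \<Lambda>\<close> turns congruence modulo
  \<open>sqrt \<Lambda>\<close> into congruence of the sums modulo \<Lambda>.\<close>

lemma bar_eq_iff:
  assumes "\<Lambda> \<ge> 1"
  shows "bar \<Lambda> X = bar \<Lambda> Y \<longleftrightarrow> (\<exists>k :: int. (\<Sum>i<\<Lambda>. Y i) = (\<Sum>i<\<Lambda>. X i) + of_int k * real \<Lambda>)"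
proof -
  define q where "q = sqrt (real \<Lambda>)"
  have q: "q > 0" "q * q = real \<Lambda>" using assms by (auto simp: q_def)
  have "(\<Sum>i<\<Lambda>. X i * (1 / q)) = (\<Sum>i<\<Lambda>. X i) / q" for X
    by (simp add: sum_divide_distrib)
  then have "bar \<Lambda> X = bar \<Lambda> Y \<longleftrightarrow> (\<exists>k :: int. (\<Sum>i<\<Lambda>. Y i) / q = (\<Sum>i<\<Lambda>. X i) / q + of_int k * q)"
    using rcong_altdef[of "(\<Sum>i<\<Lambda>. X i) / q" "(\<Sum>i<\<Lambda>. Y i) / q" q]
    by (simp add: bar_def rcong_def q_def)
  moreover have "a / q = b / q + of_int k * q \<longleftrightarrow> a = b + of_int k * real \<Lambda>" for a b and k :: int
    unfolding q(2)[symmetric] using q(1) by (simp add: field_simps)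
  ultimately show ?thesis by simp
qed

text \<open>Every competitor in \<open>config_dist\<close> differs from the lifted matching by a
  common integer \<open>k - m\<close> and by individual multiples of \<open>n\<close>. The
  prescribed sum makes the mean displacement zero, so \<open>monotone_matching_optimal\<close>
  applies.\<close>

lemma config_dist_ge:
  assumes n: "n \<ge> 1" and X: "X \<in> reg_configs n"
    and C: "\<And>i. i < n \<Longrightarrow> ord_config n C i = real i + \<tau>"
    and sum: "(\<Sum>i<n. X i) = real n * (\<tau> + of_int m) + real n * (real n - 1) / 2"
    and r: "bij_betw r {..<n} {..<n}" "\<And>i. i < n \<Longrightarrow> X i = ord_config n X (r i)"
  shows "sqrt (\<Sum>i<n. (X i - (\<tau> + of_int m + real (r i)))\<^sup>2) \<le> config_dist n X C"
proof -
  define y where "y = ord_config n X"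
  define a where "a = (\<lambda>i. y i - real i - (\<tau> + of_int m))"
  have inj: "inj_on X {..<n}" using X by (simp add: reg_configs_def)
  have re: "(\<Sum>i<n. F (r i)) = (\<Sum>p<n. F p)" for F :: "nat \<Rightarrow> real"
    using r(1) by (rule sum.reindex_bij_betw)
  have "(\<Sum>i<n. X i) = (\<Sum>i<n. y (r i))" using r(2) by (simp add: y_def)
  then have "(\<Sum>p<n. y p) = real n * (\<tau> + of_int m) + real n * (real n - 1) / 2" using re sum by simp
  then have zero: "(\<Sum>p<n. a p) = 0"
    by (simp add: a_def sum_subtractf sum.distrib real_sum_lessThan algebra_simps)
  have y_range: "0 \<le> y p \<and> y p < real n" if "p < n" for p
  proof -
    have "p \<in> r ` {..<n}" using r(1) that by (simp add: bij_betw_def)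
    then obtain i where i: "i < n" "p = r i" by auto
    then have "X i \<in> {0..<real n}" using X by (auto simp: reg_configs_def configs_def Pi_iff)
    then show ?thesis using r(2)[of i] i by (simp add: y_def)
  qed
  have ymono: "y i \<le> y j \<and> y j \<le> y i + real n" if "i < j" "j < n" for i j
    using ord_config_strict_mono[OF inj that] y_range[of i] y_range[of j] that by (auto simp: y_def)
  have "(\<Sum>i<n. (X i - (\<tau> + of_int m + real (r i)))\<^sup>2) = (\<Sum>i<n. (a (r i))\<^sup>2)"
    using r(2) by (intro sum.cong refl) (simp add: a_def y_def algebra_simps)
  then have lhs: "(\<Sum>i<n. (X i - (\<tau> + of_int m + real (r i)))\<^sup>2) = (\<Sum>p<n. (a p)\<^sup>2)" using re by simp
  show ?thesis
    unfolding config_dist_def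
  proof (rule Min.boundedI)
    show "(\<lambda>k. sqrt (\<Sum>i<n. (per_abs n (ord_config n X i - ord_config n C ((i + k) mod n)))\<^sup>2)) ` {..<n} \<noteq> {}"
      using n by (auto simp: lessThan_empty_iff)
    fix b assume "b \<in> (\<lambda>k. sqrt (\<Sum>i<n. (per_abs n (ord_config n X i - ord_config n C ((i + k) mod n)))\<^sup>2)) ` {..<n}"
    then obtain k where b: "b = sqrt (\<Sum>i<n. (per_abs n (ord_config n X i - ord_config n C ((i + k) mod n)))\<^sup>2)" by blast
    \<comment> \<open>\<open>w\<close> collects two sources of full periods: the winding chosen by
      \<open>per_abs\<close> and the reduction of \<open>i + k\<close> modulo
      \<open>n\<close>.\<close>
    have "\<exists>w :: int. (per_abs n (ord_config n X i - ord_config n C ((i + k) mod n)))\<^sup>2 =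
        (a i - of_int (int k - m) - real n * of_int w)\<^sup>2" for i
    proof -
      obtain z :: int where z: "per_abs n (ord_config n X i - ord_config n C ((i + k) mod n)) =
          \<bar>ord_config n X i - ord_config n C ((i + k) mod n) + real n * of_int z\<bar>"
        using per_abs_attained[OF n] by blast
      have "real (i + k) = real (n * ((i + k) div n) + (i + k) mod n)" by simp
      then have "real ((i + k) mod n) = real i + real k - real n * real ((i + k) div n)"
        by (simp only: of_nat_add of_nat_mult)
      then have "ord_config n X i - ord_config n C ((i + k) mod n) + real n * of_int z =
          a i - of_int (int k - m) - real n * of_int (- z - int ((i + k) div n))"
        using n by (simp add: C a_def y_def algebra_simps)
      then show ?thesis unfolding z by (metis power2_abs)
    qed
    then obtain w :: "nat \<Rightarrow> int" where w: "\<And>i. (per_abs n (ord_config n X i - ord_config n C ((i + k) mod n)))\<^sup>2 =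
        (a i - of_int (int k - m) - real n * of_int (w i))\<^sup>2" by metis
    show "sqrt (\<Sum>i<n. (X i - (\<tau> + of_int m + real (r i)))\<^sup>2) \<le> b"
      unfolding b lhs w
      by (intro real_sqrt_le_mono monotone_matching_optimal[where y = y and \<tau> = "\<tau> + of_int m", OF ymono _ zero])
        (auto simp: a_def)
  qed simp
qed

text \<open>Wrapping changes which particle comes first. The sorted wrapped entries are
  \<open>n\<close> consecutive points of the periodic configuration, beginning with its first
  nonnegative one, and this determines the relabelling to use.\<close>

lemma config_dist_wrap_le:
  assumes n: "n \<ge> 1" and Y: "wrap n Y \<in> reg_configs n"
    and C: "\<And>i. i < n \<Longrightarrow> ord_config n C i = real i + \<tau>"
    and r: "bij_betw r {..<n} {..<n}"
    and ch: "\<And>i j. i < n \<Longrightarrow> j < n \<Longrightarrow> r i < r j \<Longrightarrow> Y i < Y j \<and> Y j < Y i + real n"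
  shows "config_dist n (wrap n Y) C \<le> sqrt (\<Sum>i<n. (Y i - (\<tau> + of_int m + real (r i)))\<^sup>2)"
proof -
  define v where "v = (\<lambda>p. Y (inv_into {..<n} r p))"
  have vr: "v (r i) = Y i" if "i < n" for i
    using r that by (simp add: v_def bij_betw_def inv_into_f_f)
  have inv: "\<exists>i<n. p = r i" if "p < n" for p using r that by (auto simp: bij_betw_def image_iff)
  have vmono: "v p < v q \<and> v q < v p + real n" if pq: "p < q" "q < n" for p q
  proof -
    obtain i j where "i < n" "p = r i" "j < n" "q = r j" using inv[of p] inv[of q] pq by auto
    then show ?thesis using ch[of i j] vr pq by simp
  qed
  \<comment> \<open>The increasing enumeration of all points of the periodic configuration, indexed
    by the integers.\<close>
  define u where "u = (\<lambda>N :: int. v (nat (N mod int n)) + real n * of_int (N div int n))"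
  have n0: "int n > 0" "real n > 0" using n by auto
  have u_add: "u (N + int n) = u N + real n" for N using n0 by (simp add: u_def algebra_simps)
  have u_mono: "u N < u M" if NM: "N < M" for N M
  proof -
    define a b where "a = nat (N mod int n)" and "b = nat (M mod int n)"
    have ab: "a < n" "b < n" "int a = N mod int n" "int b = M mod int n"
      using n0 by (auto simp: a_def b_def nat_less_iff)
    have le: "N div int n \<le> M div int n" using NM n0 by (intro zdiv_mono1) auto
    show ?thesis
    proof (cases "N div int n = M div int n")
      case True
      have "N = int n * (M div int n) + N mod int n" using True by (metis mult_div_mod_eq)
      moreover have "M = int n * (M div int n) + M mod int n" by simp
      ultimately have "N mod int n < M mod int n" using NM by linarith
      then have "a < b" using ab by linarith
      then show ?thesis using vmono[of a b] ab True by (simp add: u_def a_def b_def)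
    next
      case False
      then have "N div int n + 1 \<le> M div int n" using le by linarith
      then have "real_of_int (N div int n + 1) \<le> real_of_int (M div int n)" by (simp only: of_int_le_iff)
      then have "real n * real_of_int (N div int n + 1) \<le> real n * real_of_int (M div int n)"
        using n0 by (intro mult_left_mono) auto
      then have "real n * of_int (N div int n) + real n \<le> real n * of_int (M div int n)" by (simp add: algebra_simps)
      moreover have "v a < v b + real n"
        using vmono[of a b] vmono[of b a] ab n0 by (cases a b rule: linorder_cases) auto
      ultimately show ?thesis by (simp add: u_def a_def b_def)
    qed
  qed
  \<comment> \<open>The upward search for the first nonnegative point starts at
    \<open>- K * n\<close>, where \<open>u\<close> is already negative.\<close>
  obtain p where p: "u p \<ge> 0" "u (p - 1) < 0"
  proof -
    obtain K where K: "real K > \<bar>v 0\<bar>" using reals_Archimedean2 by blast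
    have "real K * 1 \<le> real K * real n" using n by (intro mult_left_mono) auto
    then have KN: "real K \<le> real n * real K" by (simp add: mult.commute)
    define N0 where "N0 = - int K * int n"
    have u0: "u (int n * q) = v 0 + real n * of_int q" for q using n0 by (simp add: u_def)
    have neg: "u N0 < 0" using u0[of "- int K"] K KN by (simp add: N0_def mult.commute)
    have "u (N0 + int (2 * K * n)) = v 0 + real n * of_int (int K)"
      using u0[of "int K"] by (simp add: N0_def algebra_simps)
    then have "\<exists>j. u (N0 + int j) \<ge> 0" using K KN by (intro exI[of _ "2 * K * n"]) simp
    define j where "j = (LEAST j. u (N0 + int j) \<ge> 0)"
    have j: "u (N0 + int j) \<ge> 0" unfolding j_def by (rule LeastI_ex) fact
    have "j \<noteq> 0" using neg j by (intro notI) simp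
    then have "\<not> u (N0 + int (j - 1)) \<ge> 0" unfolding j_def by (intro not_less_Least) (simp add: j_def[symmetric])
    moreover have "N0 + int (j - 1) = N0 + int j - 1" using \<open>j \<noteq> 0\<close> by simp
    ultimately have "u (N0 + int j - 1) < 0" by (simp only: not_le)
    then show thesis using that[of "N0 + int j"] j by blast
  qed
  define ys where "ys = map (\<lambda>i. u (p + int i)) [0..<n]"
  have ys_range: "0 \<le> u (p + int i) \<and> u (p + int i) < real n" if "i < n" for i
  proof -
    have "u p \<le> u (p + int i)" using u_mono[of p "p + int i"] by (cases "i = 0") auto
    moreover have "u (p + int i) \<le> u (p - 1 + int n)"
    proof (cases "p + int i = p - 1 + int n")
      case True
      then show ?thesis by (simp only: order_refl)
    next
      case False
      then have "p + int i < p - 1 + int n" using that by linarith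
      then show ?thesis using u_mono less_imp_le by blast
    qed
    ultimately show ?thesis using p u_add[of "p - 1"] by linarith
  qed
  have sorted: "sorted_wrt (<) ys"
    unfolding ys_def sorted_wrt_map by (rule sorted_wrt_mono_rel[OF _ sorted_wrt_upt]) (auto intro: u_mono)
  have sub: "set ys \<subseteq> wrap n Y ` {..<n}"
  proof
    fix w assume "w \<in> set ys"
    then obtain i where i: "i < n" "w = u (p + int i)" by (auto simp: ys_def)
    obtain j where j: "j < n" "nat ((p + int i) mod int n) = r j"
      using inv[of "nat ((p + int i) mod int n)"] n0 by (auto simp: nat_less_iff)
    then have "w = Y j + real n * of_int ((p + int i) div int n)" using i vr by (simp add: u_def)
    then have "Y j rmod real n = w"
      using ys_range[OF i(1)] i n0
      by (intro rmod_eq_iff[where k = "- ((p + int i) div int n)"]) (auto simp: algebra_simps)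
    then show "w \<in> wrap n Y ` {..<n}" using j(1) by (auto simp: wrap_def image_iff)
  qed
  have inj: "inj_on (wrap n Y) {..<n}" using Y by (simp add: reg_configs_def)
  have "distinct ys" using sorted by (simp add: strict_sorted_iff)
  then have "card (set ys) = length ys" by (rule distinct_card)
  then have "card (set ys) = n" by (simp only: ys_def length_map length_upt diff_zero)
  \<comment> \<open>Inclusion suffices, since both sets have \<open>n\<close> elements.\<close>
  then have "set ys = wrap n Y ` {..<n}"
    using sub card_image[OF inj] by (intro card_subset_eq) auto
  then have ord: "ord_config n (wrap n Y) i = u (p + int i)" if "i < n" for i
    using ord_config_eqI[OF inj, of ys i] that sorted by (simp add: strict_sorted_iff ys_def)
  \<comment> \<open>\<open>u (p + i)\<close> belongs to the lifted crystal point
    \<open>\<tau> + m + p + i\<close>, so the sorted index \<open>i\<close> meets the crystal index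
    \<open>i + m + p\<close> modulo \<open>n\<close>.\<close>
  define k where "k = nat ((m + p) mod int n)"
  have k: "k < n" "int k = (m + p) mod int n" using n0 by (auto simp: k_def nat_less_iff)
  define b where "b = (\<lambda>q. (v q - (\<tau> + of_int m + real q))\<^sup>2)"
  have summand: "(per_abs n (ord_config n (wrap n Y) i - ord_config n C ((i + k) mod n)))\<^sup>2 \<le> b (nat ((p + int i) mod int n))"
    if i: "i < n" for i
  proof -
    define q where "q = (int i + m + p) div int n"
    define q' where "q' = (p + int i) div int n"
    have "int ((i + k) mod n) = (int i + (m + p)) mod int n"
      by (simp add: zmod_int k(2) mod_add_right_eq)
    also have "\<dots> = int i + m + p - int n * q"
      unfolding q_def using minus_mult_div_eq_mod[of "int i + m + p" "int n"] by (simp add: add.assoc)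
    finally have "real_of_int (int ((i + k) mod n)) = real_of_int (int i + m + p - int n * q)" by (simp only:)
    then have e1: "real ((i + k) mod n) = real i + of_int m + of_int p - real n * of_int q" by simp
    have "int (nat ((p + int i) mod int n)) = p + int i - int n * q'"
      unfolding q'_def using n0 minus_mult_div_eq_mod[of "p + int i" "int n"] by simp
    then have "real_of_int (int (nat ((p + int i) mod int n))) = real_of_int (p + int i - int n * q')" by (simp only:)
    then have e2: "real (nat ((p + int i) mod int n)) = of_int p + real i - real n * of_int q'"
      by (simp only: of_int_of_nat_eq of_int_add of_int_diff of_int_mult)
    have "per_abs n (ord_config n (wrap n Y) i - ord_config n C ((i + k) mod n)) \<le>
        \<bar>ord_config n (wrap n Y) i - ord_config n C ((i + k) mod n) + real n * of_int (- q)\<bar>"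
      by (rule per_abs_le)
    also have "ord_config n (wrap n Y) i - ord_config n C ((i + k) mod n) + real n * of_int (- q) =
        v (nat ((p + int i) mod int n)) - (\<tau> + of_int m + real (nat ((p + int i) mod int n)))"
      using n i by (simp add: ord C e1 e2 u_def q'_def[symmetric] algebra_simps)
    finally show ?thesis
      unfolding b_def using per_abs_nonneg by (metis abs_le_square_iff abs_of_nonneg)
  qed
  have "config_dist n (wrap n Y) C \<le> sqrt (\<Sum>i<n. (per_abs n (ord_config n (wrap n Y) i - ord_config n C ((i + k) mod n)))\<^sup>2)"
    unfolding config_dist_def using k by (intro Min_le) auto
  also have "\<dots> \<le> sqrt (\<Sum>i<n. b (nat ((p + int i) mod int n)))"
    using summand by (intro real_sqrt_le_mono sum_mono) auto
  \<comment> \<open>Rotation by \<open>p\<close> permutes the indices.\<close>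
  also have "(\<Sum>i<n. b (nat ((p + int i) mod int n))) = (\<Sum>q<n. b q)"
  proof (rule sum.reindex_bij_witness[of _ "\<lambda>q. nat ((int q - p) mod int n)" "\<lambda>i. nat ((p + int i) mod int n)"])
    fix i assume i: "i \<in> {..<n}"
    have "(int (nat ((p + int i) mod int n)) - p) mod int n = (p + int i - p) mod int n"
      using n0 by (simp add: mod_diff_left_eq)
    then show "nat ((int (nat ((p + int i) mod int n)) - p) mod int n) = i" using i by simp
  next
    fix q assume q: "q \<in> {..<n}"
    have "(p + int (nat ((int q - p) mod int n))) mod int n = (p + (int q - p)) mod int n"
      using n0 by (simp add: mod_add_right_eq)
    then show "nat ((p + int (nat ((int q - p) mod int n))) mod int n) = q" using q by simp
  qed (use n0 in \<open>auto simp: nat_less_iff\<close>)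
  also have "(\<Sum>q<n. b q) = (\<Sum>i<n. b (r i))" using r by (rule sum.reindex_bij_betw[symmetric])
  also have "\<dots> = (\<Sum>i<n. (Y i - (\<tau> + of_int m + real (r i)))\<^sup>2)"
    by (intro sum.cong refl) (simp add: b_def vr)
  finally show ?thesis .
qed

subsection \<open>Convergence to the crystal\<close>

lemma pair_interaction_pair_energy:
  assumes "0 < s" "s < 1 / 2" "L > 0"
  shows "periodic_pair_interaction L (pair_energy s L) (deriv (pair_energy s L)) (deriv (deriv (pair_energy s L)))"
  by unfold_locales
    (use assms in \<open>auto intro: pair_energy_even pair_energy_derivs deriv_pair_energy_periodic deriv2_pair_energy_periodic\<close>)

context
  fixes s :: real and \<Lambda> :: nat
  assumes s: "0 < s" "s < 1 / 2" and \<Lambda>: "\<Lambda> \<ge> 1"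
begin

interpretation P: periodic_pair_interaction "real \<Lambda>" "pair_energy s (real \<Lambda>)"
  "deriv (pair_energy s (real \<Lambda>))" "deriv (deriv (pair_energy s (real \<Lambda>)))"
  using s \<Lambda> by (intro pair_interaction_pair_energy) auto

lemma energy_eq_total_energy: "energy s \<Lambda> = P.total_energy \<Lambda>"
  using energy_eq_pair_energy[OF s \<Lambda>] by (intro ext) (simp add: P.total_energy_def)

lemma wrap_decomp: "wrap \<Lambda> X i = X i + of_int (- \<lfloor>X i / real \<Lambda>\<rfloor>) * real \<Lambda>"
  using \<Lambda> by (simp add: wrap_def rmod_def)

lemma diff_wrap: "\<exists>k :: int. wrap \<Lambda> X i - wrap \<Lambda> X j = X i - X j + of_int k * real \<Lambda>"
  unfolding wrap_decomp by (intro exI[of _ "\<lfloor>X j / real \<Lambda>\<rfloor> - \<lfloor>X i / real \<Lambda>\<rfloor>"]) (simp add: algebra_simps)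

lemma noncolliding_wrap: "P.noncolliding \<Lambda> (wrap \<Lambda> X) \<longleftrightarrow> P.noncolliding \<Lambda> X"
proof -
  have "(wrap \<Lambda> X i - wrap \<Lambda> X j) rmod real \<Lambda> = (X i - X j) rmod real \<Lambda>" for i j
    unfolding wrap_def by (rule rmod_diff)
  then show ?thesis by (simp add: P.noncolliding_def)
qed

lemma reg_configs_noncolliding:
  assumes "X \<in> reg_configs \<Lambda>"
  shows "P.noncolliding \<Lambda> X"
  unfolding P.noncolliding_def
proof (intro allI impI)
  fix i j assume ij: "i < \<Lambda>" "j < \<Lambda>" "i \<noteq> j"
  have "X i \<noteq> X j" using assms ij by (auto simp: reg_configs_def inj_on_def)
  moreover have "X i \<in> {0..<real \<Lambda>}" "X j \<in> {0..<real \<Lambda>}"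
    using assms ij by (auto simp: reg_configs_def configs_def Pi_iff)
  then have "\<bar>X i - X j\<bar> < \<bar>real \<Lambda>\<bar>" by auto
  ultimately show "(X i - X j) rmod real \<Lambda> \<noteq> 0"
    using rcong_imp_eq[of "X i" "X j" "real \<Lambda>"] by (auto simp: rcong_conv_diff_rmod_eq_0)
qed

lemma wrap_reg_configs:
  assumes "P.noncolliding \<Lambda> X"
  shows "wrap \<Lambda> X \<in> reg_configs \<Lambda>"
proof -
  have "wrap \<Lambda> X i \<in> {0..<real \<Lambda>}" for i
    using \<Lambda> by (simp add: wrap_def rmod_nonneg rmod_less)
  moreover have "inj_on (wrap \<Lambda> X) {..<\<Lambda>}"
  proof -
    have "P.noncolliding \<Lambda> (wrap \<Lambda> X)" using assms noncolliding_wrap by blast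
    then show ?thesis unfolding P.noncolliding_def inj_on_def by (metis diff_self lessThan_iff rmod_0)
  qed
  ultimately show ?thesis by (auto simp: reg_configs_def configs_def)
qed

lemma hess_form_wrap: "P.hess_form \<Lambda> (wrap \<Lambda> X) h = P.hess_form \<Lambda> X h"
proof -
  have "deriv (deriv (pair_energy s (real \<Lambda>))) (wrap \<Lambda> X i - wrap \<Lambda> X j) =
      deriv (deriv (pair_energy s (real \<Lambda>))) (X i - X j)" for i j
    using diff_wrap[of X i j] periodic_of_int[of "deriv (deriv (pair_energy s (real \<Lambda>)))", OF P.f_periodic] by auto
  then show ?thesis by (simp add: P.hess_form_def)
qed

text \<open>\<open>hessian_bound\<close> covers only entries in \<open>(0, \<Lambda>)\<close>. The
  form depends on differences modulo \<Lambda> alone, so any collision-free lift may be translated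
  off the cut and wrapped.\<close>

lemma hessian_bound_hess_form:
  assumes hb: "hessian_bound s \<gamma>" and X: "P.noncolliding \<Lambda> X" and h: "(\<Sum>i<\<Lambda>. h i) = 0"
  shows "P.hess_form \<Lambda> X h \<ge> \<gamma> * real \<Lambda> powr (- 2 * s) * (\<Sum>i<\<Lambda>. (h i)\<^sup>2)"
proof -
  \<comment> \<open>Only finitely many translations put some particle at the cut 0.\<close>
  have "infinite ({0..<real \<Lambda>} - (\<lambda>i. (- X i) rmod real \<Lambda>) ` {..<\<Lambda>})"
    using \<Lambda> by (intro Diff_infinite_finite infinite_Ico) auto
  then obtain \<delta> where \<delta>: "\<delta> \<in> {0..<real \<Lambda>}" "\<delta> \<notin> (\<lambda>i. (- X i) rmod real \<Lambda>) ` {..<\<Lambda>}"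
    by (metis DiffD1 DiffD2 ex_in_conv finite.emptyI)
  define Z where "Z = (\<lambda>i. X i + \<delta>)"
  have Z: "P.noncolliding \<Lambda> Z" using X by (simp add: P.noncolliding_def Z_def)
  have pos: "0 < wrap \<Lambda> Z i" if "i < \<Lambda>" for i
  proof -
    have "(X i + \<delta>) rmod real \<Lambda> \<noteq> 0"
    proof
      assume "(X i + \<delta>) rmod real \<Lambda> = 0"
      then have "X i + \<delta> = of_int \<lfloor>(X i + \<delta>) / real \<Lambda>\<rfloor> * real \<Lambda>" using \<Lambda> by (simp add: rmod_def mult.commute)
      then have "(- X i) rmod real \<Lambda> = \<delta>"
        using \<delta>(1) \<Lambda> by (intro rmod_eq_iff[where k = "- \<lfloor>(X i + \<delta>) / real \<Lambda>\<rfloor>"]) auto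
      then show False using \<delta>(2) that by auto
    qed
    then show ?thesis using rmod_nonneg[of "real \<Lambda>" "X i + \<delta>"] \<Lambda> by (simp add: wrap_def Z_def)
  qed
  have "(\<Sum>i<\<Lambda>. \<Sum>j<\<Lambda>. partial i (partial j (energy s \<Lambda>)) (wrap \<Lambda> Z) * h j * h i)
      \<ge> \<gamma> * real \<Lambda> powr (- 2 * s) * (\<Sum>i<\<Lambda>. (h i)\<^sup>2)"
    using hb \<Lambda> wrap_reg_configs[OF Z] pos h unfolding hessian_bound_def by blast
  moreover have "(\<Sum>i<\<Lambda>. \<Sum>j<\<Lambda>. partial i (partial j (energy s \<Lambda>)) (wrap \<Lambda> Z) * h j * h i) = P.hess_form \<Lambda> X h"
    unfolding energy_eq_total_energy
    using P.hessian_eq_hess_form[of \<Lambda> "wrap \<Lambda> Z" h] Z by (simp add: noncolliding_wrap hess_form_wrap) (simp add: P.hess_form_def Z_def)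
  ultimately show ?thesis by simp
qed

lemma energy_hessian_ge:
  assumes X: "X \<in> reg_configs \<Lambda>" and h: "(\<Sum>i<\<Lambda>. h i) = 0"
  shows "(\<Sum>i<\<Lambda>. \<Sum>j<\<Lambda>. partial i (partial j (energy s \<Lambda>)) X * h j * h i) \<ge> 2 * real \<Lambda> powr (- 2 * s) * (\<Sum>i<\<Lambda>. (h i)\<^sup>2)"
proof -
  have L: "real \<Lambda> > 0" using \<Lambda> by simp
  have nc: "P.noncolliding \<Lambda> X" using X by (rule reg_configs_noncolliding)
  \<comment> \<open>The extra factor is the number of particles in
    \<open>hess_form_ge\<close>.\<close>
  have "real \<Lambda> powr (- 1 - 2 * s) * real \<Lambda> = real \<Lambda> powr (- 2 * s)"
    using L by (simp add: powr_mult_base mult.commute)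
  then have "2 * real \<Lambda> powr (- 2 * s) * (\<Sum>i<\<Lambda>. (h i)\<^sup>2) = 2 * real \<Lambda> powr (- 1 - 2 * s) * real \<Lambda> * (\<Sum>i<\<Lambda>. (h i)\<^sup>2)"
    by simp
  also have "\<dots> \<le> P.hess_form \<Lambda> X h"
    using pair_energy_derivs(3)[OF s L] h by (intro P.hess_form_ge[OF nc]) auto
  finally show ?thesis
    unfolding energy_eq_total_energy P.hessian_eq_hess_form[OF nc] .
qed

lemma gradient_flow_decay:
  assumes X0: "X0 \<in> reg_configs \<Lambda>" and C: "C \<in> crystals \<Lambda>" and bar: "bar \<Lambda> C = bar \<Lambda> X0"
    and hb: "hessian_bound s \<gamma>" and flow: "gradient_flow s \<Lambda> X0 X" and t: "t \<ge> 0"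
  shows "config_dist \<Lambda> (wrap \<Lambda> (X t)) C \<le> config_dist \<Lambda> X0 C * exp (- \<gamma> * real \<Lambda> powr (- 2 * s) * t)"
proof -
  define L where "L = real \<Lambda>"
  have L: "L > 0" using \<Lambda> by (simp add: L_def)
  define \<kappa> where "\<kappa> = \<gamma> * real \<Lambda> powr (- 2 * s)"
  obtain \<tau> where Ci: "inj_on C {..<\<Lambda>}" and C\<tau>: "C ` {..<\<Lambda>} = (\<lambda>j. real j + \<tau>) ` {..<\<Lambda>}"
    using C by (auto simp: crystals_def reg_configs_def)
  have ordC: "ord_config \<Lambda> C i = real i + \<tau>" if "i < \<Lambda>" for i by (rule crystal_ord_config[OF Ci C\<tau> that])
  obtain m :: int where "(\<Sum>i<\<Lambda>. X0 i) = (\<Sum>i<\<Lambda>. C i) + of_int m * L"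
    using bar unfolding bar_eq_iff[OF \<Lambda>] L_def by blast
  then have sum0: "(\<Sum>i<\<Lambda>. X0 i) = real \<Lambda> * (\<tau> + of_int m) + real \<Lambda> * (real \<Lambda> - 1) / 2"
    unfolding crystal_sum[OF Ci C\<tau>] by (simp add: L_def algebra_simps)
  have X0i: "inj_on X0 {..<\<Lambda>}" using X0 by (simp add: reg_configs_def)
  obtain r where r: "bij_betw r {..<\<Lambda>} {..<\<Lambda>}" "\<And>i. i < \<Lambda> \<Longrightarrow> X0 i = ord_config \<Lambda> X0 (r i)"
    using rank_exists[OF X0i] by blast
  have r_less: "r i < \<Lambda>" if "i < \<Lambda>" for i using r(1) that by (auto simp: bij_betw_def)
  \<comment> \<open>The lift of the crystal: each particle gets the site of its rank, and
    \<open>m\<close> adjusts the sum of positions to that of \<open>X0\<close>.\<close>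
  define c where "c = (\<lambda>i. \<tau> + of_int m + real (r i))"
  have X0c: "X 0 i = X0 i" if "i < \<Lambda>" for i using flow that by (simp add: gradient_flow_def)
  have reg: "wrap \<Lambda> (X t) \<in> reg_configs \<Lambda>" if "t \<ge> 0" for t using flow that by (simp add: gradient_flow_def)
  have nc: "P.noncolliding \<Lambda> (X t)" if "t \<ge> 0" for t
    using reg_configs_noncolliding[OF reg[OF that]] by (simp add: noncolliding_wrap)
  have D: "((\<lambda>r. X r i) has_real_derivative - P.force \<Lambda> (X t) i) (at t within {0..})" if "t \<ge> 0" "i < \<Lambda>" for t i
  proof -
    have "((\<lambda>r. X r i) has_real_derivative - partial i (energy s \<Lambda>) (X t)) (at t within {0..})"
      using flow that unfolding gradient_flow_def by blast
    then show ?thesis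
      using P.partial_total_energy[OF nc[OF that(1)] that(2)] by (simp only: energy_eq_total_energy)
  qed
  have ordered: "X0 i < X0 j \<and> X0 j < X0 i + L" if "i < \<Lambda>" "j < \<Lambda>" "r i < r j" for i j
  proof -
    have "X0 i < X0 j" using r(2) that r_less ord_config_strict_mono[OF X0i that(3) r_less[OF that(2)]] by simp
    moreover have "X0 i \<in> {0..<L}" "X0 j \<in> {0..<L}"
      using X0 that by (auto simp: reg_configs_def configs_def Pi_iff L_def)
    ultimately show ?thesis by auto
  qed
  have c_ordered: "0 < c j - c i \<and> c j - c i < L" if "i < \<Lambda>" "j < \<Lambda>" "r i < r j" for i j
    using that r_less[of i] r_less[of j] by (auto simp: c_def L_def)
  have ch0: "P.same_chamber \<Lambda> (X 0) c"
    unfolding P.same_chamber_def unfolding L_def[symmetric]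
  proof (intro allI impI)
    fix i j assume ij: "i < \<Lambda>" "j < \<Lambda>" "i \<noteq> j"
    then have "r i \<noteq> r j" using r(1) by (auto simp: bij_betw_def inj_on_def)
    then consider "r i < r j" | "r j < r i" by linarith
    \<comment> \<open>Both differences have the sign of \<open>r i - r j\<close> and modulus below
      \<open>L\<close>, hence \<open>k = - 1\<close> or \<open>k = 0\<close>.\<close>
    then show "\<exists>k :: int. X 0 i - X 0 j \<in> {of_int k * L<..<of_int (k + 1) * L} \<and> c i - c j \<in> {of_int k * L<..<of_int (k + 1) * L}"
    proof cases
      case 1
      then show ?thesis using ordered[of i j] c_ordered[of i j] ij by (intro exI[of _ "- 1"]) (auto simp: X0c)
    next
      case 2
      then show ?thesis using ordered[of j i] c_ordered[of j i] ij by (intro exI[of _ 0]) (auto simp: X0c)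
    qed
  qed
  have sumr: "(\<Sum>i<\<Lambda>. real (r i)) = real \<Lambda> * (real \<Lambda> - 1) / 2"
    using sum.reindex_bij_betw[OF r(1), of real] by (simp add: real_sum_lessThan)
  have sum: "(\<Sum>i<\<Lambda>. X 0 i) = (\<Sum>i<\<Lambda>. c i)"
    using sum0 sumr by (simp add: X0c c_def sum.distrib)
  have crit: "P.force \<Lambda> c i = 0" if "i < \<Lambda>" for i
    unfolding c_def by (rule P.lattice_force_eq_0[OF refl r(1) that])
  have hess: "P.hess_form \<Lambda> Y h \<ge> \<kappa> * (\<Sum>i<\<Lambda>. (h i)\<^sup>2)" if "P.noncolliding \<Lambda> Y" "(\<Sum>i<\<Lambda>. h i) = 0" for Y h
    unfolding \<kappa>_def by (rule hessian_bound_hess_form[OF hb that])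
  have decay: "P.same_chamber \<Lambda> (X t) c"
    "(\<Sum>i<\<Lambda>. (X t i - c i)\<^sup>2) \<le> (\<Sum>i<\<Lambda>. (X 0 i - c i)\<^sup>2) * exp (- 2 * \<kappa> * t)"
    by (rule P.gradient_descent_decay[OF D nc ch0 sum crit hess t]; assumption)+
  \<comment> \<open>The crystal difference lies in \<open>(0, L)\<close>, which forces
    \<open>k = 0\<close> for the evolved configuration too: the cyclic order is the initial
    one.\<close>
  have ch: "X t i < X t j \<and> X t j < X t i + real \<Lambda>" if ij: "i < \<Lambda>" "j < \<Lambda>" "r i < r j" for i j
  proof -
    obtain k :: int where k: "X t j - X t i \<in> {of_int k * L<..<of_int (k + 1) * L}" "c j - c i \<in> {of_int k * L<..<of_int (k + 1) * L}"
      using decay(1) ij unfolding P.same_chamber_def L_def by (metis less_irrefl)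
    have "of_int k * L < 1 * L" "0 * L < of_int (k + 1) * L" using k(2) c_ordered[OF ij] unfolding greaterThanLessThan_iff by linarith+
    then have "real_of_int k < 1" "0 < real_of_int (k + 1)" using L by (simp_all only: mult_less_cancel_right_pos)
    then have "k = 0" by linarith
    then show ?thesis using k(1) by (auto simp: L_def)
  qed
  have "config_dist \<Lambda> (wrap \<Lambda> (X t)) C \<le> sqrt (\<Sum>i<\<Lambda>. (X t i - c i)\<^sup>2)"
    unfolding c_def by (rule config_dist_wrap_le[OF \<Lambda> reg[OF t] ordC r(1) ch])
  also have "\<dots> \<le> sqrt ((\<Sum>i<\<Lambda>. (X 0 i - c i)\<^sup>2) * exp (- 2 * \<kappa> * t))"
    using decay(2) by (rule real_sqrt_le_mono)
  also have "\<dots> = sqrt (\<Sum>i<\<Lambda>. (X0 i - c i)\<^sup>2) * exp (- \<kappa> * t)"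
  proof -
    have "exp (- 2 * \<kappa> * t) = (exp (- \<kappa> * t))\<^sup>2" by (simp add: power2_eq_square exp_add[symmetric])
    then have "sqrt (exp (- 2 * \<kappa> * t)) = exp (- \<kappa> * t)" by (simp only: real_sqrt_abs abs_exp_cancel)
    then show ?thesis by (simp add: real_sqrt_mult X0c)
  qed
  also have "\<dots> \<le> config_dist \<Lambda> X0 C * exp (- \<kappa> * t)"
    using config_dist_ge[OF \<Lambda> X0 ordC sum0 r] unfolding c_def by (intro mult_right_mono) auto
  finally show ?thesis by (simp add: \<kappa>_def)
qed

end

lemma hessian_bound_2:
  assumes "0 < s" "s < 1 / 2"
  shows "hessian_bound s 2"
  unfolding hessian_bound_def using energy_hessian_ge[OF assms] by blast

section \<open>Crystals with a prescribed barycenter\<close>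

lemma crystal_same_bar_exists:
  assumes \<Lambda>: "\<Lambda> \<ge> 1"
  shows "\<exists>C\<in>crystals \<Lambda>. bar \<Lambda> C = bar \<Lambda> X"
proof -
  \<comment> \<open>The offset solving the equation of \<open>crystal_sum\<close>; its integer part
    shifts the sum by multiples of \<Lambda>, which the barycenter does not see.\<close>
  define \<sigma> where "\<sigma> = ((\<Sum>i<\<Lambda>. X i) - real \<Lambda> * (real \<Lambda> - 1) / 2) / real \<Lambda>"
  define C where "C = (\<lambda>j. real j + frac \<sigma>)"
  have inj: "inj_on C {..<\<Lambda>}" by (auto simp: C_def inj_on_def)
  have "real j + frac \<sigma> < real \<Lambda>" if "j < \<Lambda>" for j
  proof -
    have "real j + 1 \<le> real \<Lambda>" using that by linarith
    then show ?thesis using frac_lt_1[of \<sigma>] by linarith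
  qed
  then have "C \<in> reg_configs \<Lambda>" using inj by (auto simp: reg_configs_def configs_def C_def)
  then have C: "C \<in> crystals \<Lambda>"
    unfolding crystals_def using frac_lt_1[of \<sigma>] by (auto simp: C_def intro!: bexI[of _ "frac \<sigma>"])
  have "(\<Sum>i<\<Lambda>. C i) = real \<Lambda> * frac \<sigma> + real \<Lambda> * (real \<Lambda> - 1) / 2"
    by (rule crystal_sum[OF inj]) (simp add: C_def)
  then have "(\<Sum>i<\<Lambda>. X i) = (\<Sum>i<\<Lambda>. C i) + of_int \<lfloor>\<sigma>\<rfloor> * real \<Lambda>"
  proof -
    have "real \<Lambda> * \<sigma> = (\<Sum>i<\<Lambda>. X i) - real \<Lambda> * (real \<Lambda> - 1) / 2" using \<Lambda> by (simp add: \<sigma>_def)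
    moreover have "real \<Lambda> * frac \<sigma> = real \<Lambda> * \<sigma> - of_int \<lfloor>\<sigma>\<rfloor> * real \<Lambda>"
      by (simp add: frac_def algebra_simps)
    ultimately show ?thesis using \<open>(\<Sum>i<\<Lambda>. C i) = _\<close> by linarith
  qed
  then have "bar \<Lambda> C = bar \<Lambda> X" unfolding bar_eq_iff[OF \<Lambda>] by blast
  then show ?thesis using C by blast
qed

text \<open>Equal barycenters make the two offsets differ by an integer, and both lie in
  \<open>[0, 1)\<close>. So the sets of entries agree, and matching equal entries gives the
  permutation.\<close>

lemma crystal_same_bar_unique:
  assumes \<Lambda>: "\<Lambda> \<ge> 1" and C: "C \<in> crystals \<Lambda>" and Z: "Z \<in> crystals \<Lambda>" and bar: "bar \<Lambda> C = bar \<Lambda> Z"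
  shows "\<exists>\<pi>. \<pi> permutes {..<\<Lambda>} \<and> (\<forall>i<\<Lambda>. Z i = C (\<pi> i))"
proof -
  obtain \<tau> where Ci: "inj_on C {..<\<Lambda>}" and \<tau>: "\<tau> \<in> {0..<1}" "C ` {..<\<Lambda>} = (\<lambda>j. real j + \<tau>) ` {..<\<Lambda>}"
    using C by (auto simp: crystals_def reg_configs_def)
  obtain \<sigma> where Zi: "inj_on Z {..<\<Lambda>}" and \<sigma>: "\<sigma> \<in> {0..<1}" "Z ` {..<\<Lambda>} = (\<lambda>j. real j + \<sigma>) ` {..<\<Lambda>}"
    using Z by (auto simp: crystals_def reg_configs_def)
  obtain k :: int where "real \<Lambda> * \<sigma> = real \<Lambda> * \<tau> + of_int k * real \<Lambda>"
    using bar unfolding bar_eq_iff[OF \<Lambda>] crystal_sum[OF Ci \<tau>(2)] crystal_sum[OF Zi \<sigma>(2)] by auto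
  then have "real \<Lambda> * \<sigma> = real \<Lambda> * (\<tau> + of_int k)" by (simp add: algebra_simps)
  then have k: "\<sigma> = \<tau> + of_int k" using \<Lambda> by simp
  then have "real_of_int k < 1" "real_of_int k > - 1" using \<tau> \<sigma> by auto
  then have "k = 0" by linarith
  then have eq: "Z ` {..<\<Lambda>} = C ` {..<\<Lambda>}" using k \<tau> \<sigma> by simp
  have bC: "bij_betw C {..<\<Lambda>} (C ` {..<\<Lambda>})" using Ci by (simp add: bij_betw_def)
  have bZ: "bij_betw Z {..<\<Lambda>} (C ` {..<\<Lambda>})" using Zi eq by (simp add: bij_betw_def)
  define \<rho> where "\<rho> = inv_into {..<\<Lambda>} C \<circ> Z"
  have b\<rho>: "bij_betw \<rho> {..<\<Lambda>} {..<\<Lambda>}" unfolding \<rho>_def by (rule bij_betw_trans[OF bZ bij_betw_inv_into[OF bC]])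
  define \<pi> where "\<pi> = (\<lambda>i. if i < \<Lambda> then \<rho> i else i)"
  have "bij_betw \<pi> {..<\<Lambda>} {..<\<Lambda>}" using b\<rho> by (rule bij_betw_cong[THEN iffD1, rotated]) (simp add: \<pi>_def)
  then have "\<pi> permutes {..<\<Lambda>}" by (rule bij_imp_permutes) (simp add: \<pi>_def)
  moreover have "Z i = C (\<pi> i)" if "i < \<Lambda>" for i
    unfolding \<pi>_def \<rho>_def using that eq by (auto intro!: f_inv_into_f[symmetric])
  ultimately show ?thesis by blast
qed

text \<open>The existence clauses for \<open>\<gamma>\<close> and \<open>Xinf\<close> show that the
  constants and limits in the decay estimate do exist; the estimate itself is proved for every
  admissible \<open>\<gamma>\<close>, not only for 2.\<close>

theorem proposition4p3:
  fixes s :: real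
  assumes "0 < s" and "s < 1 / 2"
  shows "(\<exists>\<gamma>>0. hessian_bound s \<gamma>) \<and>
    (\<forall>\<Lambda>\<ge>1. \<forall>X0\<in>reg_configs \<Lambda>.
      (\<exists>Xinf\<in>crystals \<Lambda>. bar \<Lambda> Xinf = bar \<Lambda> X0) \<and>
      (\<forall>Xinf\<in>crystals \<Lambda>. bar \<Lambda> Xinf = bar \<Lambda> X0 \<longrightarrow>
        (\<forall>Z\<in>crystals \<Lambda>. bar \<Lambda> Z = bar \<Lambda> X0 \<longrightarrow>
           (\<exists>\<pi>. \<pi> permutes {..<\<Lambda>} \<and> (\<forall>i<\<Lambda>. Z i = Xinf (\<pi> i)))) \<and>
        (\<forall>\<gamma>>0. hessian_bound s \<gamma> \<longrightarrow>
          (\<forall>X. gradient_flow s \<Lambda> X0 X \<longrightarrow>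
            (\<forall>t\<ge>0. config_dist \<Lambda> (wrap \<Lambda> (X t)) Xinf
               \<le> config_dist \<Lambda> X0 Xinf * exp (- \<gamma> * real \<Lambda> powr (- 2 * s) * t))))))"
proof (intro conjI allI ballI impI)
  show "\<exists>\<gamma>>0. hessian_bound s \<gamma>" using hessian_bound_2[OF assms] by (intro exI[of _ 2]) simp
next
  fix \<Lambda> :: nat and X0 assume "1 \<le> \<Lambda>"
  then show "\<exists>Xinf\<in>crystals \<Lambda>. bar \<Lambda> Xinf = bar \<Lambda> X0" by (rule crystal_same_bar_exists)
next
  fix \<Lambda> :: nat and X0 C Z
  assume "1 \<le> \<Lambda>" "C \<in> crystals \<Lambda>" "bar \<Lambda> C = bar \<Lambda> X0" "Z \<in> crystals \<Lambda>" "bar \<Lambda> Z = bar \<Lambda> X0"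
  then show "\<exists>\<pi>. \<pi> permutes {..<\<Lambda>} \<and> (\<forall>i<\<Lambda>. Z i = C (\<pi> i))"
    by (intro crystal_same_bar_unique) auto
qed (rule gradient_flow_decay[OF assms])

end
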